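(* The properadic graphical category $\mathbf G$ may be identified with the subcategory of $\mathbf U_{/\mathfrak o}$ with (1) objects the acyclic directed graphs, and (2) morphisms those $\varphi=(\bar\varphi_0,\hat\varphi)\colon G\to G'$ (with $G,G'$ acyclic) such that $\hat\varphi(G):=\hat\varphi([\mathrm{id}_G])\in\mathrm{sSb}(G')$. That is, these objects and morphisms form a subcategory of $\mathbf U_{/\mathfrak o}$, and it is isomorphic to $\mathbf G$ by an isomorphism of categories which is the identity on objects and does not change the edge function $\bar\varphi_0$ of a morphism.
   Context: **Directed graphs.** A directed graph $G$ consists of finite sets $E_G,I_G,V_G,O_G$, inclusions $I_G,O_G\subseteq E_G$ and functions $I_G\to V_G$, $O_G\to V_G$. For $v\in V_G$, $\mathrm{in}(v)\subseteq I_G$ and $\mathrm{out}(v)\subseteq O_G$ are the preimages of $v$; $\mathrm{in}(G)=E_G\setminus O_G$, $\mathrm{out}(G)=E_G\setminus I_G$. Connected means non-empty and not a disjoint union of two non-empty directed graphs. An étale map is a natural transformation of diagrams $(E,I,V,O)$ such that the squares for $I\to V$ and $O\to V$ are pullbacks; an embedding is an étale map between connected directed graphs that is injective on vertices. $\mathrm{Emb}(G)$ is the set of classes $[f]$ of embeddings with codomain $G$ ($f\sim h$ iff $f=hz$, $z$ an isomorphism), ordered by $[h]\le[k]$ iff $h=kj$ for some embedding $j$. A class $[f\colon H\to G]$ is an edge if $V_H=\varnothing$ (so $E_H$ is a point). $\mathbb NS$ is the free commutative monoid on $S$; $\mathrm{in}([f])=\sum_{e\in\mathrm{in}(H)}f(e)$,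 $\mathrm{out}([f])=\sum_{e\in\mathrm{out}(H)}f(e)$ in $\mathbb NE_G$. **$\mathbf U_{/\mathfrak o}$ (oriented graphical category).** Objects are connected directed graphs. A morphism $G\to G'$ is a pair of functions $\bar\varphi_0\colon E_G\to E_{G'}$, $\hat\varphi\colon\mathrm{Emb}(G)\to\mathrm{Emb}(G')$ such that: (i) $\hat\varphi$ sends edges to edges; (ii) if $[\ell]$ is a union of $[h]$ and $[k]$, then $\hat\varphi[\ell]$ is a union of $\hat\varphi[h]$ and $\hat\varphi[k]$; (iii) $\hat\varphi$ takes vertex disjoint pairs to vertex disjoint pairs; (iv) $\mathrm{in}(\hat\varphi[h])=(\mathbb N\bar\varphi_0)(\mathrm{in}[h])$ and $\mathrm{out}(\hat\varphi[h])=(\mathbb N\bar\varphi_0)(\mathrm{out}[h])$ for all $[h]$. Here $\ell\colon L\to G$ is a union of $h\colon H\to G$ and $k\colon K\to G$ if $[h],[k]\le[\ell]$ and $\ell(V_L)=h(V_H)\cup k(V_K)$; $h,k$ are vertex disjoint if $h(V_H)\cap k(V_K)=\varnothing$. Composition is composition of pairs of functions. **Acyclic graphs and structured subgraphs.** A directed path in $G$ is a sequence $e_0v_1e_1\cdots v_ne_n$ ($n\ge0$) of edges and vertices with $e_{i-1}\in\mathrm{in}(v_i)$ and $e_i\in\mathrm{out}(v_i)$. $G$ is acyclic if it is connected and no directed path with $n\ge1$ has $e_0=e_n$. For $G$ acyclic, an embedding $h\colon H\to G$ is a convex inclusion if it is injective (on edges and vertices) and every directed path in $G$ whose first and last edges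 are in the image of $h$ has all its edges and vertices in the image of $h$. $\mathrm{sSb}(G)\subseteq\mathrm{Emb}(G)$ is the set of classes of convex inclusions (structured subgraphs); a structured subgraph $H$ is identified with the pair of subsets $E_H\subseteq E_G$, $V_H\subseteq V_G$ (its image). For $H_1,H_2\in\mathrm{sSb}(G)$, $H_1\cup H_2$ is the subgraph with $E_{H_1}\cup E_{H_2}$ and $V_{H_1}\cup V_{H_2}$, which may or may not be in $\mathrm{sSb}(G)$. **$\mathbf G$ (properadic graphical category).** Objects are the acyclic directed graphs. A morphism $G\to G'$ is a pair of functions $\bar\varphi_0\colon E_G\to E_{G'}$ and $\check\varphi\colon\mathrm{sSb}(G)\to\mathrm{sSb}(G')$ such that (1) $\mathrm{in}(\check\varphi(H))=(\mathbb N\bar\varphi_0)(\mathrm{in}(H))$ and $\mathrm{out}(\check\varphi(H))=(\mathbb N\bar\varphi_0)(\mathrm{out}(H))$ in $\mathbb NE_{G'}$ for all $H\in\mathrm{sSb}(G)$; (2) if $H_1,H_2,H_1\cup H_2\in\mathrm{sSb}(G)$, then $\check\varphi(H_1\cup H_2)=\check\varphi(H_1)\cup\check\varphi(H_2)$. Composition is composition of pairs. *)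

theory Defs
  imports "HOL-Library.Multiset" "HOL-Library.FuncSet" "HOL-Library.Infinite_Typeclass"
begin

section \<open>Categories\<close>

text \<open>
  Composition and identities take the objects involved as arguments, and hom-sets of different
  pairs of objects may overlap: a morphism need not determine its source and target.
  \<open>Comp C A B D g f\<close> is the composite of \<open>f : A \<rightarrow> B\<close> and \<open>g : B \<rightarrow> D\<close>.
\<close>

record ('o, 'm) cat =
  Ob :: "'o set"
  Hom :: "'o \<Rightarrow> 'o \<Rightarrow> 'm set"
  Id :: "'o \<Rightarrow> 'm"
  Comp :: "'o \<Rightarrow> 'o \<Rightarrow> 'o \<Rightarrow> 'm \<Rightarrow> 'm \<Rightarrow> 'm"

locale category =
  fixes C :: "('o, 'm) cat"
  assumes Id_in_Hom: "A \<in> Ob C \<Longrightarrow> Id C A \<in> Hom C A A"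
    and Comp_in_Hom: "\<lbrakk>A \<in> Ob C; B \<in> Ob C; D \<in> Ob C; f \<in> Hom C A B; g \<in> Hom C B D\<rbrakk>
          \<Longrightarrow> Comp C A B D g f \<in> Hom C A D"
    and Comp_Id_right: "\<lbrakk>A \<in> Ob C; B \<in> Ob C; f \<in> Hom C A B\<rbrakk> \<Longrightarrow> Comp C A A B f (Id C A) = f"
    and Comp_Id_left: "\<lbrakk>A \<in> Ob C; B \<in> Ob C; f \<in> Hom C A B\<rbrakk> \<Longrightarrow> Comp C A B B (Id C B) f = f"
    and Comp_assoc: "\<lbrakk>A \<in> Ob C; B \<in> Ob C; D \<in> Ob C; F \<in> Ob C;
            f \<in> Hom C A B; g \<in> Hom C B D; h \<in> Hom C D F\<rbrakk>
          \<Longrightarrow> Comp C A D F h (Comp C A B D g f) = Comp C A B F (Comp C B D F h g) f"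

locale subcategory = category C
  for C :: "('o, 'm) cat" and obs :: "'o set" and homs :: "'o \<Rightarrow> 'o \<Rightarrow> 'm set" +
  assumes obs_subset: "obs \<subseteq> Ob C"
    and homs_subset: "\<lbrakk>A \<in> obs; B \<in> obs\<rbrakk> \<Longrightarrow> homs A B \<subseteq> Hom C A B"
    and Id_in_homs: "A \<in> obs \<Longrightarrow> Id C A \<in> homs A A"
    and Comp_in_homs: "\<lbrakk>A \<in> obs; B \<in> obs; D \<in> obs; f \<in> homs A B; g \<in> homs B D\<rbrakk>
          \<Longrightarrow> Comp C A B D g f \<in> homs A D"

definition subcat :: "('o, 'm) cat \<Rightarrow> 'o set \<Rightarrow> ('o \<Rightarrow> 'o \<Rightarrow> 'm set) \<Rightarrow> ('o, 'm) cat" where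
  "subcat C obs homs = C\<lparr>Ob := obs, Hom := homs\<rparr>"

locale cat_functor = C: category C + D: category D
  for C :: "('o, 'm) cat" and D :: "('p, 'n) cat"
    and Fo :: "'o \<Rightarrow> 'p" and Fm :: "'o \<Rightarrow> 'o \<Rightarrow> 'm \<Rightarrow> 'n" +
  assumes Fo_in_Ob: "A \<in> Ob C \<Longrightarrow> Fo A \<in> Ob D"
    and Fm_in_Hom: "\<lbrakk>A \<in> Ob C; B \<in> Ob C; f \<in> Hom C A B\<rbrakk> \<Longrightarrow> Fm A B f \<in> Hom D (Fo A) (Fo B)"
    and Fm_Id: "A \<in> Ob C \<Longrightarrow> Fm A A (Id C A) = Id D (Fo A)"
    and Fm_Comp: "\<lbrakk>A \<in> Ob C; B \<in> Ob C; E \<in> Ob C; f \<in> Hom C A B; g \<in> Hom C B E\<rbrakk>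
          \<Longrightarrow> Fm A E (Comp C A B E g f) = Comp D (Fo A) (Fo B) (Fo E) (Fm B E g) (Fm A B f)"

locale cat_isomorphism = cat_functor C D Fo Fm
  for C :: "('o, 'm) cat" and D :: "('p, 'n) cat"
    and Fo :: "'o \<Rightarrow> 'p" and Fm :: "'o \<Rightarrow> 'o \<Rightarrow> 'm \<Rightarrow> 'n" +
  assumes has_inverse: "\<exists>Go Gm. cat_functor D C Go Gm
      \<and> (\<forall>A \<in> Ob C. Go (Fo A) = A)
      \<and> (\<forall>X \<in> Ob D. Fo (Go X) = X)
      \<and> (\<forall>A \<in> Ob C. \<forall>B \<in> Ob C. \<forall>f \<in> Hom C A B. Gm (Fo A) (Fo B) (Fm A B f) = f)
      \<and> (\<forall>X \<in> Ob D. \<forall>Y \<in> Ob D. \<forall>g \<in> Hom D X Y. Fm (Go X) (Go Y) (Gm X Y g) = g)"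


section \<open>Directed graphs\<close>

text \<open>
  All graphs have their edges and vertices in fixed types \<open>'e\<close> and \<open>'v\<close>. For infinite \<open>'e\<close> and
  \<open>'v\<close> every finite directed graph is isomorphic to one of these, so nothing is lost by letting
  the domains of embeddings range over such graphs only. All functions are extensional
  (\<open>undefined\<close> off their domain), so that equality of functions between the given sets is
  equality in HOL.

  An edge in \<open>iedges G\<close> is an input of the vertex \<open>ivert G e\<close>; an edge in \<open>oedges G\<close> is an
  output of the vertex \<open>overt G e\<close>.
\<close>

record ('e, 'v) digraph =
  edges :: "'e set"
  iedges :: "'e set"
  oedges :: "'e set"
  verts :: "'v set"
  ivert :: "'e \<Rightarrow> 'v"
  overt :: "'e \<Rightarrow> 'v"

definition digraph :: "('e, 'v) digraph \<Rightarrow> bool" where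
  "digraph G \<longleftrightarrow> finite (edges G) \<and> finite (verts G)
     \<and> iedges G \<subseteq> edges G \<and> oedges G \<subseteq> edges G
     \<and> ivert G \<in> iedges G \<rightarrow>\<^sub>E verts G \<and> overt G \<in> oedges G \<rightarrow>\<^sub>E verts G"

definition in_vert :: "('e, 'v) digraph \<Rightarrow> 'v \<Rightarrow> 'e set" where
  "in_vert G v = {e \<in> iedges G. ivert G e = v}"

definition out_vert :: "('e, 'v) digraph \<Rightarrow> 'v \<Rightarrow> 'e set" where
  "out_vert G v = {e \<in> oedges G. overt G e = v}"

definition in_graph :: "('e, 'v) digraph \<Rightarrow> 'e set" where
  "in_graph G = edges G - oedges G"

definition out_graph :: "('e, 'v) digraph \<Rightarrow> 'e set" where
  "out_graph G = edges G - iedges G"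

definition nonempty_digraph :: "('e, 'v) digraph \<Rightarrow> bool" where
  "nonempty_digraph G \<longleftrightarrow> edges G \<noteq> {} \<or> verts G \<noteq> {}"

definition disjoint_union_of :: "('e, 'v) digraph \<Rightarrow> ('e, 'v) digraph \<Rightarrow> ('e, 'v) digraph \<Rightarrow> bool" where
  "disjoint_union_of G A B \<longleftrightarrow> digraph A \<and> digraph B
     \<and> edges A \<inter> edges B = {} \<and> verts A \<inter> verts B = {}
     \<and> edges G = edges A \<union> edges B \<and> verts G = verts A \<union> verts B
     \<and> iedges G = iedges A \<union> iedges B \<and> oedges G = oedges A \<union> oedges B
     \<and> (\<forall>e \<in> iedges A. ivert G e = ivert A e) \<and> (\<forall>e \<in> iedges B. ivert G e = ivert B e)
     \<and> (\<forall>e \<in> oedges A. overt G e = overt A e) \<and> (\<forall>e \<in> oedges B. overt G e = overt B e)"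

definition connected_digraph :: "('e, 'v) digraph \<Rightarrow> bool" where
  "connected_digraph G \<longleftrightarrow> digraph G \<and> nonempty_digraph G
     \<and> \<not> (\<exists>A B. disjoint_union_of G A B \<and> nonempty_digraph A \<and> nonempty_digraph B)"


section \<open>Etale maps and embeddings\<close>

text \<open>
  As the maps \<open>I \<rightarrow> E\<close> and \<open>O \<rightarrow> E\<close> are inclusions, a natural transformation of diagrams is
  determined by its components on edges and vertices.
\<close>

record ('e, 'v) dmap =
  emap :: "'e \<Rightarrow> 'e"
  vmap :: "'v \<Rightarrow> 'v"

definition digraph_map :: "('e, 'v) digraph \<Rightarrow> ('e, 'v) digraph \<Rightarrow> ('e, 'v) dmap \<Rightarrow> bool" where
  "digraph_map H G f \<longleftrightarrow> digraph H \<and> digraph G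
     \<and> emap f \<in> edges H \<rightarrow>\<^sub>E edges G \<and> vmap f \<in> verts H \<rightarrow>\<^sub>E verts G
     \<and> emap f ` iedges H \<subseteq> iedges G \<and> emap f ` oedges H \<subseteq> oedges G
     \<and> (\<forall>e \<in> iedges H. vmap f (ivert H e) = ivert G (emap f e))
     \<and> (\<forall>e \<in> oedges H. vmap f (overt H e) = overt G (emap f e))"

definition id_dmap :: "('e, 'v) digraph \<Rightarrow> ('e, 'v) dmap" where
  "id_dmap G = \<lparr>emap = (\<lambda>e \<in> edges G. e), vmap = (\<lambda>v \<in> verts G. v)\<rparr>"

definition comp_dmap :: "('e, 'v) digraph \<Rightarrow> ('e, 'v) dmap \<Rightarrow> ('e, 'v) dmap \<Rightarrow> ('e, 'v) dmap" where
  "comp_dmap H g f =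
     \<lparr>emap = compose (edges H) (emap g) (emap f), vmap = compose (verts H) (vmap g) (vmap f)\<rparr>"

definition digraph_iso :: "('e, 'v) digraph \<Rightarrow> ('e, 'v) digraph \<Rightarrow> ('e, 'v) dmap \<Rightarrow> bool" where
  "digraph_iso H K z \<longleftrightarrow> digraph_map H K z
     \<and> (\<exists>w. digraph_map K H w \<and> comp_dmap H w z = id_dmap H \<and> comp_dmap K z w = id_dmap K)"

text \<open>
  The commutative square of sets with \<open>p : A \<rightarrow> B\<close>, \<open>q : A \<rightarrow> C\<close>, \<open>f : B \<rightarrow> D\<close> and \<open>g : C \<rightarrow> D\<close>
  is a pullback: \<open>A\<close> maps bijectively to the fibre product of \<open>B\<close> and \<open>C\<close>.
\<close>

definition pullback_square ::
  "'a set \<Rightarrow> 'b set \<Rightarrow> 'c set \<Rightarrow> ('a \<Rightarrow> 'b) \<Rightarrow> ('a \<Rightarrow> 'c) \<Rightarrow> ('b \<Rightarrow> 'd) \<Rightarrow> ('c \<Rightarrow> 'd) \<Rightarrow> bool" where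
  "pullback_square A B C p q f g \<longleftrightarrow>
     bij_betw (\<lambda>a. (p a, q a)) A {(b, c). b \<in> B \<and> c \<in> C \<and> f b = g c}"

definition etale :: "('e, 'v) digraph \<Rightarrow> ('e, 'v) digraph \<Rightarrow> ('e, 'v) dmap \<Rightarrow> bool" where
  "etale H G f \<longleftrightarrow> digraph_map H G f
     \<and> pullback_square (iedges H) (verts H) (iedges G) (ivert H) (emap f) (vmap f) (ivert G)
     \<and> pullback_square (oedges H) (verts H) (oedges G) (overt H) (emap f) (vmap f) (overt G)"

definition embedding :: "('e, 'v) digraph \<Rightarrow> ('e, 'v) digraph \<Rightarrow> ('e, 'v) dmap \<Rightarrow> bool" where
  "embedding H G f \<longleftrightarrow> connected_digraph H \<and> connected_digraph G \<and> etale H G f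
     \<and> inj_on (vmap f) (verts H)"


section \<open>The partially ordered set of classes of embeddings\<close>

text \<open>An embedding with given codomain is a pair of its domain and the underlying map.\<close>

type_synonym ('e, 'v) emb = "('e, 'v) digraph \<times> ('e, 'v) dmap"

definition embs :: "('e, 'v) digraph \<Rightarrow> ('e, 'v) emb set" where
  "embs G = {(H, f). embedding H G f}"

definition emb_rel :: "('e, 'v) digraph \<Rightarrow> (('e, 'v) emb \<times> ('e, 'v) emb) set" where
  "emb_rel G = {((H, f), (K, h)). (H, f) \<in> embs G \<and> (K, h) \<in> embs G
     \<and> (\<exists>z. digraph_iso H K z \<and> f = comp_dmap H h z)}"

definition Emb :: "('e, 'v) digraph \<Rightarrow> ('e, 'v) emb set set" where
  "Emb G = embs G // emb_rel G"

definition emb_class :: "('e, 'v) digraph \<Rightarrow> ('e, 'v) emb \<Rightarrow> ('e, 'v) emb set" where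
  "emb_class G f = emb_rel G `` {f}"

definition id_class :: "('e, 'v) digraph \<Rightarrow> ('e, 'v) emb set" where
  "id_class G = emb_class G (G, id_dmap G)"

definition emb_le :: "('e, 'v) emb set \<Rightarrow> ('e, 'v) emb set \<Rightarrow> bool" where
  "emb_le c d \<longleftrightarrow> (\<exists>(H, h) \<in> c. \<exists>(K, k) \<in> d. \<exists>j. embedding H K j \<and> h = comp_dmap H k j)"

text \<open>
  The following notions are invariant under isomorphism of the domain, and are therefore defined
  by means of an arbitrary representative.
\<close>

definition rep_dom :: "('e, 'v) emb set \<Rightarrow> ('e, 'v) digraph" where
  "rep_dom c = fst (SOME f. f \<in> c)"

definition rep_map :: "('e, 'v) emb set \<Rightarrow> ('e, 'v) dmap" where
  "rep_map c = snd (SOME f. f \<in> c)"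

definition is_edge :: "('e, 'v) emb set \<Rightarrow> bool" where
  "is_edge c \<longleftrightarrow> verts (rep_dom c) = {}"

definition edge_image :: "('e, 'v) emb set \<Rightarrow> 'e set" where
  "edge_image c = emap (rep_map c) ` edges (rep_dom c)"

definition vert_image :: "('e, 'v) emb set \<Rightarrow> 'v set" where
  "vert_image c = vmap (rep_map c) ` verts (rep_dom c)"

text \<open>
  The elements of the free commutative monoid on a set of edges are the multisets of these edges;
  \<open>image_mset\<close> is the functorial action on functions.
\<close>

definition in_class :: "('e, 'v) emb set \<Rightarrow> 'e multiset" where
  "in_class c = image_mset (emap (rep_map c)) (mset_set (in_graph (rep_dom c)))"

definition out_class :: "('e, 'v) emb set \<Rightarrow> 'e multiset" where
  "out_class c = image_mset (emap (rep_map c)) (mset_set (out_graph (rep_dom c)))"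

definition is_union :: "('e, 'v) emb set \<Rightarrow> ('e, 'v) emb set \<Rightarrow> ('e, 'v) emb set \<Rightarrow> bool" where
  "is_union l h k \<longleftrightarrow> emb_le h l \<and> emb_le k l \<and> vert_image l = vert_image h \<union> vert_image k"

definition vertex_disjoint :: "('e, 'v) emb set \<Rightarrow> ('e, 'v) emb set \<Rightarrow> bool" where
  "vertex_disjoint h k \<longleftrightarrow> vert_image h \<inter> vert_image k = {}"


section \<open>The oriented graphical category\<close>

type_synonym ('e, 'v) gmor = "('e \<Rightarrow> 'e) \<times> (('e, 'v) emb set \<Rightarrow> ('e, 'v) emb set)"

definition U_Hom :: "('e, 'v) digraph \<Rightarrow> ('e, 'v) digraph \<Rightarrow> ('e, 'v) gmor set" where
  "U_Hom G G' = {(\<phi>0, \<phi>).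
     \<phi>0 \<in> edges G \<rightarrow>\<^sub>E edges G' \<and> \<phi> \<in> Emb G \<rightarrow>\<^sub>E Emb G'
     \<and> (\<forall>h \<in> Emb G. is_edge h \<longrightarrow> is_edge (\<phi> h))
     \<and> (\<forall>l \<in> Emb G. \<forall>h \<in> Emb G. \<forall>k \<in> Emb G. is_union l h k \<longrightarrow> is_union (\<phi> l) (\<phi> h) (\<phi> k))
     \<and> (\<forall>h \<in> Emb G. \<forall>k \<in> Emb G. vertex_disjoint h k \<longrightarrow> vertex_disjoint (\<phi> h) (\<phi> k))
     \<and> (\<forall>h \<in> Emb G. in_class (\<phi> h) = image_mset \<phi>0 (in_class h)
          \<and> out_class (\<phi> h) = image_mset \<phi>0 (out_class h))}"

definition U_cat :: "(('e, 'v) digraph, ('e, 'v) gmor) cat" where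
  "U_cat =
     \<lparr>Ob = {G. connected_digraph G},
      Hom = U_Hom,
      Id = (\<lambda>G. (\<lambda>e \<in> edges G. e, \<lambda>h \<in> Emb G. h)),
      Comp = (\<lambda>G G' G'' \<psi> \<phi>.
        (compose (edges G) (fst \<psi>) (fst \<phi>), compose (Emb G) (snd \<psi>) (snd \<phi>)))\<rparr>"


section \<open>Acyclic graphs and structured subgraphs\<close>

text \<open>The path $e_0 v_1 e_1 \ldots v_n e_n$ is given by its lists of edges and vertices.\<close>

definition dipath :: "('e, 'v) digraph \<Rightarrow> 'e list \<Rightarrow> 'v list \<Rightarrow> bool" where
  "dipath G es vs \<longleftrightarrow> length es = Suc (length vs) \<and> set es \<subseteq> edges G \<and> set vs \<subseteq> verts G
     \<and> (\<forall>i < length vs. es ! i \<in> in_vert G (vs ! i) \<and> es ! Suc i \<in> out_vert G (vs ! i))"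

definition acyclic_digraph :: "('e, 'v) digraph \<Rightarrow> bool" where
  "acyclic_digraph G \<longleftrightarrow> connected_digraph G
     \<and> \<not> (\<exists>es vs. dipath G es vs \<and> length vs \<ge> 1 \<and> hd es = last es)"

definition convex_inclusion :: "('e, 'v) digraph \<Rightarrow> ('e, 'v) digraph \<Rightarrow> ('e, 'v) dmap \<Rightarrow> bool" where
  "convex_inclusion H G h \<longleftrightarrow> embedding H G h
     \<and> inj_on (emap h) (edges H) \<and> inj_on (vmap h) (verts H)
     \<and> (\<forall>es vs. dipath G es vs \<and> hd es \<in> emap h ` edges H \<and> last es \<in> emap h ` edges H
          \<longrightarrow> set es \<subseteq> emap h ` edges H \<and> set vs \<subseteq> vmap h ` verts H)"

definition sSb :: "('e, 'v) digraph \<Rightarrow> ('e, 'v) emb set set" where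
  "sSb G = emb_class G ` {(H, h). convex_inclusion H G h}"

text \<open>
  A structured subgraph \<open>H\<close> is identified with the pair of subsets \<open>edge_image H\<close> and
  \<open>vert_image H\<close>. The following says that the structured subgraph \<open>H\<close> is $H_1 \cup H_2$.
\<close>

definition is_ssb_union :: "('e, 'v) emb set \<Rightarrow> ('e, 'v) emb set \<Rightarrow> ('e, 'v) emb set \<Rightarrow> bool" where
  "is_ssb_union H H1 H2 \<longleftrightarrow> edge_image H = edge_image H1 \<union> edge_image H2
     \<and> vert_image H = vert_image H1 \<union> vert_image H2"


section \<open>The properadic graphical category\<close>

definition G_Hom :: "('e, 'v) digraph \<Rightarrow> ('e, 'v) digraph \<Rightarrow> ('e, 'v) gmor set" where
  "G_Hom G G' = {(\<phi>0, \<phi>).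
     \<phi>0 \<in> edges G \<rightarrow>\<^sub>E edges G' \<and> \<phi> \<in> sSb G \<rightarrow>\<^sub>E sSb G'
     \<and> (\<forall>H \<in> sSb G. in_class (\<phi> H) = image_mset \<phi>0 (in_class H)
          \<and> out_class (\<phi> H) = image_mset \<phi>0 (out_class H))
     \<and> (\<forall>H1 \<in> sSb G. \<forall>H2 \<in> sSb G. \<forall>H \<in> sSb G.
          is_ssb_union H H1 H2 \<longrightarrow> is_ssb_union (\<phi> H) (\<phi> H1) (\<phi> H2))}"

definition G_cat :: "(('e, 'v) digraph, ('e, 'v) gmor) cat" where
  "G_cat =
     \<lparr>Ob = {G. acyclic_digraph G},
      Hom = G_Hom,
      Id = (\<lambda>G. (\<lambda>e \<in> edges G. e, \<lambda>H \<in> sSb G. H)),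
      Comp = (\<lambda>G G' G'' \<psi> \<phi>.
        (compose (edges G) (fst \<psi>) (fst \<phi>), compose (sSb G) (snd \<psi>) (snd \<phi>)))\<rparr>"


definition acyclic_objs :: "('e, 'v) digraph set" where
  "acyclic_objs = {G. acyclic_digraph G}"

definition ssb_homs :: "('e, 'v) digraph \<Rightarrow> ('e, 'v) digraph \<Rightarrow> ('e, 'v) gmor set" where
  "ssb_homs G G' = {\<phi> \<in> Hom U_cat G G'. snd \<phi> (id_class G) \<in> sSb G'}"

end

theory Submission
  imports Defs
begin

text \<open>
  Apart from the edges, a class of embeddings into \<open>G\<close> is a set \<open>W\<close> of vertices together with the set \<open>J\<close>
  of those edges between vertices of \<open>W\<close> that are not cut; its inputs and outputs are the inputs and
  outputs of \<open>W\<close> outside \<open>J\<close>. So a class is determined by its vertices and its inputs, and it is a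
  structured subgraph if and only if nothing is cut and \<open>W\<close> is convex for the reachability relation.

  A morphism of the oriented graphical category is determined by its values on edges and on corollas,
  because every class is built from corollas by adding one vertex or gluing one edge at a time. If it
  maps the whole of \<open>G\<close> to a structured subgraph, then an edge of the image that is not external can be
  traced back along a directed path in \<open>G\<close>, so that it preserves structured subgraphs and restricts to a
  morphism of the properadic graphical category. Conversely, given a properadic morphism, the images of
  different corollas have disjoint vertex sets: grow a structured subgraph by one minimal or maximal
  vertex at a time and use that the image of the union has no cut edge. Hence the values on corollas can
  be glued along any class of embeddings, which extends the morphism.
\<close>

section \<open>Vertex sets and connectedness\<close>

text \<open>A morphism constrains the image of a class only through vertices and through the
  multisets of inputs and outputs; which edges of the image are cut is not prescribed. Counting
  reveals it: an uncut edge between vertices of \<open>W\<close> contributes to neither multiset, a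
  cut one contributes once to each. So gluing two parts along \<open>f\<close>, or closing a cut
  edge \<open>f\<close>, removes one \<open>f\<close> from the inputs and one from the outputs, and
  applying \<open>\<phi>0\<close> gives the same count for the images. Hence a glued value satisfies
  the boundary axiom by construction, and does not depend on the order of gluing. What has to be
  earned is that the images to be glued have disjoint vertex sets, for which \<open>G_Hom\<close>
  has no axiom, and that images without vertices do no harm: gluing such an image on changes
  nothing, and it never has to be closed up on itself. Acyclicity enters at both points, and also in
  tracing edges backwards, which terminates because \<open>adj G\<close> is well-founded.\<close>

definition inputs :: "('e, 'v) digraph \<Rightarrow> 'v set \<Rightarrow> 'e set" where
  "inputs G W = {e \<in> iedges G. ivert G e \<in> W}"

definition outputs :: "('e, 'v) digraph \<Rightarrow> 'v set \<Rightarrow> 'e set" where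
  "outputs G W = {e \<in> oedges G. overt G e \<in> W}"

text \<open>\<open>J\<close> is the set of edges between vertices of \<open>W\<close> that are not cut.\<close>

definition connected_part :: "('e, 'v) digraph \<Rightarrow> 'v set \<Rightarrow> 'e set \<Rightarrow> bool" where
  "connected_part G W J \<longleftrightarrow> W \<noteq> {} \<and> W \<subseteq> verts G \<and> J \<subseteq> inputs G W \<inter> outputs G W
     \<and> (\<forall>A. A \<subseteq> W \<longrightarrow> A \<noteq> {} \<longrightarrow> A \<noteq> W \<longrightarrow> (\<exists>e \<in> J. (ivert G e \<in> A) \<noteq> (overt G e \<in> A)))"

lemma inputs_Un: "inputs G (A \<union> B) = inputs G A \<union> inputs G B"
  and outputs_Un: "outputs G (A \<union> B) = outputs G A \<union> outputs G B"
  by (auto simp: inputs_def outputs_def)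

lemma inputs_mono: "A \<subseteq> B \<Longrightarrow> inputs G A \<subseteq> inputs G B"
  and outputs_mono: "A \<subseteq> B \<Longrightarrow> outputs G A \<subseteq> outputs G B"
  by (auto simp: inputs_def outputs_def)

lemma inputs_subset: "inputs G A \<subseteq> iedges G"
  and outputs_subset: "outputs G A \<subseteq> oedges G"
  by (auto simp: inputs_def outputs_def)

lemma inputs_empty [simp]: "inputs G {} = {}"
  and outputs_empty [simp]: "outputs G {} = {}"
  by (auto simp: inputs_def outputs_def)

lemma inputs_disjoint: "A \<inter> B = {} \<Longrightarrow> inputs G A \<inter> inputs G B = {}"
  and outputs_disjoint: "A \<inter> B = {} \<Longrightarrow> outputs G A \<inter> outputs G B = {}"
  by (auto simp: inputs_def outputs_def)

lemma digraph_vertD: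
  assumes "digraph G"
  shows "e \<in> iedges G \<Longrightarrow> ivert G e \<in> verts G" "e \<in> oedges G \<Longrightarrow> overt G e \<in> verts G"
  using assms by (auto simp: digraph_def)

lemma digraph_edgeD:
  assumes "digraph G"
  shows "e \<in> iedges G \<Longrightarrow> e \<in> edges G" "e \<in> oedges G \<Longrightarrow> e \<in> edges G"
  using assms by (auto simp: digraph_def)

lemma finite_edges: "digraph G \<Longrightarrow> finite (edges G)"
  and finite_verts: "digraph G \<Longrightarrow> finite (verts G)"
  and finite_iedges: "digraph G \<Longrightarrow> finite (iedges G)"
  and finite_oedges: "digraph G \<Longrightarrow> finite (oedges G)"
  by (auto simp: digraph_def dest: finite_subset)

lemma finite_inputs: "digraph G \<Longrightarrow> finite (inputs G W)"
  and finite_outputs: "digraph G \<Longrightarrow> finite (outputs G W)"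
  by (auto simp: inputs_def outputs_def finite_iedges finite_oedges)

lemma connected_digraphD: "connected_digraph G \<Longrightarrow> digraph G"
  by (simp add: connected_digraph_def)

text \<open>An edge attached to no vertex splits off as the summand \<open>A\<close>, so
  connectedness forces the complement \<open>B\<close> to be empty.\<close>

lemma connected_isolated_edge:
  fixes H :: "('e, 'v) digraph"
  assumes "connected_digraph H" and e: "e \<in> edges H" "e \<notin> iedges H" "e \<notin> oedges H"
  shows "edges H = {e}" "verts H = {}"
proof -
  define A :: "('e, 'v) digraph" where "A = \<lparr>edges = {e}, iedges = {}, oedges = {}, verts = {},
    ivert = (\<lambda>_. undefined), overt = (\<lambda>_. undefined)\<rparr>"
  define B where "B = H\<lparr>edges := edges H - {e}\<rparr>"
  have d: "digraph H" using assms(1) by (rule connected_digraphD)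
  have dA: "digraph A" by (simp add: A_def digraph_def)
  have dB: "digraph B" using d e by (simp add: B_def digraph_def subset_Diff_insert)
  have "edges H = insert e (edges H)" using e by auto
  then have "disjoint_union_of H A B"
    using dA dB unfolding disjoint_union_of_def by (simp add: A_def B_def)
  moreover have "nonempty_digraph A" by (simp add: A_def nonempty_digraph_def)
  ultimately have "\<not> nonempty_digraph B"
    using assms(1) by (auto simp: connected_digraph_def)
  then show "edges H = {e}" "verts H = {}"
    using e by (auto simp: B_def nonempty_digraph_def)
qed

lemma connected_edges:
  assumes "connected_digraph H" "verts H \<noteq> {}"
  shows "edges H = iedges H \<union> oedges H"
  using connected_isolated_edge[OF assms(1)] assms digraph_edgeD[OF connected_digraphD[OF assms(1)]]
  by blast

lemma connected_no_verts:
  assumes "connected_digraph H" "verts H = {}"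
  obtains e where "edges H = {e}" "iedges H = {}" "oedges H = {}"
proof -
  have d: "digraph H" using assms(1) by (rule connected_digraphD)
  have io: "iedges H = {}" "oedges H = {}"
    using digraph_vertD[OF d] assms(2) by auto
  obtain e where "e \<in> edges H"
    using assms by (auto simp: connected_digraph_def nonempty_digraph_def)
  then show thesis
    using connected_isolated_edge[OF assms(1), of e] io that by auto
qed

definition part :: "('e, 'v) digraph \<Rightarrow> 'v set \<Rightarrow> ('e, 'v) digraph" where
  "part H A = \<lparr>edges = inputs H A \<union> outputs H A, iedges = inputs H A, oedges = outputs H A,
     verts = A, ivert = restrict (ivert H) (inputs H A), overt = restrict (overt H) (outputs H A)\<rparr>"

lemma digraph_part:
  assumes "digraph H" "A \<subseteq> verts H"
  shows "digraph (part H A)"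
proof -
  have "finite A" using assms finite_subset by (auto simp: digraph_def)
  then show ?thesis
    unfolding digraph_def part_def
    using assms digraph_edgeD[OF assms(1)] finite_iedges[OF assms(1)] finite_oedges[OF assms(1)]
    by (simp add: inputs_def outputs_def)
qed

text \<open>If every edge with two ends had both on the same side of \<open>A\<close>, the parts
  spanned by \<open>A\<close> and by its complement would share no edge and form a disjoint
  union.\<close>

lemma connected_split:
  assumes c: "connected_digraph H" and A: "A \<subseteq> verts H" "A \<noteq> {}" "A \<noteq> verts H"
  shows "\<exists>e \<in> iedges H \<inter> oedges H. (ivert H e \<in> A) \<noteq> (overt H e \<in> A)"
proof (rule ccontr)
  assume "\<not> ?thesis"
  then have no: "\<And>e. e \<in> iedges H \<Longrightarrow> e \<in> oedges H \<Longrightarrow> (ivert H e \<in> A) = (overt H e \<in> A)"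
    by auto
  let ?B = "verts H - A"
  have d: "digraph H" using c by (rule connected_digraphD)
  have v: "verts H \<noteq> {}" using A by auto
  have "disjoint_union_of H (part H A) (part H ?B)"
    unfolding disjoint_union_of_def
    using digraph_part[OF d A(1)] digraph_part[OF d, of ?B] connected_edges[OF c v] A(1)
      digraph_vertD[OF d] no
    by (auto simp: part_def inputs_def outputs_def)
  moreover have "nonempty_digraph (part H A)" "nonempty_digraph (part H ?B)"
    using A by (auto simp: nonempty_digraph_def part_def)
  ultimately show False using c by (auto simp: connected_digraph_def)
qed

lemma connected_part_verts:
  assumes c: "connected_digraph H" and v: "verts H \<noteq> {}"
  shows "connected_part H (verts H) (iedges H \<inter> oedges H)"
  unfolding connected_part_def
  using connected_split[OF c] v digraph_vertD[OF connected_digraphD[OF c]]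
  by (auto simp: inputs_def outputs_def)

text \<open>Both summands of a decomposition contain vertices, so some edge crosses between their
  vertex sets; but it lies in one summand, which contains both of its ends.\<close>

lemma connected_digraphI:
  fixes H :: "('e, 'v) digraph"
  assumes d: "digraph H" and v: "verts H \<noteq> {}" and e: "edges H = iedges H \<union> oedges H"
    and s: "connected_part H (verts H) (iedges H \<inter> oedges H)"
  shows "connected_digraph H"
proof -
  have False if du: "disjoint_union_of H A B" and ne: "nonempty_digraph A" "nonempty_digraph B"
    for A B :: "('e, 'v) digraph"
  proof -
    have dA: "digraph A" and dB: "digraph B" using du by (auto simp: disjoint_union_of_def)
    \<comment> \<open>A summand without vertices would have only unattached edges, whereas in
      \<open>H\<close> every edge is attached.\<close>
    have vv: "verts X \<noteq> {}"
      if dX: "digraph X" and dY: "digraph Y" and nX: "nonempty_digraph X" and eX: "edges H = edges X \<union> edges Y"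
        "edges X \<inter> edges Y = {}" "iedges H = iedges X \<union> iedges Y" "oedges H = oedges X \<union> oedges Y"
      for X Y :: "('e, 'v) digraph"
    proof
      assume v0: "verts X = {}"
      then have "iedges X = {}" "oedges X = {}" using digraph_vertD[OF dX] by auto
      moreover obtain x where "x \<in> edges X" using nX v0 by (auto simp: nonempty_digraph_def)
      ultimately show False using eX e digraph_edgeD[OF dY] by blast
    qed
    have vA: "verts A \<noteq> {}"
      using vv[of A B] dA dB ne du by (auto simp: disjoint_union_of_def)
    have vB: "verts B \<noteq> {}"
      using vv[of B A] dA dB ne du by (auto simp: disjoint_union_of_def)
    have "verts A \<subseteq> verts H" "verts A \<noteq> verts H"
      using du vB by (auto simp: disjoint_union_of_def)
    then obtain x where x: "x \<in> iedges H" "x \<in> oedges H" "(ivert H x \<in> verts A) \<noteq> (overt H x \<in> verts A)"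
      using s vA unfolding connected_part_def by blast
    show False
    proof (cases "x \<in> edges A")
      case True
      then have "x \<in> iedges A" "x \<in> oedges A"
        using x du digraph_edgeD[OF dB] unfolding disjoint_union_of_def by blast+
      then show False using x(3) du digraph_vertD[OF dA] by (auto simp: disjoint_union_of_def)
    next
      case False
      then have "x \<in> iedges B" "x \<in> oedges B"
        using x du digraph_edgeD[OF dA] unfolding disjoint_union_of_def by blast+
      then show False using x(3) du digraph_vertD[OF dB] by (auto simp: disjoint_union_of_def)
    qed
  qed
  then show ?thesis using d v by (auto simp: connected_digraph_def nonempty_digraph_def)
qed

section \<open>Embeddings\<close>

lemma etale_map: "etale H G f \<Longrightarrow> digraph_map H G f"
  by (simp add: etale_def)

lemma digraph_mapD:
  assumes "digraph_map H G f"
  shows "digraph H" "digraph G"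
    "emap f \<in> extensional (edges H)" "vmap f \<in> extensional (verts H)"
    "e \<in> edges H \<Longrightarrow> emap f e \<in> edges G" "v \<in> verts H \<Longrightarrow> vmap f v \<in> verts G"
    "e \<in> iedges H \<Longrightarrow> emap f e \<in> iedges G" "e \<in> oedges H \<Longrightarrow> emap f e \<in> oedges G"
    "e \<in> iedges H \<Longrightarrow> ivert G (emap f e) = vmap f (ivert H e)"
    "e \<in> oedges H \<Longrightarrow> overt G (emap f e) = vmap f (overt H e)"
  using assms by (auto simp: digraph_map_def PiE_def)

lemma embeddingD:
  assumes "embedding H G f"
  shows "connected_digraph H" "connected_digraph G" "digraph H" "digraph G" "digraph_map H G f"
    "etale H G f" "inj_on (vmap f) (verts H)"
  using assms by (auto simp: embedding_def etale_map connected_digraphD)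

lemma etale_lift_iedge:
  assumes "etale H G f" "v \<in> verts H" "e \<in> iedges G" "ivert G e = vmap f v"
  obtains a where "a \<in> iedges H" "ivert H a = v" "emap f a = e"
proof -
  have "(v, e) \<in> (\<lambda>a. (ivert H a, emap f a)) ` iedges H"
    using assms by (auto simp: etale_def pullback_square_def bij_betw_def)
  then show thesis using that by auto
qed

lemma etale_lift_oedge:
  assumes "etale H G f" "v \<in> verts H" "e \<in> oedges G" "overt G e = vmap f v"
  obtains a where "a \<in> oedges H" "overt H a = v" "emap f a = e"
proof -
  have "(v, e) \<in> (\<lambda>a. (overt H a, emap f a)) ` oedges H"
    using assms by (auto simp: etale_def pullback_square_def bij_betw_def)
  then show thesis using that by auto
qed

text \<open>The pullback condition gives injectivity around one vertex, and injectivity on vertices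
  separates the stars of different vertices. On all edges injectivity may fail: an input edge and an
  output edge of \<open>H\<close> can have the same image, which is then a cut edge.\<close>

lemma embedding_inj_iedges:
  assumes "embedding H G f"
  shows "inj_on (emap f) (iedges H)"
proof (rule inj_onI)
  fix a b assume ab: "a \<in> iedges H" "b \<in> iedges H" "emap f a = emap f b"
  note m = embeddingD[OF assms]
  have "vmap f (ivert H a) = vmap f (ivert H b)"
    using digraph_mapD(9)[OF m(5)] ab by metis
  then have "ivert H a = ivert H b"
    using m(7) digraph_vertD[OF m(3)] ab by (meson inj_onD)
  then show "a = b"
    using m(6) ab by (auto simp: etale_def pullback_square_def bij_betw_def dest: inj_onD)
qed

lemma embedding_inj_oedges:
  assumes "embedding H G f"
  shows "inj_on (emap f) (oedges H)"
proof (rule inj_onI)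
  fix a b assume ab: "a \<in> oedges H" "b \<in> oedges H" "emap f a = emap f b"
  note m = embeddingD[OF assms]
  have "vmap f (overt H a) = vmap f (overt H b)"
    using digraph_mapD(10)[OF m(5)] ab by metis
  then have "overt H a = overt H b"
    using m(7) digraph_vertD[OF m(3)] ab by (meson inj_onD)
  then show "a = b"
    using m(6) ab by (auto simp: etale_def pullback_square_def bij_betw_def dest: inj_onD)
qed

lemma embedding_image_iedges:
  assumes "embedding H G f"
  shows "emap f ` iedges H = inputs G (vmap f ` verts H)"
proof -
  note m = embeddingD[OF assms]
  show ?thesis
    using digraph_mapD[OF m(5)] digraph_vertD[OF m(3)]
    by (auto simp: inputs_def elim!: etale_lift_iedge[OF m(6)])
qed

lemma embedding_image_oedges:
  assumes "embedding H G f"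
  shows "emap f ` oedges H = outputs G (vmap f ` verts H)"
proof -
  note m = embeddingD[OF assms]
  show ?thesis
    using digraph_mapD[OF m(5)] digraph_vertD[OF m(3)]
    by (auto simp: outputs_def elim!: etale_lift_oedge[OF m(6)])
qed

text \<open>Records the edges that are not cut. An edge of \<open>G\<close> with both ends in the
  image of the vertices but outside this set is covered by two edges of \<open>H\<close>, one ending
  and one starting at a vertex of \<open>H\<close>.\<close>

definition inner_image :: "('e, 'v) digraph \<Rightarrow> ('e, 'v) dmap \<Rightarrow> 'e set" where
  "inner_image H f = emap f ` (iedges H \<inter> oedges H)"

text \<open>No edge of \<open>H\<close> is isolated, so the inputs of \<open>H\<close> are its input
  edges that are not inner. The map is injective on these, so the boundary multisets have no
  repetitions even where edges are identified. Connectedness is transported by pulling a subset of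
  \<open>W\<close> back to \<open>H\<close>.\<close>

lemma embedding_shape:
  assumes emb: "embedding H G f" and v: "verts H \<noteq> {}"
  defines "W \<equiv> vmap f ` verts H" and "J \<equiv> inner_image H f"
  shows "connected_part G W J" "emap f ` edges H = inputs G W \<union> outputs G W"
    "image_mset (emap f) (mset_set (in_graph H)) = mset_set (inputs G W - J)"
    "image_mset (emap f) (mset_set (out_graph H)) = mset_set (outputs G W - J)"
proof -
  note m = embeddingD[OF emb]
  note I = embedding_image_iedges[OF emb] and O = embedding_image_oedges[OF emb]
  have E: "edges H = iedges H \<union> oedges H" using connected_edges[OF m(1) v] .
  have "\<exists>e\<in>J. (ivert G e \<in> A) \<noteq> (overt G e \<in> A)" if A: "A \<subseteq> W" "A \<noteq> {}" "A \<noteq> W" for A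
  proof -
    define B where "B = {v \<in> verts H. vmap f v \<in> A}"
    have "A = vmap f ` B" using A by (auto simp: B_def W_def)
    then have B: "B \<subseteq> verts H" "B \<noteq> {}" "B \<noteq> verts H" using A by (auto simp: B_def W_def)
    then obtain e where e: "e \<in> iedges H" "e \<in> oedges H" "(ivert H e \<in> B) \<noteq> (overt H e \<in> B)"
      using connected_split[OF m(1)] by blast
    have "(ivert G (emap f e) \<in> A) \<noteq> (overt G (emap f e) \<in> A)"
      using e digraph_mapD(9,10)[OF m(5)] digraph_vertD[OF m(3)] by (auto simp: B_def)
    then show ?thesis using e by (auto simp: J_def inner_image_def)
  qed
  moreover have "W \<noteq> {}" "W \<subseteq> verts G" using v digraph_mapD(6)[OF m(5)] by (auto simp: W_def)
  moreover have "J \<subseteq> inputs G W \<inter> outputs G W"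
    unfolding W_def J_def inner_image_def I[symmetric] O[symmetric] by auto
  ultimately show "connected_part G W J" by (auto simp: connected_part_def)
  show "emap f ` edges H = inputs G W \<union> outputs G W"
    unfolding E W_def by (simp add: image_Un I O)
  have inj: "inj_on (emap f) (in_graph H)" "inj_on (emap f) (out_graph H)"
    by (rule inj_on_subset[OF embedding_inj_iedges[OF emb]], use E in \<open>auto simp: in_graph_def\<close>)
      (rule inj_on_subset[OF embedding_inj_oedges[OF emb]], use E in \<open>auto simp: out_graph_def\<close>)
  have "emap f ` in_graph H = emap f ` iedges H - J"
    using inj_on_image_set_diff[OF embedding_inj_iedges[OF emb], of "iedges H" "iedges H \<inter> oedges H"] E
    by (auto simp: in_graph_def J_def inner_image_def Diff_Int Un_Diff)
  then show "image_mset (emap f) (mset_set (in_graph H)) = mset_set (inputs G W - J)"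
    using inj by (simp add: image_mset_mset_set I W_def)
  have "emap f ` out_graph H = emap f ` oedges H - J"
    using inj_on_image_set_diff[OF embedding_inj_oedges[OF emb], of "oedges H" "iedges H \<inter> oedges H"] E
    by (auto simp: out_graph_def J_def inner_image_def Diff_Int Un_Diff)
  then show "image_mset (emap f) (mset_set (out_graph H)) = mset_set (outputs G W - J)"
    using inj by (simp add: image_mset_mset_set O W_def)
qed

lemma embedding_edge_shape:
  assumes emb: "embedding H G f" and v: "verts H = {}"
  obtains e where "e \<in> edges G" "emap f ` edges H = {e}" "inner_image H f = {}"
    "image_mset (emap f) (mset_set (in_graph H)) = {#e#}"
    "image_mset (emap f) (mset_set (out_graph H)) = {#e#}"
proof -
  note m = embeddingD[OF emb]
  obtain e where e: "edges H = {e}" "iedges H = {}" "oedges H = {}"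
    using connected_no_verts[OF m(1) v] .
  then show thesis
    using that[of "emap f e"] digraph_mapD(5)[OF m(5)]
    by (simp add: inner_image_def in_graph_def out_graph_def)
qed

lemma factor_images:
  assumes j: "digraph_map H K j" and h: "h = comp_dmap H k j"
  shows "vmap h ` verts H \<subseteq> vmap k ` verts K" "emap h ` edges H \<subseteq> emap k ` edges K"
    "inner_image H h \<subseteq> inner_image K k"
  using digraph_mapD(5-8)[OF j] digraph_edgeD[OF digraph_mapD(1)[OF j]] unfolding h
  by (auto simp: comp_dmap_def compose_def inner_image_def)

text \<open>The delicate point is lifting an edge of \<open>H\<close> to \<open>K\<close> with all
  its incidences. A lift found through one end alone could be one half of an edge that is cut in
  \<open>K\<close>; the inclusion of inner images supplies a lift attached at both ends.\<close>

lemma factor_exists: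
  assumes hH: "embedding H G h" and kK: "embedding K G k"
    and V: "vmap h ` verts H \<subseteq> vmap k ` verts K" and E: "emap h ` edges H \<subseteq> emap k ` edges K"
    and J: "inner_image H h \<subseteq> inner_image K k"
  obtains j where "embedding H K j" "h = comp_dmap H k j"
proof -
  note mh = embeddingD[OF hH] and mk = embeddingD[OF kK]
  note dh = digraph_mapD[OF mh(5)] and dk = digraph_mapD[OF mk(5)]
  have "\<exists>a \<in> edges K. emap k a = emap h e \<and> (e \<in> iedges H \<longrightarrow> a \<in> iedges K)
      \<and> (e \<in> oedges H \<longrightarrow> a \<in> oedges K)" if e: "e \<in> edges H" for e
  proof -
    consider "e \<in> iedges H \<inter> oedges H" | "e \<in> iedges H - oedges H" | "e \<in> oedges H - iedges H"
      | "e \<notin> iedges H \<union> oedges H" by blast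
    then show ?thesis
    proof cases
      case 1
      then have "emap h e \<in> inner_image K k" using J by (auto simp: inner_image_def)
      then show ?thesis using digraph_edgeD[OF mk(3)] by (auto simp: inner_image_def)
    next
      case 2
      then have "emap h e \<in> emap h ` iedges H" by simp
      then have "emap h e \<in> emap k ` iedges K"
        unfolding embedding_image_iedges[OF hH] embedding_image_iedges[OF kK]
        by (rule subsetD[OF inputs_mono[OF V]])
      then show ?thesis using 2 digraph_edgeD[OF mk(3)] by auto
    next
      case 3
      then have "emap h e \<in> emap h ` oedges H" by simp
      then have "emap h e \<in> emap k ` oedges K"
        unfolding embedding_image_oedges[OF hH] embedding_image_oedges[OF kK]
        by (rule subsetD[OF outputs_mono[OF V]])
      then show ?thesis using 3 digraph_edgeD[OF mk(3)] by auto
    next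
      case 4
      then show ?thesis using E e by fastforce
    qed
  qed
  then obtain t where t: "\<And>e. e \<in> edges H \<Longrightarrow> t e \<in> edges K \<and> emap k (t e) = emap h e
      \<and> (e \<in> iedges H \<longrightarrow> t e \<in> iedges K) \<and> (e \<in> oedges H \<longrightarrow> t e \<in> oedges K)"
    by metis
  have "\<exists>w \<in> verts K. vmap k w = vmap h v" if "v \<in> verts H" for v using V that by fastforce
  then obtain s where s: "\<And>v. v \<in> verts H \<Longrightarrow> s v \<in> verts K \<and> vmap k (s v) = vmap h v" by metis
  define j where "j = \<lparr>emap = restrict t (edges H), vmap = restrict s (verts H)\<rparr>"
  note eH = digraph_edgeD[OF mh(3)] and vH = digraph_vertD[OF mh(3)]
  note vK = digraph_vertD[OF mk(3)]
  have je: "emap j e = t e" if "e \<in> edges H" for e using that by (simp add: j_def)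
  have jv: "vmap j v = s v" if "v \<in> verts H" for v using that by (simp add: j_def)
  have si: "s (ivert H e) = ivert K (t e)" if e: "e \<in> iedges H" for e
  proof -
    have "vmap k (s (ivert H e)) = vmap k (ivert K (t e))"
      using s[OF vH(1)[OF e]] dh(9)[OF e] t[OF eH(1)[OF e]] e dk(9)[of "t e"] by simp
    then show ?thesis
      using mk(7) s[OF vH(1)[OF e]] t[OF eH(1)[OF e]] e vK(1) by (meson inj_onD)
  qed
  have so: "s (overt H e) = overt K (t e)" if e: "e \<in> oedges H" for e
  proof -
    have "vmap k (s (overt H e)) = vmap k (overt K (t e))"
      using s[OF vH(2)[OF e]] dh(10)[OF e] t[OF eH(2)[OF e]] e dk(10)[of "t e"] by simp
    then show ?thesis
      using mk(7) s[OF vH(2)[OF e]] t[OF eH(2)[OF e]] e vK(2) by (meson inj_onD)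
  qed
  have map: "digraph_map H K j"
    unfolding digraph_map_def
    using mh(3) mk(3) t s si so eH vH by (auto simp: j_def)
  have pi: "bij_betw (\<lambda>a. (ivert H a, emap j a)) (iedges H)
      {(b, c). b \<in> verts H \<and> c \<in> iedges K \<and> vmap j b = ivert K c}"
    unfolding bij_betw_def
  proof (intro conjI inj_onI equalityI subsetI)
    fix a b assume "a \<in> iedges H" "b \<in> iedges H" "(ivert H a, emap j a) = (ivert H b, emap j b)"
    then show "a = b"
      using embedding_inj_iedges[OF hH] je t eH(1) by (metis inj_onD prod.inject)
  next
    fix x assume "x \<in> (\<lambda>a. (ivert H a, emap j a)) ` iedges H"
    then show "x \<in> {(b, c). b \<in> verts H \<and> c \<in> iedges K \<and> vmap j b = ivert K c}"
      using je jv t eH(1) vH(1) si by auto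
  next
    fix x assume "x \<in> {(b, c). b \<in> verts H \<and> c \<in> iedges K \<and> vmap j b = ivert K c}"
    then obtain b c where x: "x = (b, c)" "b \<in> verts H" "c \<in> iedges K" "s b = ivert K c"
      using jv by auto
    then have "ivert G (emap k c) = vmap h b" using dk(9)[of c] s by metis
    then obtain a where a: "a \<in> iedges H" "ivert H a = b" "emap h a = emap k c"
      using etale_lift_iedge[OF mh(6) x(2)] dk(7) x(3) by metis
    then have "t a = c"
      using embedding_inj_iedges[OF kK] t eH(1) x(3) by (metis inj_onD)
    then show "x \<in> (\<lambda>a. (ivert H a, emap j a)) ` iedges H"
      using a x(1) je eH(1) by force
  qed
  have po: "bij_betw (\<lambda>a. (overt H a, emap j a)) (oedges H)
      {(b, c). b \<in> verts H \<and> c \<in> oedges K \<and> vmap j b = overt K c}"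
    unfolding bij_betw_def
  proof (intro conjI inj_onI equalityI subsetI)
    fix a b assume "a \<in> oedges H" "b \<in> oedges H" "(overt H a, emap j a) = (overt H b, emap j b)"
    then show "a = b"
      using embedding_inj_oedges[OF hH] je t eH(2) by (metis inj_onD prod.inject)
  next
    fix x assume "x \<in> (\<lambda>a. (overt H a, emap j a)) ` oedges H"
    then show "x \<in> {(b, c). b \<in> verts H \<and> c \<in> oedges K \<and> vmap j b = overt K c}"
      using je jv t eH(2) vH(2) so by auto
  next
    fix x assume "x \<in> {(b, c). b \<in> verts H \<and> c \<in> oedges K \<and> vmap j b = overt K c}"
    then obtain b c where x: "x = (b, c)" "b \<in> verts H" "c \<in> oedges K" "s b = overt K c"
      using jv by auto
    then have "overt G (emap k c) = vmap h b" using dk(10)[of c] s by metis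
    then obtain a where a: "a \<in> oedges H" "overt H a = b" "emap h a = emap k c"
      using etale_lift_oedge[OF mh(6) x(2)] dk(8) x(3) by metis
    then have "t a = c"
      using embedding_inj_oedges[OF kK] t eH(2) x(3) by (metis inj_onD)
    then show "x \<in> (\<lambda>a. (overt H a, emap j a)) ` oedges H"
      using a x(1) je eH(2) by force
  qed
  have "inj_on (vmap j) (verts H)"
    using mh(7) s jv by (metis inj_on_def)
  then have "embedding H K j"
    using mh(1) mk(1) map pi po by (auto simp: embedding_def etale_def pullback_square_def)
  moreover have "emap h = emap (comp_dmap H k j)"
    using dh(3) t je by (auto simp: comp_dmap_def compose_def restrict_def extensional_def fun_eq_iff)
  moreover have "vmap h = vmap (comp_dmap H k j)"
    using dh(4) s jv by (auto simp: comp_dmap_def compose_def restrict_def extensional_def fun_eq_iff)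
  ultimately show thesis using that by auto
qed

text \<open>Here \<open>h\<close> has to be cancelled from \<open>h j' j = h\<close>, although it
  may identify edges. It is injective on input edges and on output edges, and \<open>j' j\<close>
  preserves both kinds; an isolated edge is the only edge of \<open>H\<close>.\<close>

lemma factor_unique_id:
  assumes h: "embedding H G h" and j: "digraph_map H K j" "digraph_map K H j'"
    and c: "h = comp_dmap H k j" "k = comp_dmap K h j'"
  shows "comp_dmap H j' j = id_dmap H"
proof -
  note m = embeddingD[OF h] and dj = digraph_mapD[OF j(1)] and dj' = digraph_mapD[OF j(2)]
  have he: "emap h (emap j' (emap j e)) = emap h e" if "e \<in> edges H" for e
  proof -
    have "emap h e = emap k (emap j e)" using that by (subst c(1)) (simp add: comp_dmap_def compose_def)
    also have "\<dots> = emap h (emap j' (emap j e))"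
      using dj(5)[OF that] by (subst c(2)) (simp add: comp_dmap_def compose_def)
    finally show ?thesis by simp
  qed
  have hv: "vmap h (vmap j' (vmap j v)) = vmap h v" if "v \<in> verts H" for v
  proof -
    have "vmap h v = vmap k (vmap j v)" using that by (subst c(1)) (simp add: comp_dmap_def compose_def)
    also have "\<dots> = vmap h (vmap j' (vmap j v))"
      using dj(6)[OF that] by (subst c(2)) (simp add: comp_dmap_def compose_def)
    finally show ?thesis by simp
  qed
  have "emap j' (emap j e) = e" if e: "e \<in> edges H" for e
  proof -
    consider "e \<in> iedges H" | "e \<in> oedges H" | "e \<notin> iedges H" "e \<notin> oedges H" by blast
    then show ?thesis
    proof cases
      case 1
      then show ?thesis using he[OF e] embedding_inj_iedges[OF h] dj(7) dj'(7) by (meson inj_onD)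
    next
      case 2
      then show ?thesis using he[OF e] embedding_inj_oedges[OF h] dj(8) dj'(8) by (meson inj_onD)
    next
      case 3
      then show ?thesis using connected_isolated_edge[OF m(1) e] dj(5)[OF e] dj'(5) e by blast
    qed
  qed
  moreover have "vmap j' (vmap j v) = v" if "v \<in> verts H" for v
    using that hv[OF that] m(7) dj(6) dj'(6) by (meson inj_onD)
  ultimately show ?thesis
    by (auto simp: comp_dmap_def id_dmap_def compose_def)
qed

lemma factor_iso:
  assumes "embedding H G h" "embedding K G k" "digraph_map H K j" "digraph_map K H j'"
    "h = comp_dmap H k j" "k = comp_dmap K h j'"
  shows "digraph_iso H K j"
  unfolding digraph_iso_def using factor_unique_id[of H G h K j j' k] factor_unique_id[of K G k H j' j h] assms
  by blast

section \<open>Classes of embeddings\<close>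

text \<open>Equal images give factorisations in both directions, which are mutually inverse. The
  existence of an isomorphism is thereby replaced by three equations between sets, from which it is
  evident that this is an equivalence relation.\<close>

lemma emb_rel_iff:
  "((H, f), (K, h)) \<in> emb_rel G \<longleftrightarrow> embedding H G f \<and> embedding K G h
     \<and> vmap f ` verts H = vmap h ` verts K \<and> emap f ` edges H = emap h ` edges K
     \<and> inner_image H f = inner_image K h" (is "?L \<longleftrightarrow> ?R")
proof
  assume ?L
  then obtain z w where fh: "embedding H G f" "embedding K G h"
    and z: "digraph_map H K z" "digraph_map K H w"
    and zw: "f = comp_dmap H h z" "comp_dmap K z w = id_dmap K"
    by (auto simp: emb_rel_def embs_def digraph_iso_def)
  note dh = digraph_mapD[OF embeddingD(5)[OF fh(2)]] and dw = digraph_mapD[OF z(2)]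
  have "emap z (emap w e) = e" if "e \<in> edges K" for e
    using arg_cong[OF zw(2), of "\<lambda>m. emap m e"] that by (simp add: comp_dmap_def compose_def id_dmap_def)
  then have "emap h = emap (comp_dmap K f w)"
    using dh(3) dw(5) by (auto simp: zw(1) comp_dmap_def compose_def extensional_def fun_eq_iff)
  moreover have "vmap z (vmap w v) = v" if "v \<in> verts K" for v
    using arg_cong[OF zw(2), of "\<lambda>m. vmap m v"] that by (simp add: comp_dmap_def compose_def id_dmap_def)
  then have "vmap h = vmap (comp_dmap K f w)"
    using dh(4) dw(6) by (auto simp: zw(1) comp_dmap_def compose_def extensional_def fun_eq_iff)
  ultimately have "h = comp_dmap K f w" by simp
  from fh factor_images[OF z(1) zw(1)] factor_images[OF z(2) this]
  show ?R by (intro conjI equalityI)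
next
  assume R: ?R
  then obtain j where j: "embedding H K j" "f = comp_dmap H h j"
    using factor_exists[of H G f K h] by (metis order_refl)
  obtain j' where j': "embedding K H j'" "h = comp_dmap K f j'"
    using R factor_exists[of K G h H f] by (metis order_refl)
  have "digraph_iso H K j"
    by (rule factor_iso[of H G f K h, OF _ _ embeddingD(5)[OF j(1)] embeddingD(5)[OF j'(1)] j(2) j'(2)])
      (use R in simp_all)
  then have "\<exists>z. digraph_iso H K z \<and> f = comp_dmap H h z" using j(2) by blast
  then show ?L using R by (simp add: emb_rel_def embs_def)
qed

definition inner_edges :: "('e, 'v) emb set \<Rightarrow> 'e set" where
  "inner_edges c = inner_image (rep_dom c) (rep_map c)"

text \<open>Justifies the choice of a representative by \<open>SOME\<close>: the images can be
  computed from any member.\<close>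

lemma Emb_member:
  assumes c: "c \<in> Emb G" and H: "(H, h) \<in> c"
  shows "embedding H G h" "vert_image c = vmap h ` verts H" "edge_image c = emap h ` edges H"
    "inner_edges c = inner_image H h"
proof -
  obtain K k where K: "c = emb_rel G `` {(K, k)}"
    using c by (auto simp: Emb_def quotient_def)
  have "((K, k), (rep_dom c, rep_map c)) \<in> emb_rel G"
    using someI[of "\<lambda>x. x \<in> c", OF H] by (auto simp: K rep_dom_def rep_map_def)
  moreover have "((K, k), (H, h)) \<in> emb_rel G" using H K by auto
  ultimately show "embedding H G h" "vert_image c = vmap h ` verts H" "edge_image c = emap h ` edges H"
    "inner_edges c = inner_image H h"
    by (auto simp: emb_rel_iff vert_image_def edge_image_def inner_edges_def)
qed

lemma Emb_rep:
  assumes c: "c \<in> Emb G"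
  shows "(rep_dom c, rep_map c) \<in> c" "embedding (rep_dom c) G (rep_map c)"
proof -
  obtain K k where K: "c = emb_rel G `` {(K, k)}" "embedding K G k"
    using c by (auto simp: Emb_def quotient_def embs_def)
  then have "(K, k) \<in> c" by (auto simp: emb_rel_iff)
  then show "(rep_dom c, rep_map c) \<in> c"
    using someI[of "\<lambda>x. x \<in> c"] by (auto simp: rep_dom_def rep_map_def)
  then show "embedding (rep_dom c) G (rep_map c)" using Emb_member c by blast
qed

lemma emb_class_Emb:
  assumes "embedding H G h"
  shows "emb_class G (H, h) \<in> Emb G" "(H, h) \<in> emb_class G (H, h)"
  using assms by (auto simp: emb_class_def Emb_def embs_def emb_rel_iff intro: quotientI)

lemma Emb_eqI:
  assumes c: "c \<in> Emb G" and d: "d \<in> Emb G" and "vert_image c = vert_image d"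
    "edge_image c = edge_image d" "inner_edges c = inner_edges d"
  shows "c = d"
proof -
  have *: "x \<in> b \<longleftrightarrow> embedding (fst x) G (snd x) \<and> vmap (snd x) ` verts (fst x) = vert_image b
      \<and> emap (snd x) ` edges (fst x) = edge_image b \<and> inner_image (fst x) (snd x) = inner_edges b"
    if b: "b \<in> Emb G" for b x
  proof -
    obtain H h where x: "x = (H, h)" by force
    obtain K k where K: "b = emb_rel G `` {(K, k)}" "embedding K G k"
      using b by (auto simp: Emb_def quotient_def embs_def)
    then have "(K, k) \<in> b" by (auto simp: emb_rel_iff)
    from Emb_member[OF b this] show ?thesis unfolding x by (auto simp: K(1) emb_rel_iff)
  qed
  show ?thesis using *[OF c] *[OF d] assms by auto
qed

text \<open>By \<open>factor_exists\<close> no factoring embedding has to be constructed later on;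
  reflexivity and transitivity become set theory.\<close>

lemma emb_le_iff:
  assumes c: "c \<in> Emb G" and d: "d \<in> Emb G"
  shows "emb_le c d \<longleftrightarrow> vert_image c \<subseteq> vert_image d \<and> edge_image c \<subseteq> edge_image d
    \<and> inner_edges c \<subseteq> inner_edges d" (is "?L \<longleftrightarrow> ?R")
proof
  assume ?L
  then obtain H h K k j where H: "(H, h) \<in> c" "(K, k) \<in> d" and j: "embedding H K j" "h = comp_dmap H k j"
    by (auto simp: emb_le_def)
  show ?R using factor_images[OF embeddingD(5)[OF j(1)] j(2)] Emb_member[OF c H(1)] Emb_member[OF d H(2)]
    by simp
next
  assume ?R
  then obtain j where "embedding (rep_dom c) (rep_dom d) j"
    "rep_map c = comp_dmap (rep_dom c) (rep_map d) j"
    using factor_exists[OF Emb_rep(2)[OF c] Emb_rep(2)[OF d]]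
    by (auto simp: vert_image_def edge_image_def inner_edges_def)
  then show ?L
    unfolding emb_le_def
    by (intro bexI[OF _ Emb_rep(1)[OF c]] case_prodI bexI[OF _ Emb_rep(1)[OF d]] exI conjI)
qed

section \<open>Normal forms of classes: single edges, and vertex sets with their uncut edges\<close>

definition edge_shape :: "('e, 'v) digraph \<Rightarrow> ('e, 'v) emb set \<Rightarrow> 'e \<Rightarrow> bool" where
  "edge_shape G c e \<longleftrightarrow> c \<in> Emb G \<and> e \<in> edges G \<and> vert_image c = {} \<and> edge_image c = {e}
     \<and> inner_edges c = {} \<and> in_class c = {#e#} \<and> out_class c = {#e#}"

definition part_shape :: "('e, 'v) digraph \<Rightarrow> ('e, 'v) emb set \<Rightarrow> 'v set \<Rightarrow> 'e set \<Rightarrow> bool" where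
  "part_shape G c W J \<longleftrightarrow> c \<in> Emb G \<and> connected_part G W J \<and> vert_image c = W
     \<and> edge_image c = inputs G W \<union> outputs G W \<and> inner_edges c = J
     \<and> in_class c = mset_set (inputs G W - J) \<and> out_class c = mset_set (outputs G W - J)"

lemma is_edge_iff: "is_edge c \<longleftrightarrow> vert_image c = {}"
  by (simp add: is_edge_def vert_image_def)

lemma Emb_edge_shape:
  assumes c: "c \<in> Emb G" and v: "vert_image c = {}"
  obtains e where "edge_shape G c e"
proof -
  have "verts (rep_dom c) = {}" using v by (simp add: vert_image_def)
  from embedding_edge_shape[OF Emb_rep(2)[OF c] this] show thesis
    using that c v
    by (auto simp: edge_shape_def edge_image_def in_class_def out_class_def inner_edges_def)
qed

lemma Emb_part_shape:
  assumes c: "c \<in> Emb G" and v: "vert_image c \<noteq> {}"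
  shows "part_shape G c (vert_image c) (inner_edges c)"
proof -
  have "verts (rep_dom c) \<noteq> {}" using v by (simp add: vert_image_def)
  from embedding_shape[OF Emb_rep(2)[OF c] this] show ?thesis
    using c
    by (auto simp: part_shape_def vert_image_def edge_image_def in_class_def out_class_def inner_edges_def)
qed

text \<open>Realising a part in which some edges are cut needs a new edge for every cut edge.\<close>

lemma embedding_part_exists:
  fixes G :: "('e::infinite, 'v) digraph"
  assumes G: "connected_digraph G" and W: "connected_part G W J"
  obtains c where "part_shape G c W J"
proof -
  have dG: "digraph G" using G by (rule connected_digraphD)
  define I O' C where "I = inputs G W" and "O' = outputs G W" and "C = I \<inter> O' - J"
  have fin: "finite (edges G)" "finite I" "finite O'" "finite C"
    using dG by (auto simp: I_def O'_def C_def finite_edges finite_inputs finite_outputs)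
  have sub: "I \<subseteq> iedges G" "O' \<subseteq> oedges G" "I \<subseteq> edges G" "O' \<subseteq> edges G" "J \<subseteq> I" "J \<subseteq> O'" "C \<subseteq> edges G"
    using digraph_edgeD[OF dG] W inputs_subset[of G W] outputs_subset[of G W]
    by (auto simp: I_def O'_def C_def connected_part_def)
  have "infinite (- edges G)" using fin(1) by (simp add: infinite_UNIV Compl_eq_Diff_UNIV)
  \<comment> \<open>Fresh names for the output halves of the cut edges \<open>C\<close>; the input
    halves keep the original names. The map \<open>p\<close> below undoes the renaming.\<close>
  then obtain B where B: "finite B" "card B = card C" "B \<subseteq> - edges G"
    using infinite_arbitrarily_large by metis
  obtain g where "bij_betw g C B" using finite_same_card_bij[OF fin(4) B(1)] B(2) by auto
  then have g: "inj_on g C" "g ` C \<inter> edges G = {}"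
    using B(3) by (auto simp: bij_betw_def)
  define p where "p = (\<lambda>e. if e \<in> g ` C then inv_into C g e else e)"
  have pg: "p (g e) = e" if "e \<in> C" for e using that g(1) by (simp add: p_def)
  have pe: "p e = e" if "e \<in> edges G" for e using that g(2) by (auto simp: p_def)
  define OH where "OH = (O' - C) \<union> g ` C"
  have pe': "p e = e" if "e \<in> O'" for e using that pe sub(4) by blast
  have pO: "bij_betw p OH O'"
  proof (rule bij_betw_imageI)
    show "inj_on p OH"
    proof (rule inj_onI)
      fix a b assume "a \<in> OH" "b \<in> OH" "p a = p b"
      then show "a = b" 
        unfolding OH_def by (elim UnE imageE) (auto simp: pg pe')
    qed
    show "p ` OH = O'"
    proof
      show "p ` OH \<subseteq> O'" using pg pe sub by (auto simp: OH_def C_def)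
      show "O' \<subseteq> p ` OH"
      proof
        fix x assume x: "x \<in> O'"
        show "x \<in> p ` OH"
        proof (cases "x \<in> C")
          case True
          then show ?thesis using pg by (force simp: OH_def)
        next
          case False
          then show ?thesis using x pe sub(4) by (force simp: OH_def)
        qed
      qed
    qed
  qed
  have pOH: "p e \<in> O'" if "e \<in> OH" for e using bij_betwE[OF pO] that by blast
  have pI: "p e = e" if "e \<in> I" for e using that pe sub(3) by blast
  define H where "H = \<lparr>edges = I \<union> OH, iedges = I, oedges = OH, verts = W,
    ivert = restrict (ivert G) I, overt = restrict (\<lambda>e. overt G (p e)) OH\<rparr>"
  define h where "h = \<lparr>emap = restrict p (I \<union> OH), vmap = (\<lambda>v \<in> W. v)\<rparr>"
  have WG: "W \<subseteq> verts G" "W \<noteq> {}" using W by (auto simp: connected_part_def)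
  have iW: "ivert G e \<in> W" if "e \<in> I" for e using that by (simp add: I_def inputs_def)
  have oW: "overt G e \<in> W" if "e \<in> O'" for e using that by (simp add: O'_def outputs_def)
  have dH: "digraph H"
    unfolding digraph_def H_def
    using fin finite_subset[OF WG(1)] finite_verts[OF dG] iW oW pOH by (auto simp: OH_def)
  \<comment> \<open>The output half of a cut edge now has a name outside \<open>G\<close>, so
    exactly the edges in \<open>J\<close> keep both ends.\<close>
  have io: "I \<inter> OH = J" using g(2) sub by (auto simp: OH_def C_def)
  have "connected_part H W J"
    unfolding connected_part_def
  proof (intro conjI allI impI)
    show "J \<subseteq> inputs H W \<inter> outputs H W"
      using io iW oW pOH by (auto simp: H_def inputs_def outputs_def)
    fix A assume A: "A \<subseteq> W" "A \<noteq> {}" "A \<noteq> W"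
    then obtain e where e: "e \<in> J" "(ivert G e \<in> A) \<noteq> (overt G e \<in> A)"
      using W unfolding connected_part_def by blast
    have "e \<in> I" "e \<in> OH" "p e = e" using e(1) io pe sub by auto
    then show "\<exists>e\<in>J. (ivert H e \<in> A) \<noteq> (overt H e \<in> A)"
      using e by (intro bexI[of _ e]) (auto simp: H_def)
  qed (use WG in \<open>auto simp: H_def\<close>)
  then have cH: "connected_digraph H"
    using connected_digraphI[OF dH] WG(2) io by (simp add: H_def)
  have map: "digraph_map H G h"
    unfolding digraph_map_def using dH dG WG sub pOH pI iW oW
    by (auto simp: H_def h_def)
  have bi: "bij_betw (\<lambda>a. (ivert H a, emap h a)) (iedges H)
      {(b, c). b \<in> verts H \<and> c \<in> iedges G \<and> vmap h b = ivert G c}"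
  proof -
    have "bij_betw (\<lambda>c. (ivert G c, c)) I {(b, c). b \<in> W \<and> c \<in> iedges G \<and> b = ivert G c}"
      by (auto simp: bij_betw_def inj_on_def I_def inputs_def)
    moreover have "{(b, c). b \<in> verts H \<and> c \<in> iedges G \<and> vmap h b = ivert G c}
        = {(b, c). b \<in> W \<and> c \<in> iedges G \<and> b = ivert G c}"
      by (auto simp: H_def h_def)
    ultimately show ?thesis
      by (subst bij_betw_cong[where g = "\<lambda>c. (ivert G c, c)"]) (auto simp: H_def h_def pI)
  qed
  have bo: "bij_betw (\<lambda>a. (overt H a, emap h a)) (oedges H)
      {(b, c). b \<in> verts H \<and> c \<in> oedges G \<and> vmap h b = overt G c}"
  proof -
    have "bij_betw (\<lambda>c. (overt G c, c)) O' {(b, c). b \<in> W \<and> c \<in> oedges G \<and> b = overt G c}"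
      by (auto simp: bij_betw_def inj_on_def O'_def outputs_def)
    from bij_betw_trans[OF pO this]
    have "bij_betw (\<lambda>a. (overt G (p a), p a)) OH {(b, c). b \<in> W \<and> c \<in> oedges G \<and> b = overt G c}"
      by (simp add: o_def)
    moreover have "{(b, c). b \<in> verts H \<and> c \<in> oedges G \<and> vmap h b = overt G c}
        = {(b, c). b \<in> W \<and> c \<in> oedges G \<and> b = overt G c}"
      by (auto simp: H_def h_def)
    ultimately show ?thesis
      by (subst bij_betw_cong[where g = "\<lambda>a. (overt G (p a), p a)"]) (auto simp: H_def h_def)
  qed
  have emb: "embedding H G h"
    using cH G map bi bo
    by (simp add: embedding_def etale_def pullback_square_def) (simp add: h_def H_def inj_on_def)
  note c = emb_class_Emb[OF emb] Emb_member[OF emb_class_Emb[OF emb]]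
  have V: "vert_image (emb_class G (H, h)) = W" using c(4) by (simp add: H_def h_def)
  have "p ` J = J" using pe sub by force
  then have "inner_edges (emb_class G (H, h)) = J"
    using c(6) io by (auto simp: inner_image_def H_def h_def)
  then show thesis using that Emb_part_shape[OF c(1)] V WG(2) by simp
qed

lemma id_embedding:
  assumes "connected_digraph G"
  shows "embedding G G (id_dmap G)"
proof -
  have d: "digraph G" using assms by (rule connected_digraphD)
  note v = digraph_vertD[OF d] and e = digraph_edgeD[OF d]
  have "digraph_map G G (id_dmap G)"
    unfolding digraph_map_def using d v e by (auto simp: id_dmap_def)
  then show ?thesis
    using assms v e
    by (auto simp: embedding_def etale_def pullback_square_def id_dmap_def bij_betw_def inj_on_def image_iff)
qed

lemma id_class_images:
  assumes "connected_digraph G"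
  shows "id_class G \<in> Emb G" "vert_image (id_class G) = verts G" "edge_image (id_class G) = edges G"
    "inner_edges (id_class G) = iedges G \<inter> oedges G"
proof -
  note emb = id_embedding[OF assms]
  note c = emb_class_Emb[OF emb] Emb_member[OF emb_class_Emb[OF emb]]
  show "id_class G \<in> Emb G" "vert_image (id_class G) = verts G" "edge_image (id_class G) = edges G"
    using c by (auto simp: id_class_def id_dmap_def)
  show "inner_edges (id_class G) = iedges G \<inter> oedges G"
    using c digraph_edgeD[OF connected_digraphD[OF assms]]
    by (auto simp: id_class_def id_dmap_def inner_image_def image_iff)
qed

lemma Emb_connected: "c \<in> Emb G \<Longrightarrow> connected_digraph G"
  using Emb_rep(2) embeddingD(2) by blast

lemma Emb_digraph: "c \<in> Emb G \<Longrightarrow> digraph G"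
  by (rule connected_digraphD[OF Emb_connected])

lemma part_shapeD:
  assumes "part_shape G c W J"
  shows "c \<in> Emb G" "connected_part G W J" "vert_image c = W"
    "edge_image c = inputs G W \<union> outputs G W" "inner_edges c = J"
    "in_class c = mset_set (inputs G W - J)" "out_class c = mset_set (outputs G W - J)"
    "set_mset (in_class c) = inputs G W - J" "set_mset (out_class c) = outputs G W - J"
    "W \<noteq> {}" "W \<subseteq> verts G" "J \<subseteq> inputs G W" "J \<subseteq> outputs G W"
proof -
  show *: "c \<in> Emb G" "connected_part G W J" "vert_image c = W"
    "edge_image c = inputs G W \<union> outputs G W" "inner_edges c = J"
    "in_class c = mset_set (inputs G W - J)" "out_class c = mset_set (outputs G W - J)"
    using assms by (auto simp: part_shape_def)
  show "set_mset (in_class c) = inputs G W - J" "set_mset (out_class c) = outputs G W - J"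
    using * Emb_digraph[OF *(1)] by (simp_all add: finite_inputs finite_outputs)
  show "W \<noteq> {}" "W \<subseteq> verts G" "J \<subseteq> inputs G W" "J \<subseteq> outputs G W"
    using *(2) by (auto simp: connected_part_def)
qed

lemma edge_shapeD:
  assumes "edge_shape G c e"
  shows "c \<in> Emb G" "e \<in> edges G" "vert_image c = {}" "edge_image c = {e}" "inner_edges c = {}"
    "in_class c = {#e#}" "out_class c = {#e#}"
  using assms by (auto simp: edge_shape_def)

text \<open>As the uncut edges are a subset of \<open>inputs G W\<close>, they can be recovered from
  their complement there, which is the set of inputs. For a class without vertices the single input
  is the edge itself.\<close>

lemma Emb_eqI_in:
  assumes c: "c \<in> Emb G" and d: "d \<in> Emb G" and V: "vert_image c = vert_image d"
    and i: "in_class c = in_class d"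
  shows "c = d"
proof (cases "vert_image c = {}")
  case True
  obtain e where e: "edge_shape G c e" using Emb_edge_shape[OF c True] .
  obtain e' where e': "edge_shape G d e'" using Emb_edge_shape[OF d] True V by metis
  show ?thesis
    using Emb_eqI[OF c d V] i edge_shapeD[OF e] edge_shapeD[OF e'] by simp
next
  case False
  note sc = part_shapeD[OF Emb_part_shape[OF c False]]
  have sd: "part_shape G d (vert_image c) (inner_edges d)" using Emb_part_shape[OF d] False V by simp
  have "inputs G (vert_image c) - inner_edges c = inputs G (vert_image c) - inner_edges d"
    using sc(8) part_shapeD(8)[OF sd] i by simp
  then have "inner_edges c = inner_edges d" using sc(12) part_shapeD(12)[OF sd] by blast
  then show ?thesis using Emb_eqI[OF c d V] sc(4) part_shapeD(4)[OF sd] by simp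
qed

lemma in_class_edges: "c \<in> Emb G \<Longrightarrow> set_mset (in_class c) \<subseteq> edge_image c"
  and out_class_edges: "c \<in> Emb G \<Longrightarrow> set_mset (out_class c) \<subseteq> edge_image c"
  and edge_image_edges: "c \<in> Emb G \<Longrightarrow> edge_image c \<subseteq> edges G"
  and vert_image_verts: "c \<in> Emb G \<Longrightarrow> vert_image c \<subseteq> verts G"
proof -
  assume c: "c \<in> Emb G"
  note io = digraph_edgeD[OF Emb_digraph[OF c]] and sub = inputs_subset[of G] outputs_subset[of G]
  have "set_mset (in_class c) \<subseteq> edge_image c \<and> set_mset (out_class c) \<subseteq> edge_image c
    \<and> edge_image c \<subseteq> edges G \<and> vert_image c \<subseteq> verts G"
  proof (cases "vert_image c = {}")
    case True
    then obtain e where "edge_shape G c e" using Emb_edge_shape[OF c] by blast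
    then show ?thesis by (simp add: edge_shape_def)
  next
    case False
    note s = part_shapeD[OF Emb_part_shape[OF c False]]
    have "edge_image c \<subseteq> edges G" using s(4) io sub by blast
    then show ?thesis using s(4,8,9,11) by auto
  qed
  then show "set_mset (in_class c) \<subseteq> edge_image c" "set_mset (out_class c) \<subseteq> edge_image c"
    "edge_image c \<subseteq> edges G" "vert_image c \<subseteq> verts G" by auto
qed

section \<open>Corollas, gluing and growth of connected parts\<close>

definition part_class :: "('e, 'v) digraph \<Rightarrow> 'v set \<Rightarrow> 'e set \<Rightarrow> ('e, 'v) emb set" where
  "part_class G W J = (THE c. part_shape G c W J)"

text \<open>A loop at \<open>v\<close> is cut too. With no uncut edges this lies below every class
  that contains \<open>v\<close>, so that it can start any growth.\<close>

definition corolla :: "('e, 'v) digraph \<Rightarrow> 'v \<Rightarrow> ('e, 'v) emb set" where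
  "corolla G v = part_class G {v} {}"

lemma part_shape_unique: "part_shape G c W J \<Longrightarrow> part_shape G d W J \<Longrightarrow> c = d"
  by (rule Emb_eqI) (auto simp: part_shape_def)

lemma edge_shape_unique: "edge_shape G c e \<Longrightarrow> edge_shape G d e \<Longrightarrow> c = d"
  by (rule Emb_eqI) (auto simp: edge_shape_def)

lemma part_class_eq: "part_shape G c W J \<Longrightarrow> part_class G W J = c"
  unfolding part_class_def using part_shape_unique by (metis the_equality)

lemma part_class_shape:
  fixes G :: "('e::infinite, 'v) digraph"
  assumes "connected_digraph G" "connected_part G W J"
  shows "part_shape G (part_class G W J) W J"
  using embedding_part_exists[OF assms] part_class_eq by metis

lemma connected_part_singleton: "v \<in> verts G \<Longrightarrow> connected_part G {v} {}"
  by (auto simp: connected_part_def)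

lemma corolla_shape:
  fixes G :: "('e::infinite, 'v) digraph"
  assumes "connected_digraph G" "v \<in> verts G"
  shows "part_shape G (corolla G v) {v} {}"
  unfolding corolla_def by (rule part_class_shape[OF assms(1) connected_part_singleton[OF assms(2)]])

lemma connected_part_add_edge:
  "connected_part G W J \<Longrightarrow> f \<in> inputs G W \<Longrightarrow> f \<in> outputs G W \<Longrightarrow> connected_part G W (insert f J)"
  unfolding connected_part_def by blast

text \<open>A proper subset \<open>A\<close> either splits one of the two parts, which then has a
  crossing edge of its own, or equals one of them, and then \<open>f\<close> crosses.\<close>

lemma connected_part_glue:
  assumes 1: "connected_part G W1 J1" and 2: "connected_part G W2 J2" and d: "W1 \<inter> W2 = {}"
    and f: "f \<in> outputs G W1" "f \<in> inputs G W2"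
  shows "connected_part G (W1 \<union> W2) (insert f (J1 \<union> J2))"
proof -
  have "\<exists>e \<in> insert f (J1 \<union> J2). (ivert G e \<in> A) \<noteq> (overt G e \<in> A)"
    if A: "A \<subseteq> W1 \<union> W2" "A \<noteq> {}" "A \<noteq> W1 \<union> W2" for A
  proof -
    have *: "\<exists>e \<in> J. (ivert G e \<in> A) \<noteq> (overt G e \<in> A)"
      if c: "connected_part G W J" and W: "A \<inter> W \<noteq> {}" "A \<inter> W \<noteq> W" for W J
    proof -
      obtain e where e: "e \<in> J" "(ivert G e \<in> A \<inter> W) \<noteq> (overt G e \<in> A \<inter> W)"
        using c W unfolding connected_part_def by (meson inf_le2)
      moreover have "ivert G e \<in> W" "overt G e \<in> W"
        using c e(1) by (auto simp: connected_part_def inputs_def outputs_def)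
      ultimately show ?thesis by auto
    qed
    consider "A \<inter> W1 \<noteq> {}" "A \<inter> W1 \<noteq> W1" | "A \<inter> W2 \<noteq> {}" "A \<inter> W2 \<noteq> W2" | "A = W1" | "A = W2"
      using A by blast
    then show ?thesis
    proof cases
      case 1
      then show ?thesis using *[OF assms(1)] by blast
    next
      case 2
      then show ?thesis using *[OF assms(2)] by blast
    qed (use f d in \<open>auto simp: inputs_def outputs_def\<close>)
  qed
  moreover have "insert f (J1 \<union> J2) \<subseteq> inputs G (W1 \<union> W2) \<inter> outputs G (W1 \<union> W2)"
    using 1 2 f by (auto simp: connected_part_def inputs_Un outputs_Un)
  ultimately show ?thesis
    using 1 2 by (auto simp: connected_part_def)
qed

text \<open>The edge \<open>f\<close> is an output of the first part and an input of the second, and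
  it disappears from both boundaries of the union. Adding it on the left instead of subtracting it
  on the right lets \<open>image_mset\<close> be applied to the equations directly.\<close>

lemma glue_boundary:
  assumes G: "digraph G" and 1: "connected_part G W1 J1" and 2: "connected_part G W2 J2"
    and d: "W1 \<inter> W2 = {}" and f: "f \<in> outputs G W1" "f \<notin> J1" "f \<in> inputs G W2" "f \<notin> J2"
  shows "add_mset f (mset_set (inputs G (W1 \<union> W2) - insert f (J1 \<union> J2)))
      = mset_set (inputs G W1 - J1) + mset_set (inputs G W2 - J2)"
    "add_mset f (mset_set (outputs G (W1 \<union> W2) - insert f (J1 \<union> J2)))
      = mset_set (outputs G W1 - J1) + mset_set (outputs G W2 - J2)"
proof -
  note fin = finite_inputs[OF G] finite_outputs[OF G]
  have J: "J1 \<subseteq> inputs G W1" "J1 \<subseteq> outputs G W1" "J2 \<subseteq> inputs G W2" "J2 \<subseteq> outputs G W2"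
    using 1 2 by (auto simp: connected_part_def)
  note dis = inputs_disjoint[OF d, of G] outputs_disjoint[OF d, of G]
  have "insert f (inputs G (W1 \<union> W2) - insert f (J1 \<union> J2)) = (inputs G W1 - J1) \<union> (inputs G W2 - J2)"
    using J dis f by (auto simp: inputs_Un)
  then have "mset_set (insert f (inputs G (W1 \<union> W2) - insert f (J1 \<union> J2)))
      = mset_set (inputs G W1 - J1) + mset_set (inputs G W2 - J2)"
    using dis fin by (subst mset_set_Union[symmetric]) auto
  then show "add_mset f (mset_set (inputs G (W1 \<union> W2) - insert f (J1 \<union> J2)))
      = mset_set (inputs G W1 - J1) + mset_set (inputs G W2 - J2)"
    using fin by simp
  have "insert f (outputs G (W1 \<union> W2) - insert f (J1 \<union> J2)) = (outputs G W1 - J1) \<union> (outputs G W2 - J2)"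
    using J dis f by (auto simp: outputs_Un)
  then have "mset_set (insert f (outputs G (W1 \<union> W2) - insert f (J1 \<union> J2)))
      = mset_set (outputs G W1 - J1) + mset_set (outputs G W2 - J2)"
    using dis fin by (subst mset_set_Union[symmetric]) auto
  then show "add_mset f (mset_set (outputs G (W1 \<union> W2) - insert f (J1 \<union> J2)))
      = mset_set (outputs G W1 - J1) + mset_set (outputs G W2 - J2)"
    using fin by simp
qed

text \<open>Edges of \<open>J'\<close> between vertices already reached are added first. When none
  is left, connectedness of the target gives an edge of \<open>J'\<close> from \<open>W\<close> to a
  new vertex. A vertex enters with a single edge; its further connections are made by later
  \<open>edge\<close> steps.\<close>

lemma connected_part_grow [consumes 5, case_names start edge vertex]:
  assumes G: "digraph G" and W': "connected_part G W' J'" and W: "connected_part G W J"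
    and sub: "W \<subseteq> W'" "J \<subseteq> J'"
    and start: "P W J"
    and edge: "\<And>W J f. connected_part G W J \<Longrightarrow> P W J \<Longrightarrow> f \<in> inputs G W \<Longrightarrow> f \<in> outputs G W \<Longrightarrow> f \<notin> J
      \<Longrightarrow> P W (insert f J)"
    and vertex: "\<And>W J u f. connected_part G W J \<Longrightarrow> P W J \<Longrightarrow> u \<in> verts G \<Longrightarrow> u \<notin> W \<Longrightarrow> f \<notin> J
      \<Longrightarrow> f \<in> outputs G W \<and> f \<in> inputs G {u} \<or> f \<in> outputs G {u} \<and> f \<in> inputs G W
      \<Longrightarrow> P (insert u W) (insert f J)"
  shows "P W' J'"
  using W sub start
proof (induction "card (W' - W) + card (J' - J)" arbitrary: W J rule: less_induct)
  case (less W J)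
  have c': "W' \<subseteq> verts G" "J' \<subseteq> inputs G W'" "J' \<subseteq> outputs G W'"
    using W' by (auto simp: connected_part_def)
  have c: "W \<noteq> {}" "J \<subseteq> inputs G W" "J \<subseteq> outputs G W"
    using less.prems(1) by (auto simp: connected_part_def)
  have fin: "finite (W' - W)" "finite (J' - J)"
    using finite_subset[OF c'(1)] finite_subset[OF c'(2)] G
    by (auto simp: finite_verts finite_inputs)
  have smaller: "card (J' - insert f J) < card (J' - J)" if "f \<in> J'" "f \<notin> J" for f
    by (rule psubset_card_mono[OF fin(2)]) (use that in auto)
  show ?case
  proof (cases "\<exists>f \<in> J' - J. f \<in> inputs G W \<and> f \<in> outputs G W")
    case True
    then obtain f where f: "f \<in> J'" "f \<notin> J" "f \<in> inputs G W" "f \<in> outputs G W" by auto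
    show ?thesis
      using less.hyps[of W "insert f J"] smaller[OF f(1,2)] connected_part_add_edge[OF less.prems(1) f(3,4)]
        edge[OF less.prems(1,4) f(3,4,2)] less.prems f(1) by simp
  next
    case False
    show ?thesis
    proof (cases "W = W'")
      case True
      then have "J = J'" using False c' less.prems(3) by blast
      then show ?thesis using True less.prems by simp
    next
      case neq: False
      obtain f where f: "f \<in> J'" "(ivert G f \<in> W) \<noteq> (overt G f \<in> W)"
        using W' less.prems(2) c(1) neq unfolding connected_part_def by meson
      have fJ: "f \<notin> J" using f(2) c by (auto simp: inputs_def outputs_def)
      have fW: "f \<in> iedges G" "ivert G f \<in> W'" "f \<in> oedges G" "overt G f \<in> W'"
        using f(1) c' by (auto simp: inputs_def outputs_def)
      define u where "u = (if ivert G f \<in> W then overt G f else ivert G f)"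
      have u: "u \<in> W'" "u \<notin> W" "u \<in> verts G" using f(2) fW c'(1) by (auto simp: u_def)
      have fu: "f \<in> outputs G W \<and> f \<in> inputs G {u} \<or> f \<in> outputs G {u} \<and> f \<in> inputs G W"
        using f(2) fW by (auto simp: u_def inputs_def outputs_def)
      have "connected_part G (insert u W) (insert f J)"
        using connected_part_glue[OF less.prems(1) connected_part_singleton[OF u(3)], of f]
          connected_part_glue[OF connected_part_singleton[OF u(3)] less.prems(1), of f] fu u(2) by auto
      moreover have "card (W' - insert u W) < card (W' - W)"
        by (rule psubset_card_mono[OF fin(1)]) (use u in auto)
      ultimately show ?thesis
        using less.hyps[of "insert u W" "insert f J"] smaller[OF f(1) fJ]
          vertex[OF less.prems(1,4) u(3,2) fJ fu] less.prems u(1) f(1) by simp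
    qed
  qed
qed

section \<open>Acyclic graphs and structured subgraphs\<close>

definition adj :: "('e, 'v) digraph \<Rightarrow> ('v \<times> 'v) set" where
  "adj G = {(u, w). \<exists>e. e \<in> outputs G {u} \<and> e \<in> inputs G {w}}"

text \<open>Convexity is expressed by vertices alone, and for an arbitrary relation, so that
  statements about growing along edges can also be applied to the converse relation.\<close>

definition rel_convex :: "('a \<times> 'a) set \<Rightarrow> 'a set \<Rightarrow> bool" where
  "rel_convex r W \<longleftrightarrow> (\<forall>u \<in> W. \<forall>w \<in> W. \<forall>v. (u, v) \<in> r\<^sup>* \<longrightarrow> (v, w) \<in> r\<^sup>* \<longrightarrow> v \<in> W)"

lemma adj_verts: "digraph G \<Longrightarrow> adj G \<subseteq> verts G \<times> verts G"
  using digraph_vertD by (fastforce simp: adj_def inputs_def outputs_def)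

lemma finite_adj: "digraph G \<Longrightarrow> finite (adj G)"
  using adj_verts finite_verts by (metis finite_SigmaI finite_subset)

lemma adj_iff: "(u, w) \<in> adj G \<longleftrightarrow> (\<exists>e. e \<in> out_vert G u \<and> e \<in> in_vert G w)"
  by (auto simp: adj_def inputs_def outputs_def in_vert_def out_vert_def)

lemma dipath_snoc:
  assumes p: "dipath G es vs" and v: "last es \<in> in_vert G v" "e \<in> out_vert G v" and G: "digraph G"
  shows "dipath G (es @ [e]) (vs @ [v])"
proof -
  have l: "length es = Suc (length vs)" using p by (simp add: dipath_def)
  then have "es \<noteq> []" by auto
  then have "es ! length vs = last es" using l by (simp add: last_conv_nth)
  then show ?thesis
    using p v l digraph_edgeD[OF G] digraph_vertD[OF G]
    by (auto simp: dipath_def nth_append less_Suc_eq in_vert_def out_vert_def)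
qed

text \<open>A path whose last edge enters \<open>v\<close> need not contain \<open>v\<close>.
  Extending it to an edge entering \<open>w\<close> makes \<open>v\<close> a vertex of the path, as
  needed when convexity is applied.\<close>

lemma dipath_extend:
  assumes vw: "(v, w) \<in> (adj G)\<^sup>+" and G: "digraph G"
    and p: "dipath G es vs" "last es \<in> in_vert G v"
  shows "\<exists>es' vs'. dipath G es' vs' \<and> hd es' = hd es \<and> v \<in> set vs' \<and> last es' \<in> in_vert G w"
  using vw
proof induction
  case (base y)
  then obtain e where e: "e \<in> out_vert G v" "e \<in> in_vert G y" by (auto simp: adj_iff)
  have "es \<noteq> []" using p(1) by (auto simp: dipath_def)
  then show ?case
    using dipath_snoc[OF p e(1) G] e by (intro exI[of _ "es @ [e]"] exI[of _ "vs @ [v]"]) auto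
next
  case (step y z)
  then obtain es' vs' where p': "dipath G es' vs'" "hd es' = hd es" "v \<in> set vs'" "last es' \<in> in_vert G y"
    by blast
  obtain e where e: "e \<in> out_vert G y" "e \<in> in_vert G z" using step.hyps(2) by (auto simp: adj_iff)
  have "es' \<noteq> []" using p'(1) by (auto simp: dipath_def)
  then show ?case
    using dipath_snoc[OF p'(1,4) e(1) G] e p' by (intro exI[of _ "es' @ [e]"] exI[of _ "vs' @ [y]"]) auto
qed

lemma dipath_exists:
  assumes "(u, w) \<in> (adj G)\<^sup>+" and G: "digraph G"
  shows "\<exists>es vs. dipath G es vs \<and> hd es \<in> out_vert G u \<and> last es \<in> in_vert G w"
proof -
  obtain v where v: "(u, v) \<in> adj G" "(v, w) \<in> (adj G)\<^sup>*" using assms(1) by (metis tranclD)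
  then obtain e where e: "e \<in> out_vert G u" "e \<in> in_vert G v" by (auto simp: adj_iff)
  have p: "dipath G [e] []"
    using e digraph_edgeD[OF G] by (auto simp: dipath_def in_vert_def)
  show ?thesis
  proof (cases "v = w")
    case True
    then show ?thesis using p e by force
  next
    case False
    then have "(v, w) \<in> (adj G)\<^sup>+" using v(2) by (metis rtranclD)
    from dipath_extend[OF this G p] e show ?thesis by force
  qed
qed

lemma dipath_rtrancl:
  assumes p: "dipath G es vs" and "i \<le> j" "j < length vs"
  shows "(vs ! i, vs ! j) \<in> (adj G)\<^sup>*"
  using assms(2,3)
proof (induction j)
  case (Suc j)
  show ?case
  proof (cases "i = Suc j")
    case False
    have "(vs ! j, vs ! Suc j) \<in> adj G"
      using p Suc.prems unfolding adj_iff dipath_def by (meson Suc_lessD)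
    then show ?thesis using Suc False by (auto intro: rtrancl_into_rtrancl)
  qed simp
qed simp

lemma acyclic_digraphD:
  assumes "acyclic_digraph G"
  shows "connected_digraph G" "digraph G" "acyclic (adj G)"
proof -
  show c: "connected_digraph G" using assms by (simp add: acyclic_digraph_def)
  then show G: "digraph G" by (rule connected_digraphD)
  show "acyclic (adj G)"
    unfolding acyclic_def
  proof (intro allI notI)
    fix v assume "(v, v) \<in> (adj G)\<^sup>+"
    then obtain es vs where p: "dipath G es vs" "hd es \<in> out_vert G v" "last es \<in> in_vert G v"
      using dipath_exists[OF _ G] by blast
    have "es \<noteq> []" using p(1) by (auto simp: dipath_def)
    \<comment> \<open>The path leaves \<open>v\<close> by its first edge and enters \<open>v\<close>
      by its last one, so passing \<open>v\<close> once more and repeating the first edge closes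
      it.\<close>
    then have "hd (es @ [hd es]) = last (es @ [hd es])" "length (vs @ [v]) \<ge> 1" by auto
    then show False
      using dipath_snoc[OF p(1,3,2) G] assms unfolding acyclic_digraph_def by blast
  qed
qed

section \<open>Structured subgraphs as convex parts without cut edges\<close>

definition structured_part :: "('e, 'v) digraph \<Rightarrow> 'v set \<Rightarrow> bool" where
  "structured_part G W \<longleftrightarrow> connected_part G W (inputs G W \<inter> outputs G W) \<and> rel_convex (adj G) W"

lemma sSb_Emb: "sSb G \<subseteq> Emb G"
  using emb_class_Emb(1) by (fastforce simp: sSb_def convex_inclusion_def)

text \<open>Injectivity on edges is what forbids cut edges: it makes the image commute with the
  intersection of input and output edges.\<close>

lemma convex_inclusion_inner_edges:
  assumes h: "convex_inclusion H G h"
  shows "inner_image H h = inputs G (vmap h ` verts H) \<inter> outputs G (vmap h ` verts H)"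
proof -
  have emb: "embedding H G h" and inj: "inj_on (emap h) (edges H)"
    using h by (auto simp: convex_inclusion_def)
  have "emap h ` (iedges H \<inter> oedges H) = emap h ` iedges H \<inter> emap h ` oedges H"
    by (rule inj_on_image_Int[OF inj]) (use digraph_edgeD[OF embeddingD(3)[OF emb]] in auto)
  then show ?thesis
    by (simp add: inner_image_def embedding_image_iedges[OF emb] embedding_image_oedges[OF emb])
qed

text \<open>Reachability through \<open>v\<close> becomes a path from an edge leaving
  \<open>u\<close> to an edge entering \<open>w\<close>. Both belong to the image, which contains
  every edge at its vertices.\<close>

lemma convex_inclusion_rel_convex:
  assumes h: "convex_inclusion H G h"
  shows "rel_convex (adj G) (vmap h ` verts H)"
  unfolding rel_convex_def
proof (intro ballI allI impI)
  let ?W = "vmap h ` verts H"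
  fix u w v assume uw: "u \<in> ?W" "w \<in> ?W" and uv: "(u, v) \<in> (adj G)\<^sup>*" "(v, w) \<in> (adj G)\<^sup>*"
  have emb: "embedding H G h" using h by (simp add: convex_inclusion_def)
  note G = embeddingD(4)[OF emb]
  have E: "inputs G ?W \<subseteq> emap h ` edges H" "outputs G ?W \<subseteq> emap h ` edges H"
    using embedding_image_iedges[OF emb] embedding_image_oedges[OF emb]
      digraph_edgeD[OF embeddingD(3)[OF emb]] by blast+
  show "v \<in> ?W"
  proof (cases "u = v \<or> v = w")
    case False
    then have uv: "(u, v) \<in> (adj G)\<^sup>+" "(v, w) \<in> (adj G)\<^sup>+" using uv by (metis rtranclD)+
    obtain es vs where p: "dipath G es vs" "hd es \<in> out_vert G u" "last es \<in> in_vert G v"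
      using dipath_exists[OF uv(1) G] by blast
    obtain es' vs' where p': "dipath G es' vs'" "hd es' = hd es" "v \<in> set vs'" "last es' \<in> in_vert G w"
      using dipath_extend[OF uv(2) G p(1,3)] by blast
    have "hd es' \<in> outputs G ?W" "last es' \<in> inputs G ?W"
      using p p' uw by (auto simp: in_vert_def out_vert_def inputs_def outputs_def)
    then have "set vs' \<subseteq> ?W" using h p'(1) E unfolding convex_inclusion_def by blast
    then show ?thesis using p'(3) by blast
  qed (use uw in auto)
qed

lemma convex_inclusionI:
  assumes emb: "embedding H G h" and v: "verts H \<noteq> {}"
  defines "W \<equiv> vmap h ` verts H"
  assumes J: "inner_image H h = inputs G W \<inter> outputs G W" and conv: "rel_convex (adj G) W"
  shows "convex_inclusion H G h"
proof -
  note m = embeddingD[OF emb]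
  note I = embedding_image_iedges[OF emb] and O = embedding_image_oedges[OF emb]
  have EH: "edges H = iedges H \<union> oedges H" using connected_edges[OF m(1) v] .
  have E: "emap h ` edges H = inputs G W \<union> outputs G W"
    using embedding_shape(2)[OF emb v] by (simp add: W_def)
  \<comment> \<open>The common image has both ends in \<open>W\<close>, hence is not cut and has a
    preimage with both ends; that preimage equals \<open>a\<close> and \<open>b\<close> by
    injectivity on each kind of edge.\<close>
  have io: "a = b" if ab: "a \<in> iedges H" "b \<in> oedges H" "emap h a = emap h b" for a b
  proof -
    have "emap h a \<in> inner_image H h" using ab J I O unfolding W_def by (metis IntI imageI)
    then obtain c where c: "c \<in> iedges H" "c \<in> oedges H" "emap h c = emap h a"
      by (auto simp: inner_image_def)
    have "c = a" by (rule inj_onD[OF embedding_inj_iedges[OF emb] c(3) c(1) ab(1)])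
    moreover have "c = b"
      by (rule inj_onD[OF embedding_inj_oedges[OF emb] trans[OF c(3) ab(3)] c(2) ab(2)])
    ultimately show ?thesis by simp
  qed
  have "inj_on (emap h) (edges H)"
  proof (rule inj_onI)
    fix a b assume ab: "a \<in> edges H" "b \<in> edges H" "emap h a = emap h b"
    consider "a \<in> iedges H" "b \<in> iedges H" | "a \<in> oedges H" "b \<in> oedges H"
      | "a \<in> iedges H" "b \<in> oedges H" | "a \<in> oedges H" "b \<in> iedges H"
      using ab EH by blast
    then show "a = b"
    proof cases
      case 1
      then show ?thesis by (rule inj_onD[OF embedding_inj_iedges[OF emb] ab(3)])
    next
      case 2
      then show ?thesis by (rule inj_onD[OF embedding_inj_oedges[OF emb] ab(3)])
    next
      case 3
      then show ?thesis by (rule io[OF _ _ ab(3)])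
    next
      case 4
      then show ?thesis by (rule io[OF _ _ ab(3)[symmetric], symmetric, rotated])
    qed
  qed
  moreover have "set es \<subseteq> emap h ` edges H \<and> set vs \<subseteq> W"
    if p: "dipath G es vs" and ends: "hd es \<in> emap h ` edges H" "last es \<in> emap h ` edges H" for es vs
  proof -
    have l: "length es = Suc (length vs)" using p by (simp add: dipath_def)
    then have ne: "es \<noteq> []" by auto
    have st: "es ! i \<in> in_vert G (vs ! i)" "es ! Suc i \<in> out_vert G (vs ! i)" if "i < length vs" for i
      using p that by (auto simp: dipath_def)
    \<comment> \<open>The ends of a path are edges, and their vertices in \<open>W\<close> may lie
      outside the path. In that case the path of vertices is prolonged by one step, so that
      convexity of \<open>W\<close> applies.\<close>
    have vW: "vs ! i \<in> W" if i: "i < length vs" for i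
    proof -
      define n where "n = length vs - 1"
      have n: "n < length vs" "Suc n = length vs" "i \<le> n" "0 < length vs" using i by (auto simp: n_def)
      have h0: "hd es = es ! 0" using ne by (simp add: hd_conv_nth)
      have "last es = es ! Suc n" using ne l n(2) by (simp add: last_conv_nth)
      then have ln: "last es \<in> out_vert G (vs ! n)" using st(2)[OF n(1)] by simp
      have "\<exists>u \<in> W. (u, vs ! 0) \<in> (adj G)\<^sup>*"
      proof (cases "hd es \<in> inputs G W")
        case True
        then have "vs ! 0 \<in> W" using st(1)[OF n(4)] h0 by (auto simp: in_vert_def inputs_def)
        then show ?thesis by blast
      next
        case False
        then have "hd es \<in> outputs G W" using ends(1) E by blast
        then have "(overt G (hd es), vs ! 0) \<in> adj G" "overt G (hd es) \<in> W"
          using st(1)[OF n(4)] h0 by (auto simp: in_vert_def outputs_def adj_iff out_vert_def)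
        then show ?thesis by blast
      qed
      moreover have "\<exists>w \<in> W. (vs ! n, w) \<in> (adj G)\<^sup>*"
      proof (cases "last es \<in> outputs G W")
        case True
        then have "vs ! n \<in> W" using ln by (auto simp: out_vert_def outputs_def)
        then show ?thesis by blast
      next
        case False
        then have "last es \<in> inputs G W" using ends(2) E by blast
        then have "(vs ! n, ivert G (last es)) \<in> adj G" "ivert G (last es) \<in> W"
          using ln by (auto simp: in_vert_def inputs_def adj_iff)
        then show ?thesis by blast
      qed
      moreover have "(vs ! 0, vs ! i) \<in> (adj G)\<^sup>*" "(vs ! i, vs ! n) \<in> (adj G)\<^sup>*"
        using dipath_rtrancl[OF p] n i by auto
      ultimately show ?thesis
        using conv unfolding rel_convex_def by (meson rtrancl_trans)
    qed
    have "e \<in> emap h ` edges H" if e: "e \<in> set es" for e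
    proof -
      obtain i where i: "i < length es" "e = es ! i" using e by (auto simp: in_set_conv_nth)
      show ?thesis
      proof (cases "i < length vs")
        case True
        then have "e \<in> inputs G W" using st(1)[OF True] vW[OF True] i by (auto simp: in_vert_def inputs_def)
        then show ?thesis using E by blast
      next
        case False
        then have "e = last es" using i l ne by (simp add: last_conv_nth less_Suc_eq)
        then show ?thesis using ends(2) by simp
      qed
    qed
    moreover have "set vs \<subseteq> W" using vW by (auto simp: in_set_conv_nth)
    ultimately show ?thesis by blast
  qed
  ultimately show ?thesis
    using emb m(7) unfolding convex_inclusion_def W_def by blast
qed

text \<open>Classes without vertices are always structured: in an acyclic graph a path from an edge
  to itself has no steps.\<close>

lemma sSb_iff:
  assumes G: "acyclic_digraph G"
  shows "c \<in> sSb G \<longleftrightarrow> c \<in> Emb G \<and> (vert_image c = {} \<or> 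
    inner_edges c = inputs G (vert_image c) \<inter> outputs G (vert_image c) \<and> rel_convex (adj G) (vert_image c))"
    (is "?L \<longleftrightarrow> ?R")
proof
  assume ?L
  then obtain H h where c: "c = emb_class G (H, h)" and h: "convex_inclusion H G h"
    by (auto simp: sSb_def)
  have emb: "embedding H G h" using h by (simp add: convex_inclusion_def)
  note m = emb_class_Emb[OF emb, folded c] Emb_member[OF emb_class_Emb[OF emb, folded c]]
  show ?R
    unfolding m(4) m(6) using m(1) convex_inclusion_inner_edges[OF h] convex_inclusion_rel_convex[OF h]
    by blast
next
  assume R: ?R
  define H h where "H = rep_dom c" and "h = rep_map c"
  have Hc: "(H, h) \<in> c" and emb: "embedding H G h"
    using Emb_rep R by (auto simp: H_def h_def)
  note m = Emb_member[OF conjunct1[OF R] Hc]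
  have "convex_inclusion H G h"
  proof (cases "vert_image c = {}")
    case True
    then have v: "verts H = {}" using R m by simp
    obtain e where e: "edges H = {e}" using connected_no_verts[OF embeddingD(1)[OF emb] v] by metis
    have "set es \<subseteq> {emap h e} \<and> set vs \<subseteq> {}"
      if p: "dipath G es vs" and ends: "hd es = emap h e" "last es = emap h e" for es vs
    proof -
      have "vs = []"
        using G p ends unfolding acyclic_digraph_def by (metis Suc_leI One_nat_def length_greater_0_conv)
      moreover have "length es = Suc (length vs)" using p by (simp add: dipath_def)
      ultimately show ?thesis using ends by (auto simp: length_Suc_conv)
    qed
    then show ?thesis
      unfolding convex_inclusion_def e v using emb by (simp del: split_paired_All) blast
  next
    case False
    then have "verts H \<noteq> {}" using m(2) by auto
    from convex_inclusionI[OF emb this] show ?thesis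
      using False R unfolding m(2,4) by blast
  qed
  moreover have "c = emb_class G (H, h)"
    using Emb_eqI[of c G "emb_class G (H, h)"] R m Emb_member[OF emb_class_Emb[OF emb]]
      emb_class_Emb(1)[OF emb] by simp
  ultimately show ?L by (auto simp: sSb_def)
qed

lemma sSb_part_shape:
  assumes G: "acyclic_digraph G" and c: "c \<in> sSb G" and v: "vert_image c \<noteq> {}"
  shows "part_shape G c (vert_image c) (inputs G (vert_image c) \<inter> outputs G (vert_image c))"
    "structured_part G (vert_image c)"
proof -
  have "c \<in> Emb G" using c sSb_Emb by blast
  from Emb_part_shape[OF this v] show
    s: "part_shape G c (vert_image c) (inputs G (vert_image c) \<inter> outputs G (vert_image c))"
    using c v sSb_iff[OF G] by simp
  then show "structured_part G (vert_image c)"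
    using c v sSb_iff[OF G] by (simp add: structured_part_def part_shape_def)
qed

definition structured_class :: "('e, 'v) digraph \<Rightarrow> 'v set \<Rightarrow> ('e, 'v) emb set" where
  "structured_class G W = part_class G W (inputs G W \<inter> outputs G W)"

lemma structured_class_shape:
  fixes G :: "('e::infinite, 'v) digraph"
  assumes G: "acyclic_digraph G" and W: "structured_part G W"
  shows "part_shape G (structured_class G W) W (inputs G W \<inter> outputs G W)" "structured_class G W \<in> sSb G"
proof -
  show s: "part_shape G (structured_class G W) W (inputs G W \<inter> outputs G W)"
    unfolding structured_class_def
    using W by (intro part_class_shape acyclic_digraphD[OF G]) (simp add: structured_part_def)
  show "structured_class G W \<in> sSb G"
    using part_shapeD[OF s] W sSb_iff[OF G] by (simp add: structured_part_def)
qed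

lemma acyclic_no_loop:
  assumes "acyclic_digraph G"
  shows "inputs G {v} \<inter> outputs G {v} = {}"
proof -
  have "(v, v) \<notin> adj G" using acyclic_digraphD(3)[OF assms] by (auto simp: acyclic_def)
  then show ?thesis by (auto simp: adj_def)
qed

lemma acyclic_rel_convex_singleton:
  assumes "acyclic r"
  shows "rel_convex r {v}"
  using assms unfolding rel_convex_def acyclic_def
  by (metis rtranclD singletonD trancl_rtrancl_trancl)

lemma structured_part_singleton:
  assumes "acyclic_digraph G" "v \<in> verts G"
  shows "structured_part G {v}"
  using assms acyclic_no_loop acyclic_rel_convex_singleton acyclic_digraphD connected_part_singleton
  by (metis structured_part_def)

lemma corolla_structured:
  "acyclic_digraph G \<Longrightarrow> corolla G v = structured_class G {v}"
  by (simp add: corolla_def structured_class_def acyclic_no_loop)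

lemma corolla_sSb:
  fixes G :: "('e::infinite, 'v) digraph"
  assumes "acyclic_digraph G" "v \<in> verts G"
  shows "corolla G v \<in> sSb G"
  using structured_class_shape(2)[OF assms(1) structured_part_singleton[OF assms]]
  by (simp add: corolla_structured[OF assms(1)])

lemma structured_part_verts:
  assumes G: "acyclic_digraph G" and v: "verts G \<noteq> {}"
  shows "structured_part G (verts G)"
proof -
  have "inputs G (verts G) = iedges G" "outputs G (verts G) = oedges G"
    using digraph_vertD[OF acyclic_digraphD(2)[OF G]] by (auto simp: inputs_def outputs_def)
  moreover have "rel_convex (adj G) (verts G)"
    unfolding rel_convex_def using adj_verts[OF acyclic_digraphD(2)[OF G]]
    by (metis SigmaD1 rtranclE subsetD SigmaD2)
  ultimately show ?thesis
    using connected_part_verts[OF acyclic_digraphD(1)[OF G] v] by (simp add: structured_part_def)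
qed

lemma id_class_sSb:
  assumes G: "acyclic_digraph G"
  shows "id_class G \<in> sSb G"
proof -
  note i = id_class_images[OF acyclic_digraphD(1)[OF G]]
  have "inputs G (verts G) = iedges G" "outputs G (verts G) = oedges G"
    using digraph_vertD[OF acyclic_digraphD(2)[OF G]] by (auto simp: inputs_def outputs_def)
  then show ?thesis
    using i structured_part_verts[OF G] sSb_iff[OF G] by (auto simp: structured_part_def)
qed

section \<open>Comparison of the two notions of union\<close>

lemma part_shape_le:
  assumes c: "part_shape G c W J" and d: "part_shape G d W' J'" and sub: "W \<subseteq> W'" "J \<subseteq> J'"
  shows "emb_le c d"
  unfolding emb_le_iff[OF part_shapeD(1)[OF c] part_shapeD(1)[OF d]] part_shapeD(3-5)[OF c]
    part_shapeD(3-5)[OF d]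
  using sub inputs_mono[OF sub(1), of G] outputs_mono[OF sub(1), of G] by blast

lemma incident_edge_image:
  assumes "c \<in> Emb G"
  shows "inputs G (vert_image c) \<union> outputs G (vert_image c) \<subseteq> edge_image c"
  using Emb_part_shape[OF assms] part_shapeD(4) by (cases "vert_image c = {}") fastforce+

text \<open>\<open>is_union\<close> compares only vertices and the order. A class with vertices
  consists of the edges at its vertices, each of which is a vertex of \<open>c1\<close> or
  \<open>c2\<close>; without vertices all three classes are the same edge.\<close>

lemma is_union_edge_image:
  assumes c: "c \<in> Emb G" and c1: "c1 \<in> Emb G" and c2: "c2 \<in> Emb G" and u: "is_union c c1 c2"
  shows "edge_image c = edge_image c1 \<union> edge_image c2"
proof
  have V: "vert_image c = vert_image c1 \<union> vert_image c2" and le: "edge_image c1 \<subseteq> edge_image c"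
    "edge_image c2 \<subseteq> edge_image c"
    using u emb_le_iff[OF c1 c] emb_le_iff[OF c2 c] by (auto simp: is_union_def)
  then show "edge_image c1 \<union> edge_image c2 \<subseteq> edge_image c" by blast
  show "edge_image c \<subseteq> edge_image c1 \<union> edge_image c2"
  proof (cases "vert_image c = {}")
    case True
    obtain e where e: "edge_shape G c e" using Emb_edge_shape[OF c True] .
    obtain e1 where e1: "edge_shape G c1 e1" using Emb_edge_shape[OF c1] True V by blast
    show ?thesis using le edge_shapeD(4)[OF e] edge_shapeD(4)[OF e1] by auto
  next
    case False
    have "edge_image c = inputs G (vert_image c) \<union> outputs G (vert_image c)"
      using part_shapeD(4)[OF Emb_part_shape[OF c False]] .
    then show ?thesis
      using incident_edge_image[OF c1] incident_edge_image[OF c2] by (auto simp: V inputs_Un outputs_Un)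
  qed
qed

lemma sSb_inner_edges:
  assumes G: "acyclic_digraph G" and c: "c \<in> sSb G"
  shows "inner_edges c = inputs G (vert_image c) \<inter> outputs G (vert_image c)"
proof (cases "vert_image c = {}")
  case True
  moreover have "c \<in> Emb G" using c sSb_Emb by blast
  ultimately obtain e where "edge_shape G c e" using Emb_edge_shape by blast
  then show ?thesis using True by (simp add: edge_shape_def)
next
  case False
  then show ?thesis using sSb_iff[OF G] c by blast
qed

text \<open>For structured subgraphs the uncut edges are determined by the vertices, so inclusion of
  images already gives the order.\<close>

lemma sSb_union_iff:
  assumes G: "acyclic_digraph G" and c: "c \<in> sSb G" "c1 \<in> sSb G" "c2 \<in> sSb G"
  shows "is_ssb_union c c1 c2 \<longleftrightarrow> is_union c c1 c2"
proof -
  have E: "c \<in> Emb G" "c1 \<in> Emb G" "c2 \<in> Emb G" using c sSb_Emb by blast+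
  note J = sSb_inner_edges[OF G]
  show ?thesis
  proof
    assume u: "is_ssb_union c c1 c2"
    then have "inputs G (vert_image c1) \<subseteq> inputs G (vert_image c)" "outputs G (vert_image c1) \<subseteq> outputs G (vert_image c)"
      "inputs G (vert_image c2) \<subseteq> inputs G (vert_image c)" "outputs G (vert_image c2) \<subseteq> outputs G (vert_image c)"
      by (auto simp: is_ssb_union_def inputs_def outputs_def)
    then show "is_union c c1 c2"
      using u unfolding is_union_def is_ssb_union_def emb_le_iff[OF E(2,1)] emb_le_iff[OF E(3,1)]
        J[OF c(1)] J[OF c(2)] J[OF c(3)] by blast
  next
    assume "is_union c c1 c2"
    then show "is_ssb_union c c1 c2"
      using is_union_edge_image[OF E] by (simp add: is_union_def is_ssb_union_def)
  qed
qed

section \<open>Morphisms of the oriented graphical category\<close>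

locale U_morphism =
  fixes G G' :: "('e::infinite, 'v) digraph" and \<phi>0 :: "'e \<Rightarrow> 'e"
    and \<phi> :: "('e, 'v) emb set \<Rightarrow> ('e, 'v) emb set"
  assumes conn: "connected_digraph G" "connected_digraph G'"
    and mor: "(\<phi>0, \<phi>) \<in> U_Hom G G'"
begin

lemma in_Emb: "c \<in> Emb G \<Longrightarrow> \<phi> c \<in> Emb G'"
  using mor by (auto simp: U_Hom_def)

lemma in_class: "c \<in> Emb G \<Longrightarrow> in_class (\<phi> c) = image_mset \<phi>0 (in_class c)"
  and out_class: "c \<in> Emb G \<Longrightarrow> out_class (\<phi> c) = image_mset \<phi>0 (out_class c)"
  using mor by (auto simp: U_Hom_def)

lemma no_verts: "c \<in> Emb G \<Longrightarrow> vert_image c = {} \<Longrightarrow> vert_image (\<phi> c) = {}"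
  using mor by (auto simp: U_Hom_def is_edge_iff)

lemma union: "is_union l h k \<Longrightarrow> l \<in> Emb G \<Longrightarrow> h \<in> Emb G \<Longrightarrow> k \<in> Emb G \<Longrightarrow> is_union (\<phi> l) (\<phi> h) (\<phi> k)"
  using mor by (auto simp: U_Hom_def)

lemma vert_image:
  assumes c: "c \<in> Emb G"
  shows "vert_image (\<phi> c) = (\<Union>v \<in> vert_image c. vert_image (\<phi> (corolla G v)))"
proof (cases "vert_image c = {}")
  case True
  then show ?thesis using no_verts[OF c] by simp
next
  case False
  let ?P = "\<lambda>W J. vert_image (\<phi> (part_class G W J)) = (\<Union>v \<in> W. vert_image (\<phi> (corolla G v)))"
  have s: "part_shape G c (vert_image c) (inner_edges c)" using Emb_part_shape[OF c False] .
  obtain v where v: "v \<in> vert_image c" using False by auto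
  then have vG: "v \<in> verts G" using vert_image_verts[OF c] by blast
  have U: "vert_image (\<phi> l) = vert_image (\<phi> h) \<union> vert_image (\<phi> k)"
    if s: "part_shape G l (A \<union> B) J" "part_shape G h A J1" "part_shape G k B J2" and J: "J1 \<subseteq> J" "J2 \<subseteq> J"
    for l h k A B J J1 J2
  proof -
    have "is_union l h k"
      using part_shape_le[OF s(2,1) _ J(1)] part_shape_le[OF s(3,1) _ J(2)] part_shapeD(3)[OF s(1)]
        part_shapeD(3)[OF s(2)] part_shapeD(3)[OF s(3)] by (simp add: is_union_def)
    then show ?thesis
      using union part_shapeD(1)[OF s(1)] part_shapeD(1)[OF s(2)] part_shapeD(1)[OF s(3)]
      by (simp add: is_union_def)
  qed
  note sh = part_class_shape[OF conn(1)]
  have v1: "{v} \<subseteq> vert_image c" "{} \<subseteq> inner_edges c" using v by auto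
  have "?P (vert_image c) (inner_edges c)"
    using connected_digraphD[OF conn(1)] part_shapeD(2)[OF s] connected_part_singleton[OF vG] v1
  proof (induction rule: connected_part_grow)
    case start
    show ?case by (simp add: corolla_def)
  next
    case (edge W J f)
    have "connected_part G W (insert f J)" by (rule connected_part_add_edge[OF edge.hyps(1-3)])
    \<comment> \<open>Closing an edge is regarded as a union of the old class with itself, which is
      legitimate because a union may have more uncut edges than its constituents.\<close>
    then have "part_shape G (part_class G W (insert f J)) (W \<union> W) (insert f J)" using sh by simp
    from U[OF this sh[OF edge.hyps(1)] sh[OF edge.hyps(1)] subset_insertI subset_insertI]
    show ?case by (simp add: edge.IH)
  next
    case (vertex W J u f)
    note su = connected_part_singleton[OF vertex.hyps(2)]
    have "connected_part G (W \<union> {u}) (insert f J)"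
      using connected_part_glue[OF vertex.hyps(1) su, of f] connected_part_glue[OF su vertex.hyps(1), of f]
        vertex.hyps(3,5) by auto
    from U[OF sh[OF this] sh[OF vertex.hyps(1)] corolla_shape[OF conn(1) vertex.hyps(2)] subset_insertI empty_subsetI]
    show ?case by (simp add: vertex.IH Un_commute)
  qed
  then show ?thesis using part_class_eq[OF s] by simp
qed

lemma corolla_disjoint:
  assumes "u \<in> verts G" "v \<in> verts G" "u \<noteq> v"
  shows "vert_image (\<phi> (corolla G u)) \<inter> vert_image (\<phi> (corolla G v)) = {}"
proof -
  note s = part_shapeD[OF corolla_shape[OF conn(1)]]
  have "vertex_disjoint (corolla G u) (corolla G v)"
    using s(3)[OF assms(1)] s(3)[OF assms(2)] assms(3) by (simp add: vertex_disjoint_def)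
  then show ?thesis
    using mor s(1)[OF assms(1)] s(1)[OF assms(2)] by (auto simp: U_Hom_def vertex_disjoint_def)
qed

end

lemma U_Hom_eqI:
  fixes G G' :: "('e::infinite, 'v) digraph"
  assumes c: "connected_digraph G" "connected_digraph G'"
    and \<phi>: "(\<phi>0, \<phi>) \<in> U_Hom G G'" and \<psi>: "(\<phi>0, \<psi>) \<in> U_Hom G G'"
    and eq: "\<And>v. v \<in> verts G \<Longrightarrow> \<phi> (corolla G v) = \<psi> (corolla G v)"
  shows "\<phi> = \<psi>"
proof -
  interpret p: U_morphism G G' \<phi>0 \<phi> using c \<phi> by unfold_locales
  interpret q: U_morphism G G' \<phi>0 \<psi> using c \<psi> by unfold_locales
  have "\<phi> x = \<psi> x" if x: "x \<in> Emb G" for x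
  proof (rule Emb_eqI_in[OF p.in_Emb[OF x] q.in_Emb[OF x]])
    show "vert_image (\<phi> x) = vert_image (\<psi> x)"
      unfolding p.vert_image[OF x] q.vert_image[OF x] using eq vert_image_verts[OF x] by (intro SUP_cong) auto
    show "in_class (\<phi> x) = in_class (\<psi> x)" using p.in_class[OF x] q.in_class[OF x] by simp
  qed
  moreover have "\<phi> \<in> Emb G \<rightarrow>\<^sub>E Emb G'" "\<psi> \<in> Emb G \<rightarrow>\<^sub>E Emb G'" using \<phi> \<psi> by (auto simp: U_Hom_def)
  ultimately show ?thesis by (metis PiE_ext)
qed

section \<open>Morphisms that send the whole graph to a structured subgraph\<close>

locale ssb_morphism = U_morphism +
  assumes acyclic: "acyclic_digraph G" "acyclic_digraph G'"
    and id_sSb: "\<phi> (id_class G) \<in> sSb G'"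
begin

abbreviation D where "D v \<equiv> vert_image (\<phi> (corolla G v))"

definition U where "U = vert_image (\<phi> (id_class G))"

lemma U_eq: "U = (\<Union>v \<in> verts G. D v)"
  using vert_image id_class_images[OF conn(1)] by (simp add: U_def)

lemma inner_U: "x \<in> inputs G' U \<Longrightarrow> x \<in> outputs G' U \<Longrightarrow> x \<notin> set_mset (in_class (\<phi> (id_class G)))"
proof -
  assume x: "x \<in> inputs G' U" "x \<in> outputs G' U"
  then have ne: "U \<noteq> {}" by auto
  from part_shapeD(8)[OF sSb_part_shape(1)[OF acyclic(2) id_sSb ne[unfolded U_def]]] x
  show ?thesis by (simp add: U_def)
qed

text \<open>Otherwise \<open>a\<close> is an input of \<open>G\<close>, so \<open>\<phi>0 a\<close>
  is an input of the whole image. That image is structured, and an edge between two of its vertices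
  is not on its boundary.\<close>

lemma not_global_input:
  assumes a: "a \<in> edges G" and x: "\<phi>0 a \<in> inputs G' U" "\<phi>0 a \<in> outputs G' U"
  shows "a \<in> oedges G"
proof (rule ccontr)
  assume no: "a \<notin> oedges G"
  note i = id_class_images[OF conn(1)]
  have ne: "verts G \<noteq> {}" using x U_eq by auto
  then have "a \<in> iedges G" using connected_edges[OF conn(1)] a no by blast
  then have "a \<in> inputs G (verts G)"
    using digraph_vertD[OF connected_digraphD[OF conn(1)]] by (simp add: inputs_def)
  then have "a \<in># in_class (id_class G)"
    using part_shapeD(8)[OF Emb_part_shape[OF i(1)]] ne no unfolding i by simp
  then have "\<phi>0 a \<in># in_class (\<phi> (id_class G))" using in_class[OF i(1)] by simp
  then show False using inner_U x by blast
qed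

text \<open>
  A corolla whose image contains no vertex has one input and one output, with the same image. Going
  backwards from an edge through such corollas, one arrives at the corolla whose image contains
  the source of the image of the edge.
\<close>

lemma backtrace:
  assumes a: "a \<in> edges G" and h: "h \<in> verts G" and x: "\<phi>0 a \<in> outputs G' (D h)" "\<phi>0 a \<in> inputs G' U"
  shows "a \<in> oedges G \<and> (h, overt G a) \<in> (adj G)\<^sup>*"
proof -
  have DU: "D v \<subseteq> U" if "v \<in> verts G" for v using that by (auto simp: U_eq)
  note dG = connected_digraphD[OF conn(1)]
  \<comment> \<open>Every edge with the same image as \<open>a\<close> has a source in
    \<open>G\<close>, so the search backwards never stops at the boundary.\<close>
  have o: "b \<in> oedges G" if "b \<in> edges G" "\<phi>0 b = \<phi>0 a" for b
    using not_global_input[OF that(1)] that x(2) subsetD[OF outputs_mono[OF DU[OF h]] x(1)] by simp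
  have wf: "wf (adj G)" using finite_acyclic_wf[OF finite_adj[OF dG] acyclic_digraphD(3)[OF acyclic(1)]] .
  have "(h, u) \<in> (adj G)\<^sup>*" if "b \<in> outputs G {u}" "\<phi>0 b = \<phi>0 a" for u b
    using that
  proof (induction u arbitrary: b rule: wf_induct_rule[OF wf])
    case (1 u b)
    show ?case
    proof (cases "u = h")
      case False
      have u: "u \<in> verts G" using 1(2) digraph_vertD[OF dG] by (auto simp: outputs_def)
      note su = part_shapeD[OF corolla_shape[OF conn(1) u]]
      have xo: "\<phi>0 a \<in># out_class (\<phi> (corolla G u))"
        using imageI[OF 1(2), of \<phi>0] out_class[OF su(1)] su(9) 1(3) by simp
      \<comment> \<open>The edge \<open>\<phi>0 a\<close> has only one source, which lies in
        \<open>D h\<close>, and \<open>D u\<close> is disjoint from \<open>D h\<close>.\<close>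
      have "D u = {}"
      proof (rule ccontr)
        assume "D u \<noteq> {}"
        from part_shapeD(9)[OF Emb_part_shape[OF in_Emb[OF su(1)] this]] xo
        have "\<phi>0 a \<in> outputs G' (D u)" by simp
        then show False using x(1) corolla_disjoint[OF u h False] by (auto simp: outputs_def)
      qed
      then obtain y where y: "edge_shape G' (\<phi> (corolla G u)) y"
        using Emb_edge_shape[OF in_Emb[OF su(1)]] by blast
      then have "\<phi>0 a = y" using xo edge_shapeD(7)[OF y] by simp
      then have "\<phi>0 a \<in># image_mset \<phi>0 (in_class (corolla G u))"
        using edge_shapeD(6)[OF y] in_class[OF su(1)] by simp
      then obtain b' where b': "b' \<in> inputs G {u}" "\<phi>0 b' = \<phi>0 a" using su(8) by auto
      have "b' \<in> oedges G"
        using o b' digraph_edgeD[OF dG] by (auto simp: inputs_def)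
      then have *: "b' \<in> outputs G {overt G b'}" by (simp add: outputs_def)
      then have adj: "(overt G b', u) \<in> adj G" using b'(1) by (auto simp: adj_def)
      then show ?thesis using 1(1)[OF adj * b'(2)] by simp
    qed simp
  qed
  moreover have "a \<in> oedges G" using o a by blast
  ultimately show ?thesis by (simp add: outputs_def)
qed

text \<open>Convexity of \<open>U\<close> keeps the whole path in the image. An edge from
  \<open>D q0\<close> to a different \<open>D q\<close> is an input of the image of the corolla at
  \<open>q\<close>, hence the image of an input of \<open>q\<close>, and \<open>backtrace\<close>
  leads from there back to \<open>q0\<close>.\<close>

lemma path_lift:
  assumes xy: "(x, y) \<in> (adj G')\<^sup>*" and p: "p \<in> verts G" "x \<in> D p" and q: "q \<in> verts G" "y \<in> D q"
  shows "(p, q) \<in> (adj G)\<^sup>*"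
proof -
  have xU: "x \<in> U" and yU: "y \<in> U" using p q by (auto simp: U_eq)
  have conv: "rel_convex (adj G') U"
    using sSb_iff[OF acyclic(2)] id_sSb xU by (auto simp: U_def)
  show ?thesis using xy yU q
  proof (induction arbitrary: q)
    case base
    then show ?case using corolla_disjoint p by blast
  next
    case (step y z)
    have "y \<in> U"
      using conv xU step.hyps step.prems(1) unfolding rel_convex_def by (meson r_into_rtrancl)
    then obtain q0 where q0: "q0 \<in> verts G" "y \<in> D q0" by (auto simp: U_eq)
    have pq0: "(p, q0) \<in> (adj G)\<^sup>*" using step.IH[OF \<open>y \<in> U\<close> q0] .
    show ?case
    proof (cases "q0 = q")
      case True
      then show ?thesis using pq0 by simp
    next
      case False
      obtain e where e: "e \<in> outputs G' {y}" "e \<in> inputs G' {z}" using step.hyps(2) by (auto simp: adj_def)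
      have eq: "e \<in> inputs G' (D q)" "e \<notin> outputs G' (D q)" "e \<in> outputs G' (D q0)" "e \<in> inputs G' U"
        using e step.prems q0 corolla_disjoint[OF q0(1) step.prems(2) False]
        by (auto simp: inputs_def outputs_def)
      note sq = part_shapeD[OF corolla_shape[OF conn(1) step.prems(2)]]
      have "D q \<noteq> {}" using step.prems by auto
      from part_shapeD(8,13)[OF Emb_part_shape[OF in_Emb[OF sq(1)] this]] eq
      have "e \<in># in_class (\<phi> (corolla G q))" by auto
      then obtain a where a: "a \<in> inputs G {q}" "\<phi>0 a = e" using in_class[OF sq(1)] sq(8) by auto
      have "a \<in> edges G" using a digraph_edgeD[OF connected_digraphD[OF conn(1)]] by (auto simp: inputs_def)
      from backtrace[OF this q0(1)] a eq have *: "a \<in> oedges G" "(q0, overt G a) \<in> (adj G)\<^sup>*" by auto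
      have "a \<in> outputs G {overt G a}" using *(1) by (simp add: outputs_def)
      then have "(overt G a, q) \<in> adj G" using a(1) by (auto simp: adj_def)
      then show ?thesis using pq0 *(2) by (meson rtrancl.rtrancl_into_rtrancl rtrancl_trans)
    qed
  qed
qed

text \<open>A cut edge of the image comes from an input \<open>a\<close> of \<open>W\<close>. By
  \<open>backtrace\<close> the source of \<open>a\<close> is reachable from \<open>W\<close>, and
  \<open>a\<close> leads from it back into \<open>W\<close>; convexity puts the source in
  \<open>W\<close>, so \<open>a\<close> is not an input after all. Convexity of the image is
  reflected to \<open>W\<close> by \<open>path_lift\<close>.\<close>

lemma sSb_image:
  assumes c: "c \<in> sSb G"
  shows "\<phi> c \<in> sSb G'"
proof (cases "vert_image (\<phi> c) = {}")
  case True
  then show ?thesis using sSb_iff[OF acyclic(2)] in_Emb c sSb_Emb by blast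
next
  case False
  have cE: "c \<in> Emb G" using c sSb_Emb by blast
  define W W' where "W = vert_image c" and "W' = vert_image (\<phi> c)"
  have W': "W' = (\<Union>v \<in> W. D v)" using vert_image[OF cE] by (simp add: W_def W'_def)
  have WG: "W \<subseteq> verts G" using vert_image_verts[OF cE] by (simp add: W_def)
  have W'U: "W' \<subseteq> U" using WG by (auto simp: W' U_eq)
  have ne: "vert_image c \<noteq> {}" using False no_verts[OF cE] by blast
  note s = part_shapeD[OF sSb_part_shape(1)[OF acyclic(1) c ne], folded W_def]
  note s' = part_shapeD[OF Emb_part_shape[OF in_Emb[OF cE] False], folded W'_def]
  have conv: "rel_convex (adj G) W"
    using sSb_part_shape(2)[OF acyclic(1) c ne] by (simp add: structured_part_def W_def)
  have "x \<in> inner_edges (\<phi> c)" if x: "x \<in> inputs G' W'" "x \<in> outputs G' W'" for x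
  proof (rule ccontr)
    assume "x \<notin> inner_edges (\<phi> c)"
    then have "x \<in># in_class (\<phi> c)" using s'(8) x by simp
    then obtain a where a: "a \<in> inputs G W" "a \<notin> outputs G W" "\<phi>0 a = x"
      using in_class[OF cE] s(8) by auto
    obtain h where h: "h \<in> W" "x \<in> outputs G' (D h)" using x(2) by (auto simp: W' outputs_def)
    have aE: "a \<in> edges G" using a digraph_edgeD[OF connected_digraphD[OF conn(1)]] by (auto simp: inputs_def)
    have "x \<in> inputs G' U" using x(1) by (rule subsetD[OF inputs_mono[OF W'U], rotated])
    with backtrace[OF aE, of h] h WG a have b: "a \<in> oedges G" "(h, overt G a) \<in> (adj G)\<^sup>*" by auto
    have "(overt G a, ivert G a) \<in> adj G" "ivert G a \<in> W"
      using a b(1) by (auto simp: adj_def inputs_def outputs_def)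
    then have "overt G a \<in> W" using conv h(1) b(2) unfolding rel_convex_def by blast
    then show False using a(2) b(1) by (simp add: outputs_def)
  qed
  then have "inner_edges (\<phi> c) = inputs G' W' \<inter> outputs G' W'" using s'(12,13) by blast
  moreover have "rel_convex (adj G') W'"
    unfolding rel_convex_def
  proof (intro ballI allI impI)
    fix x z y assume xz: "x \<in> W'" "z \<in> W'" and r: "(x, y) \<in> (adj G')\<^sup>*" "(y, z) \<in> (adj G')\<^sup>*"
    have "rel_convex (adj G') U"
      using sSb_iff[OF acyclic(2)] id_sSb W'U xz by (auto simp: U_def)
    then have "y \<in> U" using xz r W'U unfolding rel_convex_def by blast
    then obtain q where q: "q \<in> verts G" "y \<in> D q" by (auto simp: U_eq)
    obtain p p' where p: "p \<in> W" "x \<in> D p" "p' \<in> W" "z \<in> D p'" using xz by (auto simp: W')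
    have "(p, q) \<in> (adj G)\<^sup>*" "(q, p') \<in> (adj G)\<^sup>*"
      using path_lift[OF r(1) _ p(2) q] path_lift[OF r(2) q _ p(4)] p WG by auto
    then have "q \<in> W" using conv p unfolding rel_convex_def by blast
    then show "y \<in> W'" using q by (auto simp: W')
  qed
  ultimately show ?thesis
    using sSb_iff[OF acyclic(2)] s'(1) by (simp add: W'_def)
qed

lemma restrict_G_Hom: "(\<phi>0, restrict \<phi> (sSb G)) \<in> G_Hom G G'"
proof -
  have E: "c \<in> Emb G" if "c \<in> sSb G" for c using that sSb_Emb by blast
  have "is_ssb_union (\<phi> c) (\<phi> c1) (\<phi> c2)"
    if c: "c1 \<in> sSb G" "c2 \<in> sSb G" "c \<in> sSb G" and u: "is_ssb_union c c1 c2" for c c1 c2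
    using u union[of c c1 c2] c E
    by (simp add: sSb_union_iff[OF acyclic(1)] sSb_union_iff[OF acyclic(2)] sSb_image)
  then show ?thesis
    using mor sSb_image in_class[OF E] out_class[OF E] by (auto simp: G_Hom_def U_Hom_def)
qed

end

section \<open>Morphisms of the properadic graphical category\<close>

lemma rel_convex_converse [simp]: "rel_convex (r\<inverse>) W \<longleftrightarrow> rel_convex r W"
  unfolding rel_convex_def by (metis converseD converseI rtrancl_converse)

text \<open>The vertex \<open>u\<close> is minimal among those of \<open>W0\<close> outside
  \<open>W\<close> that are reachable from \<open>W\<close>. Minimality puts every vertex between
  \<open>W\<close> and \<open>u\<close> into \<open>W\<close>, and convexity of \<open>W\<close>
  prevents \<open>u\<close> from reaching \<open>W\<close> again.\<close>

lemma rel_convex_grow: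
  assumes r: "finite r" "acyclic r" and W: "rel_convex r W" and W0: "rel_convex r W0" "W \<subseteq> W0"
    and wu: "(w0, u0) \<in> r" "w0 \<in> W" "u0 \<in> W0" "u0 \<notin> W"
  obtains u w where "u \<in> W0" "u \<notin> W" "w \<in> W" "(w, u) \<in> r" "\<And>w. w \<in> W \<Longrightarrow> (u, w) \<notin> r"
    "rel_convex r (insert u W)"
proof -
  define S where "S = {z \<in> W0 - W. \<exists>w \<in> W. (w, z) \<in> r\<^sup>*}"
  have "wf (r\<^sup>+)" using finite_acyclic_wf[OF r] by (rule wf_trancl)
  moreover have "u0 \<in> S" using wu by (auto simp: S_def)
  ultimately obtain u where u: "u \<in> S" "\<And>y. (y, u) \<in> r\<^sup>+ \<Longrightarrow> y \<notin> S" by (rule wfE_min) blast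
  have acyc: "(z, z) \<notin> r\<^sup>+" for z using r(2) by (auto simp: acyclic_def)
  obtain w where w: "w \<in> W" "(w, u) \<in> r\<^sup>*" and uW: "u \<in> W0" "u \<notin> W" using u by (auto simp: S_def)
  have S: "z \<in> W" if z: "a \<in> W" "(a, z) \<in> r\<^sup>*" "(z, u) \<in> r\<^sup>+" for a z
  proof -
    have "z \<in> W0" using W0 z uW(1) unfolding rel_convex_def by (meson subsetD trancl_into_rtrancl)
    then show ?thesis using u(2)[OF z(3)] z by (auto simp: S_def)
  qed
  have nret: "(u, b) \<notin> r\<^sup>*" if "b \<in> W" for b
    using W w uW(2) that unfolding rel_convex_def by blast
  have "(w, u) \<in> r\<^sup>+" using w uW(2) by (metis rtranclD)
  then obtain p where p: "(w, p) \<in> r\<^sup>*" "(p, u) \<in> r" by (metis tranclD2)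
  then have "p \<in> W" using S[OF w(1) p(1)] by blast
  moreover have "(u, b) \<notin> r" if "b \<in> W" for b using nret[OF that] by blast
  moreover have "rel_convex r (insert u W)"
    unfolding rel_convex_def
  proof (intro ballI allI impI)
    fix a b z assume ab: "a \<in> insert u W" "b \<in> insert u W" and z: "(a, z) \<in> r\<^sup>*" "(z, b) \<in> r\<^sup>*"
    have ab': "(a, b) \<in> r\<^sup>*" using z by (rule rtrancl_trans)
    show "z \<in> insert u W"
    proof (cases "b \<in> W")
      case True
      then have "a \<in> W" using ab nret ab' by blast
      then show ?thesis using True W z unfolding rel_convex_def by blast
    next
      case False
      then have b: "b = u" using ab by simp
      show ?thesis
      proof (cases "z = u")
        case neq: False
        then have zu: "(z, u) \<in> r\<^sup>+" using z(2) b by (metis rtranclD)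
        have "a \<noteq> u" using z(1) zu acyc by (metis rtrancl_trancl_trancl)
        then show ?thesis using S[OF _ z(1) zu] ab by blast
      qed simp
    qed
  qed
  ultimately show thesis using that uW p(2) by blast
qed

text \<open>The direction of an edge between \<open>W\<close> and the rest of \<open>W0\<close>
  decides whether growth follows \<open>adj G\<close> or its converse. All edges between
  \<open>W\<close> and the new vertex then run the same way, as \<open>two_parts\<close>
  requires.\<close>

lemma structured_part_grow:
  assumes G: "acyclic_digraph G" and W: "structured_part G W" and W0: "structured_part G W0"
    and sub: "W \<subseteq> W0" "W \<noteq> W0"
  obtains u where "u \<in> W0" "u \<notin> W" "structured_part G (insert u W)"
    "(\<exists>f. f \<in> outputs G W \<and> f \<in> inputs G {u}) \<and> outputs G {u} \<inter> inputs G W = {}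
      \<or> (\<exists>f. f \<in> outputs G {u} \<and> f \<in> inputs G W) \<and> outputs G W \<inter> inputs G {u} = {}"
proof -
  note r = finite_adj[OF acyclic_digraphD(2)[OF G]] acyclic_digraphD(3)[OF G]
  have c: "connected_part G W (inputs G W \<inter> outputs G W)" "rel_convex (adj G) W"
    and c0: "connected_part G W0 (inputs G W0 \<inter> outputs G W0)" "rel_convex (adj G) W0"
    using W W0 by (auto simp: structured_part_def)
  have ne: "W \<noteq> {}" using c(1) by (auto simp: connected_part_def)
  have conn: "structured_part G (insert u W)"
    if u: "u \<in> W0" "u \<notin> W" "rel_convex (adj G) (insert u W)"
      and f: "f \<in> outputs G W \<and> f \<in> inputs G {u} \<or> f \<in> outputs G {u} \<and> f \<in> inputs G W" for u f
  proof -
    have uG: "u \<in> verts G" using u(1) c0(1) by (auto simp: connected_part_def)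
    note s = connected_part_singleton[OF uG]
    have "connected_part G (insert u W) (insert f (inputs G W \<inter> outputs G W))"
      using connected_part_glue[OF c(1) s, of f] connected_part_glue[OF s c(1), of f] f u(2) by auto
    moreover have "insert f (inputs G W \<inter> outputs G W) \<subseteq> inputs G (insert u W) \<inter> outputs G (insert u W)"
      using f by (auto simp: inputs_def outputs_def)
    ultimately have "connected_part G (insert u W) (inputs G (insert u W) \<inter> outputs G (insert u W))"
      unfolding connected_part_def by blast
    then show ?thesis using u(3) by (simp add: structured_part_def)
  qed
  obtain e where e: "e \<in> inputs G W0" "e \<in> outputs G W0" "(ivert G e \<in> W) \<noteq> (overt G e \<in> W)"
    using c0(1) sub ne unfolding connected_part_def by (metis Int_iff)
  have eio: "e \<in> iedges G" "ivert G e \<in> W0" "e \<in> oedges G" "overt G e \<in> W0"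
    using e by (auto simp: inputs_def outputs_def)
  then have adj: "(overt G e, ivert G e) \<in> adj G" by (auto simp: adj_def inputs_def outputs_def)
  show thesis
  proof (cases "overt G e \<in> W")
    case True
    then have "ivert G e \<notin> W" using e by blast
    from rel_convex_grow[OF r c(2) c0(2) sub(1) adj True eio(2) this] obtain u w where
      u: "u \<in> W0" "u \<notin> W" "w \<in> W" "(w, u) \<in> adj G" "\<And>w. w \<in> W \<Longrightarrow> (u, w) \<notin> adj G"
        "rel_convex (adj G) (insert u W)" by blast
    obtain f where f: "f \<in> outputs G W" "f \<in> inputs G {u}"
      using u(3,4) by (auto simp: adj_def outputs_def)
    moreover have "outputs G {u} \<inter> inputs G W = {}"
      using u(5) by (auto simp: adj_def inputs_def outputs_def)
    ultimately show thesis using that[OF u(1,2)] conn[OF u(1,2,6), of f] by blast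
  next
    case False
    then have "ivert G e \<in> W" using e by blast
    from rel_convex_grow[OF _ _ _ _ sub(1) _ this eio(4) False, of "(adj G)\<inverse>"] r c(2) c0(2) adj obtain u w where
      u: "u \<in> W0" "u \<notin> W" "w \<in> W" "(u, w) \<in> adj G" "\<And>w. w \<in> W \<Longrightarrow> (w, u) \<notin> adj G"
        "rel_convex (adj G) (insert u W)" by auto
    obtain f where f: "f \<in> outputs G {u}" "f \<in> inputs G W"
      using u(3,4) by (auto simp: adj_def inputs_def)
    moreover have "outputs G W \<inter> inputs G {u} = {}"
      using u(5) by (auto simp: adj_def inputs_def outputs_def)
    ultimately show thesis using that[OF u(1,2)] conn[OF u(1,2,6), of f] by blast
  qed
qed

text \<open>In contrast to \<open>connected_part_grow\<close>, every intermediate set is structured,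
  so that a properadic morphism has a value on it.\<close>

lemma structured_part_induct [consumes 3, case_names single insert]:
  assumes G: "acyclic_digraph G" and W0: "structured_part G W0" and v: "v \<in> W0"
    and single: "P {v}"
    and insert: "\<And>W u. structured_part G W \<Longrightarrow> P W \<Longrightarrow> u \<notin> W \<Longrightarrow> structured_part G (insert u W)
      \<Longrightarrow> (\<exists>f. f \<in> outputs G W \<and> f \<in> inputs G {u}) \<and> outputs G {u} \<inter> inputs G W = {}
        \<or> (\<exists>f. f \<in> outputs G {u} \<and> f \<in> inputs G W) \<and> outputs G W \<inter> inputs G {u} = {}
      \<Longrightarrow> P (insert u W)"
  shows "P W0"
proof -
  have W0G: "W0 \<subseteq> verts G" using W0 by (auto simp: structured_part_def connected_part_def)
  have fin: "finite (W0 - W)" for W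
    using finite_subset[OF W0G finite_verts[OF acyclic_digraphD(2)[OF G]]] by simp
  have "P W0" if "structured_part G W" "W \<subseteq> W0" "P W" for W
    using that
  proof (induction "card (W0 - W)" arbitrary: W rule: less_induct)
    case (less W)
    show ?case
    proof (cases "W = W0")
      case False
      from structured_part_grow[OF G less.prems(1) W0 less.prems(2) False] obtain u where
        u: "u \<in> W0" "u \<notin> W" "structured_part G (insert u W)" and
        f: "(\<exists>f. f \<in> outputs G W \<and> f \<in> inputs G {u}) \<and> outputs G {u} \<inter> inputs G W = {}
          \<or> (\<exists>f. f \<in> outputs G {u} \<and> f \<in> inputs G W) \<and> outputs G W \<inter> inputs G {u} = {}" by blast
      have "card (W0 - insert u W) < card (W0 - W)"
        by (rule psubset_card_mono[OF fin]) (use u in auto)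
      then show ?thesis
        using less.hyps[OF _ u(3)] insert[OF less.prems(1,3) u(2,3) f] less.prems(2) u(1) by blast
    qed (use less.prems in simp)
  qed
  moreover have "structured_part G {v}" using structured_part_singleton[OF G] v W0G by blast
  ultimately show ?thesis using v single by blast
qed

lemma emb_le_trans:
  "a \<in> Emb G \<Longrightarrow> b \<in> Emb G \<Longrightarrow> c \<in> Emb G \<Longrightarrow> emb_le a b \<Longrightarrow> emb_le b c \<Longrightarrow> emb_le a c"
  by (auto simp: emb_le_iff)

lemma emb_le_refl: "a \<in> Emb G \<Longrightarrow> emb_le a a"
  by (simp add: emb_le_iff)

section \<open>Properadic morphisms: images of disjoint parts\<close>

locale G_morphism =
  fixes G G' :: "('e::infinite, 'v) digraph" and \<phi>0 :: "'e \<Rightarrow> 'e"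
    and \<phi> :: "('e, 'v) emb set \<Rightarrow> ('e, 'v) emb set"
  assumes acyclic: "acyclic_digraph G" "acyclic_digraph G'"
    and mor: "(\<phi>0, \<phi>) \<in> G_Hom G G'"
begin

lemmas digraph = acyclic_digraphD(2)[OF acyclic(1)] acyclic_digraphD(2)[OF acyclic(2)]
lemmas conn = acyclic_digraphD(1)[OF acyclic(1)] acyclic_digraphD(1)[OF acyclic(2)]

lemma in_sSb: "c \<in> sSb G \<Longrightarrow> \<phi> c \<in> sSb G'"
  using mor by (auto simp: G_Hom_def)

lemma in_Emb: "c \<in> sSb G \<Longrightarrow> \<phi> c \<in> Emb G'"
  using in_sSb sSb_Emb by blast

lemma in_class: "c \<in> sSb G \<Longrightarrow> in_class (\<phi> c) = image_mset \<phi>0 (in_class c)"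
  and out_class: "c \<in> sSb G \<Longrightarrow> out_class (\<phi> c) = image_mset \<phi>0 (out_class c)"
  using mor by (auto simp: G_Hom_def)

lemma boundary:
  assumes c: "c \<in> sSb G'" and ne: "vert_image c \<noteq> {}"
  shows "set_mset (in_class c) = inputs G' (vert_image c) - outputs G' (vert_image c)"
    "set_mset (out_class c) = outputs G' (vert_image c) - inputs G' (vert_image c)"
  using part_shapeD(8,9)[OF sSb_part_shape(1)[OF acyclic(2) c ne]] by auto

text \<open>A structured subgraph with vertices has no edge that is both an input and an output,
  since none is cut. The image of \<open>e\<close> has \<open>\<phi>0 e\<close> as both, so it
  contains no vertex.\<close>

lemma edge_image_shape:
  assumes c: "c \<in> sSb G" and e: "edge_shape G c e"
  shows "edge_shape G' (\<phi> c) (\<phi>0 e)"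
proof -
  have io: "in_class (\<phi> c) = {#\<phi>0 e#}" "out_class (\<phi> c) = {#\<phi>0 e#}"
    using in_class[OF c] out_class[OF c] edge_shapeD(6,7)[OF e] by auto
  have "vert_image (\<phi> c) = {}"
  proof (rule ccontr)
    assume "vert_image (\<phi> c) \<noteq> {}"
    from boundary[OF in_sSb[OF c] this] io show False by auto
  qed
  from Emb_edge_shape[OF in_Emb[OF c] this] obtain x where x: "edge_shape G' (\<phi> c) x" .
  then show ?thesis using io edge_shapeD(6)[OF x] by simp
qed

text \<open>
  If the images met, connectedness of the first one would give an edge between the intersection and
  the rest of the first image; it is an inner edge of the first image and on the boundary of the
  second one, so it comes from an edge on the boundary of one of the two parts.
\<close>

lemma two_parts:
  assumes W1: "structured_part G W1" and W2: "structured_part G W2" and W: "structured_part G (W1 \<union> W2)"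
    and d: "W1 \<inter> W2 = {}" and f: "f \<in> outputs G W1" "f \<in> inputs G W2"
    and no: "outputs G W2 \<inter> inputs G W1 = {}"
  defines "A \<equiv> vert_image (\<phi> (structured_class G W1))" and "B \<equiv> vert_image (\<phi> (structured_class G W2))"
  shows "vert_image (\<phi> (structured_class G (W1 \<union> W2))) = A \<union> B" "A \<inter> B = {}"
proof -
  note c1 = structured_class_shape[OF acyclic(1) W1] and c2 = structured_class_shape[OF acyclic(1) W2]
  note c = structured_class_shape[OF acyclic(1) W]
  define h1 h2 h where "h1 = structured_class G W1" and "h2 = structured_class G W2"
    and "h = structured_class G (W1 \<union> W2)"
  note s1 = part_shapeD[OF c1(1), folded h1_def] and s2 = part_shapeD[OF c2(1), folded h2_def]
  note s = part_shapeD[OF c(1), folded h_def]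
  note m1 = c1(2)[folded h1_def] and m2 = c2(2)[folded h2_def] and m = c(2)[folded h_def]
  have "is_ssb_union h h1 h2"
    using s(3,4) s1(3,4) s2(3,4) by (auto simp: is_ssb_union_def inputs_Un outputs_Un)
  then have "is_ssb_union (\<phi> h) (\<phi> h1) (\<phi> h2)"
    using mor m m1 m2 by (auto simp: G_Hom_def)
  then have V: "vert_image (\<phi> h) = A \<union> B"
    by (simp add: is_ssb_union_def A_def B_def h1_def h2_def)
  then show "vert_image (\<phi> (structured_class G (W1 \<union> W2))) = A \<union> B" by (simp add: h_def)
  note dd = inputs_disjoint[OF d, of G] outputs_disjoint[OF d, of G]
  show "A \<inter> B = {}"
  proof (rule ccontr)
    assume AB: "A \<inter> B \<noteq> {}"
    then have ne: "vert_image (\<phi> h1) \<noteq> {}" "vert_image (\<phi> h2) \<noteq> {}" "vert_image (\<phi> h) \<noteq> {}"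
      by (auto simp: V) (auto simp: A_def B_def h1_def h2_def)
    have bA: "set_mset (out_class (\<phi> h1)) = outputs G' A - inputs G' A"
      using boundary[OF in_sSb[OF m1] ne(1)] by (simp add: A_def h1_def)
    have bB: "set_mset (in_class (\<phi> h2)) = inputs G' B - outputs G' B"
      "set_mset (out_class (\<phi> h2)) = outputs G' B - inputs G' B"
      using boundary[OF in_sSb[OF m2] ne(2)] by (simp_all add: B_def h2_def)
    have bh: "set_mset (in_class (\<phi> h)) = inputs G' (A \<union> B) - outputs G' (A \<union> B)"
      "set_mset (out_class (\<phi> h)) = outputs G' (A \<union> B) - inputs G' (A \<union> B)"
      using boundary[OF in_sSb[OF m] ne(3)] by (simp_all add: V)
    have image_in: "\<phi>0 g \<in># in_class (\<phi> k)" if "k \<in> sSb G" "g \<in># in_class k" for g k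
      using that in_class[OF that(1)] by simp
    have image_out: "\<phi>0 g \<in># out_class (\<phi> k)" if "k \<in> sSb G" "g \<in># out_class k" for g k
      using that out_class[OF that(1)] by simp
    \<comment> \<open>The connecting edge shows that \<open>A\<close> is not contained in
      \<open>B\<close>: the source of \<open>\<phi>0 f\<close> lies in \<open>A\<close> but not in
      \<open>B\<close>.\<close>
    have "f \<in># out_class h1" "f \<in># in_class h2" using f dd s1(9) s2(8) by auto
    then have "\<phi>0 f \<in> outputs G' A" "\<phi>0 f \<notin> outputs G' B"
      using image_out[OF m1] image_in[OF m2] bA bB by auto
    then have "A \<inter> B \<noteq> A" by (auto simp: outputs_def)
    moreover have "connected_part G' A (inputs G' A \<inter> outputs G' A)"
      using sSb_part_shape(2)[OF acyclic(2) in_sSb[OF m1] ne(1)]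
      by (simp add: structured_part_def A_def h1_def)
    ultimately obtain y where y: "y \<in> inputs G' A" "y \<in> outputs G' A"
      "(ivert G' y \<in> A \<inter> B) \<noteq> (overt G' y \<in> A \<inter> B)"
      using AB unfolding connected_part_def by (metis Int_iff inf_le1)
    have yA: "ivert G' y \<in> A" "overt G' y \<in> A" "y \<in> iedges G'" "y \<in> oedges G'"
      using y by (auto simp: inputs_def outputs_def)
    have nb: "y \<notin># out_class (\<phi> h1)" "y \<notin># in_class (\<phi> h)" "y \<notin># out_class (\<phi> h)"
      using y bA bh by (auto simp: inputs_Un outputs_Un)
    show False
    proof (cases "ivert G' y \<in> B")
      case True
      then have "y \<in> inputs G' B" "y \<notin> outputs G' B" using y(3) yA by (auto simp: inputs_def outputs_def)
      then have "y \<in># in_class (\<phi> h2)" using bB by simp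
      then obtain g where g: "g \<in># in_class h2" "\<phi>0 g = y" using in_class[OF m2] by auto
      show False
      proof (cases "g \<in> outputs G W1")
        case True
        then have "g \<in># out_class h1" using g(1) s2(8) s1(9) dd by auto
        then show False using image_out[OF m1] g(2) nb(1) by blast
      next
        case False
        then have "g \<in># in_class h" using g(1) s2(8) s(8) by (auto simp: inputs_Un outputs_Un)
        then show False using image_in[OF m] g(2) nb(2) by blast
      qed
    next
      case False
      then have "y \<notin> inputs G' B" "y \<in> outputs G' B" using y(3) yA by (auto simp: inputs_def outputs_def)
      then have "y \<in># out_class (\<phi> h2)" using bB by simp
      then obtain g where g: "g \<in># out_class h2" "\<phi>0 g = y" using out_class[OF m2] by auto
      \<comment> \<open>By \<open>no\<close>, the output \<open>g\<close> of the second part does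
        not enter the first one, so it remains an output of the union.\<close>
      then have "g \<in># out_class h" using s2(9) s(9) no by (auto simp: inputs_Un outputs_Un)
      then show False using image_out[OF m] g(2) nb(3) by blast
    qed
  qed
qed

abbreviation D where "D v \<equiv> vert_image (\<phi> (corolla G v))"

text \<open>At each step \<open>two_parts\<close> is applied to the old part and the new corolla,
  ordered by the direction of the edges between them. For \<open>W = verts G\<close> the second half
  replaces the missing axiom on disjointness.\<close>

lemma structured_image:
  assumes W: "structured_part G W"
  shows "vert_image (\<phi> (structured_class G W)) = (\<Union>v \<in> W. D v)
    \<and> (\<forall>a \<in> W. \<forall>b \<in> W. a \<noteq> b \<longrightarrow> D a \<inter> D b = {})"
proof -
  obtain v where v: "v \<in> W" using W by (auto simp: structured_part_def connected_part_def)
  show ?thesis using acyclic(1) W v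
  proof (induction rule: structured_part_induct)
    case single
    show ?case by (simp add: corolla_structured[OF acyclic(1)])
  next
    case (insert W u)
    have "u \<in> verts G" using insert.hyps(3) by (auto simp: structured_part_def connected_part_def)
    note su = structured_part_singleton[OF acyclic(1) this]
    have d: "W \<inter> {u} = {}" "{u} \<inter> W = {}" using insert.hyps(2) by auto
    have i: "insert u W = W \<union> {u}" "insert u W = {u} \<union> W" by auto
    have "vert_image (\<phi> (structured_class G (insert u W))) = vert_image (\<phi> (structured_class G W)) \<union> D u
      \<and> vert_image (\<phi> (structured_class G W)) \<inter> D u = {}"
      using insert.hyps(4)
    proof (elim disjE conjE exE)
      fix f assume "outputs G {u} \<inter> inputs G W = {}" "f \<in> outputs G W" "f \<in> inputs G {u}"
      with two_parts[OF insert.hyps(1) su insert.hyps(3)[unfolded i(1)] d(1)] show ?thesis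
        unfolding i(1) corolla_structured[OF acyclic(1)] by blast
    next
      fix f assume "outputs G W \<inter> inputs G {u} = {}" "f \<in> outputs G {u}" "f \<in> inputs G W"
      with two_parts[OF su insert.hyps(1) insert.hyps(3)[unfolded i(2)] d(2)] show ?thesis
        unfolding i(2) corolla_structured[OF acyclic(1)] by blast
    qed
    then show ?case using insert.IH by auto
  qed
qed

lemma corolla_disjoint:
  assumes "u \<in> verts G" "v \<in> verts G" "u \<noteq> v"
  shows "D u \<inter> D v = {}"
proof -
  have "structured_part G (verts G)" using structured_part_verts[OF acyclic(1)] assms by blast
  then show ?thesis using structured_image assms by blast
qed

lemma D_disjoint:
  assumes "A \<subseteq> verts G" "B \<subseteq> verts G" "A \<inter> B = {}"
  shows "(\<Union>v \<in> A. D v) \<inter> (\<Union>v \<in> B. D v) = {}"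
proof (rule ccontr)
  assume "\<not> ?thesis"
  then obtain x u v where x: "u \<in> A" "v \<in> B" "x \<in> D u" "x \<in> D v" by blast
  then have "D u \<inter> D v = {}" using assms by (intro corolla_disjoint) blast+
  then show False using x by blast
qed

section \<open>Extension of a properadic morphism to all classes of embeddings\<close>

text \<open>Prescribes the value at \<open>h\<close> by its vertices and boundary. This is a
  relation because existence is only established by the gluing below, while uniqueness is immediate
  from \<open>Emb_eqI_in\<close>.\<close>

definition is_ext :: "('e, 'v) emb set \<Rightarrow> ('e, 'v) emb set \<Rightarrow> bool" where
  "is_ext h c \<longleftrightarrow> c \<in> Emb G' \<and> vert_image c = (\<Union>v \<in> vert_image h. D v)
     \<and> in_class c = image_mset \<phi>0 (in_class h) \<and> out_class c = image_mset \<phi>0 (out_class h)"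

lemma is_ext_vert_image: "is_ext h c \<Longrightarrow> vert_image c = (\<Union>v \<in> vert_image h. D v)"
  by (simp add: is_ext_def)

lemma is_ext_unique: "is_ext h c \<Longrightarrow> is_ext h d \<Longrightarrow> c = d"
  by (rule Emb_eqI_in) (auto simp: is_ext_def)

lemma is_ext_sSb:
  assumes h: "h \<in> sSb G"
  shows "is_ext h (\<phi> h)"
proof -
  have "vert_image (\<phi> h) = (\<Union>v \<in> vert_image h. D v)"
  proof (cases "vert_image h = {}")
    case True
    then obtain e where "edge_shape G h e" using Emb_edge_shape h sSb_Emb by blast
    then show ?thesis using True edge_shapeD(3)[OF edge_image_shape[OF h]] by simp
  next
    case False
    note s = sSb_part_shape[OF acyclic(1) h False]
    then have "structured_class G (vert_image h) = h"
      unfolding structured_class_def using part_class_eq by blast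
    then show ?thesis using structured_image[OF s(2)] by simp
  qed
  then show ?thesis
    using in_Emb[OF h] in_class[OF h] out_class[OF h] by (simp add: is_ext_def)
qed

text \<open>
  Joining the ends of an edge whose image is already a single edge would close a directed cycle
  of vertices with one input and one output.
\<close>

lemma no_closed_edge:
  assumes h: "part_shape G h W J" and c: "is_ext h c" and f: "f \<in> inputs G W" "f \<in> outputs G W" "f \<notin> J"
  shows "vert_image c \<noteq> {}"
proof
  assume v: "vert_image c = {}"
  note s = part_shapeD[OF h]
  have cE: "c \<in> Emb G'" using c by (simp add: is_ext_def)
  obtain e where e: "edge_shape G' c e" using Emb_edge_shape[OF cE v] .
  have "image_mset \<phi>0 (mset_set (inputs G W - J)) = {#e#}"
    using c s(6) edge_shapeD(6)[OF e] by (simp add: is_ext_def)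
  then have "size (mset_set (inputs G W - J)) = 1" by (metis size_image_mset size_single)
  then have "card (inputs G W - J) = 1" by simp
  then obtain y where "inputs G W - J = {y}" by (auto simp: card_1_singleton_iff)
  then have one: "inputs G W - J = {f}" using f(1,3) by (metis Diff_iff singletonD)
  have "wf (adj G)" using finite_acyclic_wf[OF finite_adj[OF digraph(1)] acyclic_digraphD(3)[OF acyclic(1)]] .
  \<comment> \<open>A vertex with no predecessor in \<open>W\<close>. The image of its corolla is an
    edge, so it has an input \<open>g\<close>, whose source is not in \<open>W\<close>. Then
    \<open>g\<close> is an input of \<open>h\<close> different from \<open>f\<close>, which was the
    only one.\<close>
  then obtain v where v: "v \<in> W" "\<And>y. (y, v) \<in> adj G \<Longrightarrow> y \<notin> W"
    using s(10) wfE_min'[of "adj G" W] by blast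
  have vG: "v \<in> verts G" using v(1) s(11) by blast
  note cor = corolla_sSb[OF acyclic(1) vG]
  have "D v = {}" using c \<open>vert_image c = {}\<close> v(1) s(3) by (auto simp: is_ext_def)
  then obtain x where x: "edge_shape G' (\<phi> (corolla G v)) x" using Emb_edge_shape[OF in_Emb[OF cor]] by blast
  then have "in_class (corolla G v) \<noteq> {#}"
    using in_class[OF cor] edge_shapeD(6)[OF x] by auto
  then obtain g where g: "g \<in> inputs G {v}"
    using part_shapeD(8)[OF corolla_shape[OF conn(1) vG]] by fastforce
  then have gW: "g \<in> inputs G W" using v(1) by (auto simp: inputs_def)
  have no: "g \<notin> outputs G W"
    using v(2)[of "overt G g"] g by (auto simp: adj_def outputs_def)
  then have "g \<in> inputs G W - J" using gW s(13) by blast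
  then show False using one no f(2) by simp
qed

text \<open>The cut edge \<open>f\<close> is an input and an output of \<open>h\<close>, so
  \<open>\<phi>0 f\<close> is both for \<open>c\<close>. As \<open>c\<close> has vertices,
  \<open>\<phi>0 f\<close> is a cut edge between them and can be closed.\<close>

lemma ext_add_edge:
  assumes h: "part_shape G h W J" and h': "part_shape G h' W (insert f J)" and c: "is_ext h c"
    and f: "f \<in> inputs G W" "f \<in> outputs G W" "f \<notin> J"
  shows "\<exists>c'. is_ext h' c' \<and> emb_le c c'"
proof -
  note s = part_shapeD[OF h] and s' = part_shapeD[OF h']
  define V I where "V = vert_image c" and "I = inner_edges c"
  have cE: "c \<in> Emb G'" using c by (simp add: is_ext_def)
  have pc: "part_shape G' c V I"
    unfolding V_def I_def using Emb_part_shape[OF cE no_closed_edge[OF h c f]] .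
  note sc = part_shapeD[OF pc]
  have fin: "finite (inputs G W)" "finite (outputs G W)" "finite (inputs G' V)" "finite (outputs G' V)"
    using digraph by (simp_all add: finite_inputs finite_outputs)
  have cut: "add_mset x (mset_set (X - insert x Y)) = mset_set (X - Y)"
    if "finite X" "x \<in> X" "x \<notin> Y" for x and X Y :: "'e set"
  proof -
    have "X - insert x Y = (X - Y) - {x}" by blast
    then show ?thesis using that mset_set.remove[of "X - Y" x] by simp
  qed
  have "f \<in># in_class h" "f \<in># out_class h" using s(8,9) f by auto
  then have "\<phi>0 f \<in># in_class c" "\<phi>0 f \<in># out_class c" using c by (auto simp: is_ext_def)
  then have x: "\<phi>0 f \<in> inputs G' V" "\<phi>0 f \<in> outputs G' V" "\<phi>0 f \<notin> I" using sc(8,9) by auto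
  define c' where "c' = part_class G' V (insert (\<phi>0 f) I)"
  have pc': "part_shape G' c' V (insert (\<phi>0 f) I)"
    unfolding c'_def by (rule part_class_shape[OF conn(2) connected_part_add_edge[OF sc(2) x(1,2)]])
  note sc' = part_shapeD[OF pc']
  have "add_mset (\<phi>0 f) (in_class c') = image_mset \<phi>0 (add_mset f (in_class h'))"
    unfolding sc'(6) s'(6) cut[OF fin(1) f(1,3)] cut[OF fin(3) x(1,3)]
    using c sc(6) s(6) by (simp add: is_ext_def)
  moreover have "add_mset (\<phi>0 f) (out_class c') = image_mset \<phi>0 (add_mset f (out_class h'))"
    unfolding sc'(7) s'(7) cut[OF fin(2) f(2,3)] cut[OF fin(4) x(2,3)]
    using c sc(7) s(7) by (simp add: is_ext_def)
  ultimately have "is_ext h' c'"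
    using c sc'(1,3) s(3) s'(3) by (simp add: is_ext_def V_def)
  moreover have "emb_le c c'" using part_shape_le[OF pc pc'] by blast
  ultimately show ?thesis by blast
qed

text \<open>If one of the values has no vertices, it is the edge \<open>\<phi>0 f\<close>, and the
  other value already has the required vertices and boundary. Otherwise the two values are glued
  along \<open>\<phi>0 f\<close>.\<close>

lemma ext_glue:
  assumes h1: "part_shape G h1 W1 J1" and h2: "part_shape G h2 W2 J2" and d: "W1 \<inter> W2 = {}"
    and f: "f \<in> outputs G W1" "f \<in> inputs G W2"
    and h: "part_shape G h (W1 \<union> W2) (insert f (J1 \<union> J2))"
    and c1: "is_ext h1 c1" and c2: "is_ext h2 c2"
  shows "\<exists>c. is_ext h c \<and> emb_le c1 c \<and> emb_le c2 c"
proof -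
  note s1 = part_shapeD[OF h1] and s2 = part_shapeD[OF h2] and s = part_shapeD[OF h]
  have E: "c1 \<in> Emb G'" "c2 \<in> Emb G'" using c1 c2 by (auto simp: is_ext_def)
  have fJ: "f \<notin> J1" "f \<notin> J2" using s1(12) s2(13) f d by (auto simp: inputs_def outputs_def)
  define x where "x = \<phi>0 f"
  have x: "x \<in># out_class c1" "x \<in># in_class c2"
    using c1 c2 s1(9) s2(8) f fJ by (auto simp: is_ext_def x_def)
  note gb = glue_boundary[OF digraph(1) s1(2) s2(2) d f(1) fJ(1) f(2) fJ(2)]
  have inh: "add_mset x (image_mset \<phi>0 (in_class h)) = in_class c1 + in_class c2"
    using arg_cong[OF gb(1), of "image_mset \<phi>0"] c1 c2 s(6) s1(6) s2(6) by (simp add: is_ext_def x_def)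
  have outh: "add_mset x (image_mset \<phi>0 (out_class h)) = out_class c1 + out_class c2"
    using arg_cong[OF gb(2), of "image_mset \<phi>0"] c1 c2 s(7) s1(7) s2(7) by (simp add: is_ext_def x_def)
  have V: "(\<Union>v \<in> vert_image h. D v) = vert_image c1 \<union> vert_image c2"
    using c1 c2 s(3) s1(3) s2(3) by (simp add: is_ext_def)
  have dV: "vert_image c1 \<inter> vert_image c2 = {}"
    unfolding is_ext_vert_image[OF c1] is_ext_vert_image[OF c2] s1(3) s2(3)
    using D_disjoint[OF s1(11) s2(11) d] .
  consider "vert_image c1 = {}" | "vert_image c2 = {}" | "vert_image c1 \<noteq> {}" "vert_image c2 \<noteq> {}" by blast
  then show ?thesis
  proof cases
    case 1
    obtain e where e: "edge_shape G' c1 e" using Emb_edge_shape[OF E(1) 1] .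
    note se = edge_shapeD[OF e]
    have "e = x" using x(1) se(7) by simp
    then have "is_ext h c2"
      using E inh outh V se(3,6,7) by (simp add: is_ext_def)
    moreover have "emb_le c1 c2"
      unfolding emb_le_iff[OF E] using se(3-5) \<open>e = x\<close> in_class_edges[OF E(2)] x(2) by auto
    ultimately show ?thesis using emb_le_refl[OF E(2)] by blast
  next
    case 2
    obtain e where e: "edge_shape G' c2 e" using Emb_edge_shape[OF E(2) 2] .
    note se = edge_shapeD[OF e]
    have "e = x" using x(2) se(6) by simp
    then have "is_ext h c1"
      using E inh outh V se(3,6,7) by (simp add: is_ext_def)
    moreover have "emb_le c2 c1"
      unfolding emb_le_iff[OF E(2,1)] using se(3-5) \<open>e = x\<close> out_class_edges[OF E(1)] x(1) by auto
    ultimately show ?thesis using emb_le_refl[OF E(1)] by blast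
  next
    case 3
    note p1 = Emb_part_shape[OF E(1) 3(1)] and p2 = Emb_part_shape[OF E(2) 3(2)]
    note t1 = part_shapeD[OF p1] and t2 = part_shapeD[OF p2]
    have y: "x \<in> outputs G' (vert_image c1)" "x \<notin> inner_edges c1"
      "x \<in> inputs G' (vert_image c2)" "x \<notin> inner_edges c2"
      using x t1(9) t2(8) by auto
    define c where "c = part_class G' (vert_image c1 \<union> vert_image c2)
      (insert x (inner_edges c1 \<union> inner_edges c2))"
    have pc: "part_shape G' c (vert_image c1 \<union> vert_image c2) (insert x (inner_edges c1 \<union> inner_edges c2))"
      unfolding c_def by (rule part_class_shape[OF conn(2) connected_part_glue[OF t1(2) t2(2) dV y(1,3)]])
    note t = part_shapeD[OF pc] and gb' = glue_boundary[OF digraph(2) t1(2) t2(2) dV y]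
    have "add_mset x (in_class c) = add_mset x (image_mset \<phi>0 (in_class h))"
      unfolding inh t(6) gb'(1) t1(6) t2(6) ..
    moreover have "add_mset x (out_class c) = add_mset x (image_mset \<phi>0 (out_class h))"
      unfolding outh t(7) gb'(2) t1(7) t2(7) ..
    ultimately have "is_ext h c" using t(1,3) V by (simp add: is_ext_def)
    moreover have "emb_le c1 c" "emb_le c2 c"
      using part_shape_le[OF p1 pc] part_shape_le[OF p2 pc] by auto
    ultimately show ?thesis by blast
  qed
qed

lemma is_ext_corolla: "v \<in> verts G \<Longrightarrow> is_ext (corolla G v) (\<phi> (corolla G v))"
  by (rule is_ext_sSb[OF corolla_sSb[OF acyclic(1)]])

text \<open>Serves two purposes: started at a corolla it gives existence of the extension, and
  started at an arbitrary class with vertices it gives, with uniqueness, monotonicity.\<close>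

lemma ext_mono_part:
  assumes h: "part_shape G h W J" and l: "part_shape G l W' J'" and sub: "W \<subseteq> W'" "J \<subseteq> J'"
    and c: "is_ext h c"
  shows "\<exists>d. is_ext l d \<and> emb_le c d"
proof -
  note sh = part_class_shape[OF conn(1)]
  have cE: "c \<in> Emb G'" using c by (simp add: is_ext_def)
  have trans: "emb_le c b" if "emb_le c a" "emb_le a b" "is_ext p a" "is_ext q b" for a b p q
    using emb_le_trans[OF cE] that by (auto simp: is_ext_def)
  have "\<exists>d. is_ext (part_class G W' J') d \<and> emb_le c d"
    using digraph(1) part_shapeD(2)[OF l] part_shapeD(2)[OF h] sub
  proof (induction rule: connected_part_grow)
    case start
    show ?case using c emb_le_refl[OF cE] part_class_eq[OF h] by auto
  next
    case (edge W J f)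
    obtain d where d: "is_ext (part_class G W J) d" "emb_le c d" using edge.IH by blast
    have "connected_part G W (insert f J)" by (rule connected_part_add_edge[OF edge.hyps(1-3)])
    from ext_add_edge[OF sh[OF edge.hyps(1)] sh[OF this] d(1) edge.hyps(2-4)]
    obtain d' where "is_ext (part_class G W (insert f J)) d'" "emb_le d d'" by blast
    then show ?case using trans[OF d(2) _ d(1)] by blast
  next
    case (vertex W J u f)
    obtain d where d: "is_ext (part_class G W J) d" "emb_le c d" using vertex.IH by blast
    note su = connected_part_singleton[OF vertex.hyps(2)]
    note cu = corolla_shape[OF conn(1) vertex.hyps(2)] and eu = is_ext_corolla[OF vertex.hyps(2)]
    have dis: "W \<inter> {u} = {}" "{u} \<inter> W = {}" using vertex.hyps(3) by auto
    have "\<exists>d'. is_ext (part_class G (insert u W) (insert f J)) d' \<and> emb_le d d'"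
      using vertex.hyps(5)
    proof (elim disjE conjE)
      assume f: "f \<in> outputs G W" "f \<in> inputs G {u}"
      have "part_shape G (part_class G (insert u W) (insert f J)) (W \<union> {u}) (insert f (J \<union> {}))"
        using sh[OF connected_part_glue[OF vertex.hyps(1) su dis(1) f]] by simp
      from ext_glue[OF sh[OF vertex.hyps(1)] cu dis(1) f this d(1) eu] show ?thesis by blast
    next
      assume f: "f \<in> outputs G {u}" "f \<in> inputs G W"
      have "part_shape G (part_class G (insert u W) (insert f J)) ({u} \<union> W) (insert f ({} \<union> J))"
        using sh[OF connected_part_glue[OF su vertex.hyps(1) dis(2) f]] by simp
      from ext_glue[OF cu sh[OF vertex.hyps(1)] dis(2) f this eu d(1)] show ?thesis by blast
    qed
    then show ?case using trans[OF d(2) _ d(1)] by blast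
  qed
  then show ?thesis using part_class_eq[OF l] by simp
qed

lemma edge_shape_sSb:
  assumes "edge_shape G h e"
  shows "h \<in> sSb G"
  using sSb_iff[OF acyclic(1)] edge_shapeD[OF assms] by blast

lemma ext_exists:
  assumes h: "h \<in> Emb G"
  shows "\<exists>c. is_ext h c"
proof (cases "vert_image h = {}")
  case True
  then obtain e where "edge_shape G h e" using Emb_edge_shape[OF h] by blast
  then show ?thesis using is_ext_sSb edge_shape_sSb by blast
next
  case False
  then obtain v where v: "v \<in> vert_image h" by blast
  then have vG: "v \<in> verts G" using vert_image_verts[OF h] by blast
  show ?thesis
    using ext_mono_part[OF corolla_shape[OF conn(1) vG] Emb_part_shape[OF h False] _ _ is_ext_corolla[OF vG]] v
    by blast
qed

text \<open>Growth cannot start from an edge. An edge of a class \<open>l\<close> with vertices is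
  therefore compared through the corolla of a vertex of \<open>l\<close> at one of its ends.\<close>

lemma ext_mono:
  assumes E: "h \<in> Emb G" "l \<in> Emb G" and le: "emb_le h l" and c: "is_ext h c" and d: "is_ext l d"
  shows "emb_le c d"
proof -
  have sub: "vert_image h \<subseteq> vert_image l" "edge_image h \<subseteq> edge_image l" "inner_edges h \<subseteq> inner_edges l"
    using le emb_le_iff[OF E] by auto
  have E': "c \<in> Emb G'" "d \<in> Emb G'" using c d by (auto simp: is_ext_def)
  show ?thesis
  proof (cases "vert_image h = {}")
    case False
    then have "vert_image l \<noteq> {}" using sub by blast
    from ext_mono_part[OF Emb_part_shape[OF E(1) False] Emb_part_shape[OF E(2) this] sub(1,3) c]
    show ?thesis using is_ext_unique[OF d] by blast
  next
    case True
    then obtain e where e: "edge_shape G h e" using Emb_edge_shape[OF E(1)] by blast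
    have c_eq: "c = \<phi> h" using is_ext_unique[OF c is_ext_sSb[OF edge_shape_sSb[OF e]]] .
    have sc: "edge_shape G' c (\<phi>0 e)"
      unfolding c_eq by (rule edge_image_shape[OF edge_shape_sSb[OF e] e])
    show ?thesis
    proof (cases "vert_image l = {}")
      case l: True
      then obtain e' where e': "edge_shape G l e'" using Emb_edge_shape[OF E(2)] by blast
      have "e' = e" using sub(2) edge_shapeD(4)[OF e] edge_shapeD(4)[OF e'] by simp
      then have "h = l" using edge_shape_unique[OF e, of l] e' by simp
      then show ?thesis using is_ext_unique[OF c] d emb_le_refl[OF E'(1)] by simp
    next
      case l: False
      note pl = Emb_part_shape[OF E(2) l] and e_in = edge_shapeD(4)[OF e]
      have "e \<in> inputs G (vert_image l) \<union> outputs G (vert_image l)"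
        using part_shapeD(4)[OF pl] sub(2) e_in by simp
      then obtain v where v: "v \<in> vert_image l" "e \<in> inputs G {v} \<union> outputs G {v}"
        by (auto simp: inputs_def outputs_def)
      have vG: "v \<in> verts G" using v(1) vert_image_verts[OF E(2)] by blast
      note cor = corolla_sSb[OF acyclic(1) vG] and s = part_shapeD[OF corolla_shape[OF conn(1) vG]]
      have "\<phi>0 e \<in> edge_image (\<phi> (corolla G v))"
        using v(2) s(8,9) in_class[OF cor] out_class[OF cor] in_class_edges[OF in_Emb[OF cor]]
          out_class_edges[OF in_Emb[OF cor]] by auto
      then have "emb_le c (\<phi> (corolla G v))"
        unfolding emb_le_iff[OF E'(1) in_Emb[OF cor]] using edge_shapeD[OF sc] by simp
      moreover obtain d' where "is_ext l d'" "emb_le (\<phi> (corolla G v)) d'"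
        using ext_mono_part[OF corolla_shape[OF conn(1) vG] pl _ _ is_ext_corolla[OF vG]] v(1) by blast
      ultimately show ?thesis
        using is_ext_unique[OF d] emb_le_trans[OF E'(1) in_Emb[OF cor] E'(2)] by blast
    qed
  qed
qed

definition ext :: "('e, 'v) emb set \<Rightarrow> ('e, 'v) emb set" where
  "ext = (\<lambda>h \<in> Emb G. SOME c. is_ext h c)"

lemma is_ext_ext: "h \<in> Emb G \<Longrightarrow> is_ext h (ext h)"
  using someI_ex[OF ext_exists] by (simp add: ext_def)

lemma ext_sSb: "h \<in> sSb G \<Longrightarrow> ext h = \<phi> h"
  using is_ext_unique is_ext_ext is_ext_sSb sSb_Emb by blast

lemma ext_restrict: "restrict ext (sSb G) = \<phi>"
proof
  have "\<phi> \<in> extensional (sSb G)" using mor by (simp add: G_Hom_def PiE_def)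
  then show "restrict ext (sSb G) h = \<phi> h" for h
    using ext_sSb by (cases "h \<in> sSb G") (auto simp: extensional_def)
qed

text \<open>The boundary axiom is part of \<open>is_ext\<close>. Unions follow from monotonicity and
  the formula for vertices, and vertex disjointness from the disjoint images of corollas.\<close>

lemma ext_ssb_homs: "(\<phi>0, ext) \<in> ssb_homs G G'"
proof -
  note e = is_ext_ext[unfolded is_ext_def]
  have "is_union (ext l) (ext h) (ext k)" if "l \<in> Emb G" "h \<in> Emb G" "k \<in> Emb G" "is_union l h k" for l h k
    using that ext_mono[OF that(2,1) _ is_ext_ext is_ext_ext] ext_mono[OF that(3,1) _ is_ext_ext is_ext_ext]
      e[OF that(1)] e[OF that(2)] e[OF that(3)] by (auto simp: is_union_def)
  moreover have "vertex_disjoint (ext h) (ext k)" if E: "h \<in> Emb G" "k \<in> Emb G" and "vertex_disjoint h k" for h k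
    using that D_disjoint[OF vert_image_verts[OF E(1)] vert_image_verts[OF E(2)]]
    unfolding vertex_disjoint_def is_ext_vert_image[OF is_ext_ext[OF E(1)]]
      is_ext_vert_image[OF is_ext_ext[OF E(2)]] by blast
  moreover have "\<phi>0 \<in> edges G \<rightarrow>\<^sub>E edges G'" using mor by (auto simp: G_Hom_def)
  moreover have "ext \<in> Emb G \<rightarrow>\<^sub>E Emb G'" using e by (auto simp: ext_def)
  ultimately have "(\<phi>0, ext) \<in> U_Hom G G'"
    using e by (auto simp: U_Hom_def is_edge_iff)
  moreover have "ext (id_class G) \<in> sSb G'"
    using id_class_sSb[OF acyclic(1)] ext_sSb in_sSb by simp
  ultimately show ?thesis by (simp add: ssb_homs_def U_cat_def)
qed

end

section \<open>Categories\<close>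

lemma (in subcategory) category_subcat: "category (subcat C obs homs)"
proof
  have ob: "A \<in> Ob C" if "A \<in> obs" for A using that obs_subset by blast
  have hom: "f \<in> Hom C A B" if "A \<in> obs" "B \<in> obs" "f \<in> homs A B" for A B f
    using that homs_subset by blast
  note [simp] = subcat_def ob
  show "\<And>A. A \<in> Ob (subcat C obs homs) \<Longrightarrow> Id (subcat C obs homs) A \<in> Hom (subcat C obs homs) A A"
    by (simp add: Id_in_homs)
  show "\<And>A B D f g. A \<in> Ob (subcat C obs homs) \<Longrightarrow> B \<in> Ob (subcat C obs homs) \<Longrightarrow> D \<in> Ob (subcat C obs homs)
      \<Longrightarrow> f \<in> Hom (subcat C obs homs) A B \<Longrightarrow> g \<in> Hom (subcat C obs homs) B D
      \<Longrightarrow> Comp (subcat C obs homs) A B D g f \<in> Hom (subcat C obs homs) A D"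
    by (simp add: Comp_in_homs)
  show "\<And>A B f. A \<in> Ob (subcat C obs homs) \<Longrightarrow> B \<in> Ob (subcat C obs homs) \<Longrightarrow> f \<in> Hom (subcat C obs homs) A B
      \<Longrightarrow> Comp (subcat C obs homs) A A B f (Id (subcat C obs homs) A) = f"
    by (simp add: hom Comp_Id_right)
  show "\<And>A B f. A \<in> Ob (subcat C obs homs) \<Longrightarrow> B \<in> Ob (subcat C obs homs) \<Longrightarrow> f \<in> Hom (subcat C obs homs) A B
      \<Longrightarrow> Comp (subcat C obs homs) A B B (Id (subcat C obs homs) B) f = f"
    by (simp add: hom Comp_Id_left)
  show "\<And>A B D F f g h. A \<in> Ob (subcat C obs homs) \<Longrightarrow> B \<in> Ob (subcat C obs homs) \<Longrightarrow> D \<in> Ob (subcat C obs homs)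
      \<Longrightarrow> F \<in> Ob (subcat C obs homs) \<Longrightarrow> f \<in> Hom (subcat C obs homs) A B
      \<Longrightarrow> g \<in> Hom (subcat C obs homs) B D \<Longrightarrow> h \<in> Hom (subcat C obs homs) D F
      \<Longrightarrow> Comp (subcat C obs homs) A D F h (Comp (subcat C obs homs) A B D g f)
        = Comp (subcat C obs homs) A B F (Comp (subcat C obs homs) B D F h g) f"
    by (simp add: hom Comp_assoc)
qed

text \<open>Only the functor \<open>R\<close>, which will be the restriction, has to be checked
  directly. The inverse bijections respect composition because \<open>R\<close> does and is
  injective on morphisms.\<close>

lemma cat_isomorphism_inverse:
  assumes R: "cat_functor D C (\<lambda>A. A) R" and ob: "Ob C = Ob D"
    and bij: "\<And>A B. A \<in> Ob D \<Longrightarrow> B \<in> Ob D \<Longrightarrow> bij_betw (R A B) (Hom D A B) (Hom C A B)"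
  shows "cat_isomorphism C D (\<lambda>A. A) (\<lambda>A B. inv_into (Hom D A B) (R A B))"
proof -
  interpret R: cat_functor D C "\<lambda>A. A" R by (rule R)
  let ?F = "\<lambda>A B. inv_into (Hom D A B) (R A B)"
  have FR: "?F A B (R A B f) = f" if "A \<in> Ob D" "B \<in> Ob D" "f \<in> Hom D A B" for A B f
    using bij_betw_inv_into_left[OF bij] that by blast
  have RF: "R A B (?F A B f) = f" if "A \<in> Ob D" "B \<in> Ob D" "f \<in> Hom C A B" for A B f
    using bij_betw_inv_into_right[OF bij] that by blast
  have F: "?F A B f \<in> Hom D A B" if "A \<in> Ob D" "B \<in> Ob D" "f \<in> Hom C A B" for A B f
    using bij_betw_inv_into[OF bij] bij_betwE that by blast
  have F_functor: "cat_functor C D (\<lambda>A. A) ?F"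
  proof (intro cat_functor.intro cat_functor_axioms.intro)
    show "category C" "category D" by unfold_locales
    show "?F A A (Id C A) = Id D A" if "A \<in> Ob C" for A
      using FR[of A A "Id D A"] R.Fm_Id[of A] R.C.Id_in_Hom[of A] that ob by simp
    show "?F A E (Comp C A B E g f) = Comp D A B E (?F B E g) (?F A B f)"
      if o: "A \<in> Ob C" "B \<in> Ob C" "E \<in> Ob C" and f: "f \<in> Hom C A B" and g: "g \<in> Hom C B E" for A B E f g
    proof -
      note o' = o[unfolded ob]
      note Ff = F[OF o'(1,2) f] and Fg = F[OF o'(2,3) g]
      have "R A E (Comp D A B E (?F B E g) (?F A B f)) = Comp C A B E g f"
        using R.Fm_Comp[OF o' Ff Fg] RF[OF o'(1,2) f] RF[OF o'(2,3) g] by simp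
      then show ?thesis
        using FR[OF o'(1,3) R.C.Comp_in_Hom[OF o' Ff Fg]] by simp
    qed
  qed (use F ob in auto)
  then show ?thesis
    unfolding cat_isomorphism_def cat_isomorphism_axioms_def
    using R FR RF ob by (intro conjI exI[of _ "\<lambda>A. A"] exI[of _ R]) auto
qed

section \<open>The two categories and the restriction functor\<close>

lemma image_mset_restrict_id: "set_mset M \<subseteq> A \<Longrightarrow> image_mset (\<lambda>x \<in> A. x) M = M"
  by (induction M) auto

lemma image_mset_compose: "set_mset M \<subseteq> A \<Longrightarrow> image_mset (compose A g f) M = image_mset g (image_mset f M)"
  by (induction M) (auto simp: compose_eq)

lemma in_class_subset: "c \<in> Emb G \<Longrightarrow> set_mset (in_class c) \<subseteq> edges G"
  and out_class_subset: "c \<in> Emb G \<Longrightarrow> set_mset (out_class c) \<subseteq> edges G"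
  using in_class_edges out_class_edges edge_image_edges by blast+

lemma U_Hom_Id: "((\<lambda>e \<in> edges G. e), (\<lambda>h \<in> Emb G. h)) \<in> U_Hom G G"
  by (auto simp: U_Hom_def image_mset_restrict_id in_class_subset out_class_subset)

lemma U_Hom_Comp:
  assumes "(\<phi>0, \<phi>) \<in> U_Hom G G'" "(\<psi>0, \<psi>) \<in> U_Hom G' G''"
  shows "(compose (edges G) \<psi>0 \<phi>0, compose (Emb G) \<psi> \<phi>) \<in> U_Hom G G''"
proof -
  have 1: "\<phi>0 \<in> edges G \<rightarrow> edges G'" "\<psi>0 \<in> edges G' \<rightarrow> edges G''" "\<phi> \<in> Emb G \<rightarrow> Emb G'" "\<psi> \<in> Emb G' \<rightarrow> Emb G''"
    using assms by (auto simp: U_Hom_def)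
  have E: "\<phi> h \<in> Emb G'" if "h \<in> Emb G" for h using 1(3) that by blast
  have "compose (edges G) \<psi>0 \<phi>0 \<in> edges G \<rightarrow>\<^sub>E edges G''" "compose (Emb G) \<psi> \<phi> \<in> Emb G \<rightarrow>\<^sub>E Emb G''"
    using funcset_compose[OF 1(1,2)] funcset_compose[OF 1(3,4)] by (simp_all add: PiE_def)
  then show ?thesis
    using assms E
    by (simp add: U_Hom_def compose_eq image_mset_compose in_class_subset out_class_subset)
qed

lemma G_Hom_Id: "((\<lambda>e \<in> edges G. e), (\<lambda>h \<in> sSb G. h)) \<in> G_Hom G G"
proof -
  have E: "h \<in> Emb G" if "h \<in> sSb G" for h using that sSb_Emb by blast
  show ?thesis
    using in_class_subset[OF E] out_class_subset[OF E] by (auto simp: G_Hom_def image_mset_restrict_id)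
qed

lemma G_Hom_Comp:
  assumes "(\<phi>0, \<phi>) \<in> G_Hom G G'" "(\<psi>0, \<psi>) \<in> G_Hom G' G''"
  shows "(compose (edges G) \<psi>0 \<phi>0, compose (sSb G) \<psi> \<phi>) \<in> G_Hom G G''"
proof -
  have 1: "\<phi>0 \<in> edges G \<rightarrow> edges G'" "\<psi>0 \<in> edges G' \<rightarrow> edges G''" "\<phi> \<in> sSb G \<rightarrow> sSb G'" "\<psi> \<in> sSb G' \<rightarrow> sSb G''"
    using assms by (auto simp: G_Hom_def)
  have E: "\<phi> h \<in> sSb G'" "h \<in> Emb G" if "h \<in> sSb G" for h using 1(3) that sSb_Emb by blast+
  have "compose (edges G) \<psi>0 \<phi>0 \<in> edges G \<rightarrow>\<^sub>E edges G''" "compose (sSb G) \<psi> \<phi> \<in> sSb G \<rightarrow>\<^sub>E sSb G''"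
    using funcset_compose[OF 1(1,2)] funcset_compose[OF 1(3,4)] by (simp_all add: PiE_def)
  then show ?thesis
    using assms E
    by (simp add: G_Hom_def compose_eq image_mset_compose in_class_subset out_class_subset)
qed

lemma U_Hom_funcset:
  assumes "f \<in> U_Hom G G'"
  shows "fst f \<in> edges G \<rightarrow> edges G'" "fst f \<in> extensional (edges G)"
    "snd f \<in> Emb G \<rightarrow> Emb G'" "snd f \<in> extensional (Emb G)"
  using assms by (auto simp: U_Hom_def PiE_def)

lemma G_Hom_funcset:
  assumes "f \<in> G_Hom G G'"
  shows "fst f \<in> edges G \<rightarrow> edges G'" "fst f \<in> extensional (edges G)"
    "snd f \<in> sSb G \<rightarrow> sSb G'" "snd f \<in> extensional (sSb G)"
  using assms by (auto simp: G_Hom_def PiE_def)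

lemma category_U_cat: "category U_cat"
proof
  show "\<And>A. A \<in> Ob U_cat \<Longrightarrow> Id U_cat A \<in> Hom U_cat A A" by (simp add: U_cat_def U_Hom_Id)
  show "\<And>A B D f g. A \<in> Ob U_cat \<Longrightarrow> B \<in> Ob U_cat \<Longrightarrow> D \<in> Ob U_cat \<Longrightarrow> f \<in> Hom U_cat A B
      \<Longrightarrow> g \<in> Hom U_cat B D \<Longrightarrow> Comp U_cat A B D g f \<in> Hom U_cat A D"
    by (auto simp: U_cat_def U_Hom_Comp)
  show "Comp U_cat A A B f (Id U_cat A) = f" if "f \<in> Hom U_cat A B" for A B f
    using compose_Id[OF U_Hom_funcset(1,2)[of f A B]] compose_Id[OF U_Hom_funcset(3,4)[of f A B]] that
    by (simp add: U_cat_def)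
  show "Comp U_cat A B B (Id U_cat B) f = f" if "f \<in> Hom U_cat A B" for A B f
    using Id_compose[OF U_Hom_funcset(1,2)[of f A B]] Id_compose[OF U_Hom_funcset(3,4)[of f A B]] that
    by (simp add: U_cat_def)
  show "Comp U_cat A D F h (Comp U_cat A B D g f) = Comp U_cat A B F (Comp U_cat B D F h g) f"
    if "f \<in> Hom U_cat A B" for A B D F f g h
    using compose_assoc[OF U_Hom_funcset(1)[of f A B], of "fst h" "fst g"]
      compose_assoc[OF U_Hom_funcset(3)[of f A B], of "snd h" "snd g"] that
    by (simp add: U_cat_def)
qed

lemma category_G_cat: "category G_cat"
proof
  show "\<And>A. A \<in> Ob G_cat \<Longrightarrow> Id G_cat A \<in> Hom G_cat A A" by (simp add: G_cat_def G_Hom_Id)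
  show "\<And>A B D f g. A \<in> Ob G_cat \<Longrightarrow> B \<in> Ob G_cat \<Longrightarrow> D \<in> Ob G_cat \<Longrightarrow> f \<in> Hom G_cat A B
      \<Longrightarrow> g \<in> Hom G_cat B D \<Longrightarrow> Comp G_cat A B D g f \<in> Hom G_cat A D"
    by (auto simp: G_cat_def G_Hom_Comp)
  show "Comp G_cat A A B f (Id G_cat A) = f" if "f \<in> Hom G_cat A B" for A B f
    using compose_Id[OF G_Hom_funcset(1,2)[of f A B]] compose_Id[OF G_Hom_funcset(3,4)[of f A B]] that
    by (simp add: G_cat_def)
  show "Comp G_cat A B B (Id G_cat B) f = f" if "f \<in> Hom G_cat A B" for A B f
    using Id_compose[OF G_Hom_funcset(1,2)[of f A B]] Id_compose[OF G_Hom_funcset(3,4)[of f A B]] that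
    by (simp add: G_cat_def)
  show "Comp G_cat A D F h (Comp G_cat A B D g f) = Comp G_cat A B F (Comp G_cat B D F h g) f"
    if "f \<in> Hom G_cat A B" for A B D F f g h
    using compose_assoc[OF G_Hom_funcset(1)[of f A B], of "fst h" "fst g"]
      compose_assoc[OF G_Hom_funcset(3)[of f A B], of "snd h" "snd g"] that
    by (simp add: G_cat_def)
qed

lemma ssb_homs_iff: "(\<phi>0, \<phi>) \<in> ssb_homs G G' \<longleftrightarrow> (\<phi>0, \<phi>) \<in> U_Hom G G' \<and> \<phi> (id_class G) \<in> sSb G'"
  by (simp add: ssb_homs_def U_cat_def)

lemma ssb_morphismI:
  fixes G G' :: "('e::infinite, 'v) digraph"
  assumes "acyclic_digraph G" "acyclic_digraph G'" "(\<phi>0, \<phi>) \<in> ssb_homs G G'"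
  shows "ssb_morphism G G' \<phi>0 \<phi>"
  using assms acyclic_digraphD(1) by unfold_locales (auto simp: ssb_homs_iff)

text \<open>The condition on a morphism concerns only the identity class. Closure under composition
  holds because \<open>g\<close> preserves every structured subgraph, in particular the image of
  \<open>id_class A\<close> under \<open>f\<close>.\<close>

lemma subcategory_ssb:
  "subcategory (U_cat :: (('e::infinite, 'v) digraph, ('e, 'v) gmor) cat) acyclic_objs ssb_homs"
proof (intro subcategory.intro subcategory_axioms.intro)
  show "category (U_cat :: (('e, 'v) digraph, ('e, 'v) gmor) cat)" by (rule category_U_cat)
  show "acyclic_objs \<subseteq> Ob (U_cat :: (('e, 'v) digraph, ('e, 'v) gmor) cat)"
    using acyclic_digraphD(1) by (auto simp: acyclic_objs_def U_cat_def)
  fix A B D :: "('e, 'v) digraph" and f g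
  assume A: "A \<in> acyclic_objs"
  then have aA: "acyclic_digraph A" by (simp add: acyclic_objs_def)
  show "ssb_homs A B \<subseteq> Hom U_cat A B" by (auto simp: ssb_homs_def)
  show "Id U_cat A \<in> ssb_homs A A"
    using id_class_sSb[OF aA] id_class_images(1)[OF acyclic_digraphD(1)[OF aA]]
    by (simp add: U_cat_def ssb_homs_iff U_Hom_Id)
  assume B: "B \<in> acyclic_objs" and D: "D \<in> acyclic_objs" and f: "f \<in> ssb_homs A B" and g: "g \<in> ssb_homs B D"
  obtain f0 f1 g0 g1 where fg: "f = (f0, f1)" "g = (g0, g1)" by force
  interpret g: ssb_morphism B D g0 g1
    using ssb_morphismI B D g fg by (auto simp: acyclic_objs_def)
  have "g1 (f1 (id_class A)) \<in> sSb D" using g.sSb_image f fg by (simp add: ssb_homs_iff)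
  then show "Comp U_cat A B D g f \<in> ssb_homs A D"
    using f g id_class_images(1)[OF acyclic_digraphD(1)[OF aA]] U_Hom_Comp[of f0 f1 A B g0 g1 D]
    by (simp add: U_cat_def ssb_homs_iff fg compose_eq)
qed

definition ssb_restrict ::
  "('e, 'v) digraph \<Rightarrow> ('e, 'v) digraph \<Rightarrow> ('e, 'v) gmor \<Rightarrow> ('e, 'v) gmor" where
  "ssb_restrict G G' \<phi> = (fst \<phi>, restrict (snd \<phi>) (sSb G))"

text \<open>Injectivity: corollas of an acyclic graph are structured, and a morphism is determined
  by its edge function and its values on corollas. Surjectivity: \<open>ext\<close> restricts to the
  given morphism.\<close>

lemma ssb_restrict_bij:
  fixes G G' :: "('e::infinite, 'v) digraph"
  assumes G: "acyclic_digraph G" and G': "acyclic_digraph G'"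
  shows "bij_betw (ssb_restrict G G') (ssb_homs G G') (G_Hom G G')"
proof (rule bij_betw_imageI)
  show "inj_on (ssb_restrict G G') (ssb_homs G G')"
  proof (rule inj_onI)
    fix f g assume f: "f \<in> ssb_homs G G'" and g: "g \<in> ssb_homs G G'"
      and eq: "ssb_restrict G G' f = ssb_restrict G G' g"
    have 0: "fst f = fst g" and 1: "restrict (snd f) (sSb G) = restrict (snd g) (sSb G)"
      using eq by (auto simp: ssb_restrict_def)
    have "snd f (corolla G v) = snd g (corolla G v)" if "v \<in> verts G" for v
      using fun_cong[OF 1, of "corolla G v"] corolla_sSb[OF G that] by simp
    moreover have "(fst f, snd f) \<in> U_Hom G G'" "(fst f, snd g) \<in> U_Hom G G'"
      using f g by (simp_all add: ssb_homs_def U_cat_def) (simp add: 0)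
    ultimately have "snd f = snd g"
      using U_Hom_eqI[OF acyclic_digraphD(1)[OF G] acyclic_digraphD(1)[OF G']] by blast
    then show "f = g" using 0 by (simp add: prod_eq_iff)
  qed
  show "ssb_restrict G G' ` ssb_homs G G' = G_Hom G G'"
  proof
    show "ssb_restrict G G' ` ssb_homs G G' \<subseteq> G_Hom G G'"
      using ssb_morphism.restrict_G_Hom[OF ssb_morphismI[OF G G']] by (auto simp: ssb_restrict_def)
    show "G_Hom G G' \<subseteq> ssb_restrict G G' ` ssb_homs G G'"
    proof
      fix f assume f: "f \<in> G_Hom G G'"
      then interpret G_morphism G G' "fst f" "snd f" using G G' by unfold_locales auto
      have "ssb_restrict G G' (fst f, ext) = f" by (simp add: ssb_restrict_def ext_restrict)
      then show "f \<in> ssb_restrict G G' ` ssb_homs G G'" using ext_ssb_homs by (metis imageI)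
    qed
  qed
qed

lemma ssb_restrict_functor:
  "cat_functor (subcat U_cat acyclic_objs ssb_homs) (G_cat :: (('e::infinite, 'v) digraph, ('e, 'v) gmor) cat)
    (\<lambda>G. G) ssb_restrict"
proof (intro cat_functor.intro cat_functor_axioms.intro)
  show "category (subcat U_cat acyclic_objs (ssb_homs :: ('e, 'v) digraph \<Rightarrow> _))"
    by (rule subcategory.category_subcat[OF subcategory_ssb])
  show "category (G_cat :: (('e, 'v) digraph, ('e, 'v) gmor) cat)" by (rule category_G_cat)
  fix A B E :: "('e, 'v) digraph" and f g :: "('e, 'v) gmor"
  assume A: "A \<in> Ob (subcat U_cat acyclic_objs ssb_homs)"
  then show "A \<in> Ob G_cat" by (simp add: subcat_def acyclic_objs_def G_cat_def)
  have "restrict (\<lambda>h \<in> Emb A. h) (sSb A) = (\<lambda>h \<in> sSb A. h)"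
    using sSb_Emb[of A] by (intro restrict_ext) auto
  then show "ssb_restrict A A (Id (subcat U_cat acyclic_objs ssb_homs) A) = Id G_cat A"
    by (simp add: subcat_def U_cat_def G_cat_def ssb_restrict_def)
  assume B: "B \<in> Ob (subcat U_cat acyclic_objs ssb_homs)" and f: "f \<in> Hom (subcat U_cat acyclic_objs ssb_homs) A B"
  have ac: "acyclic_digraph A" "acyclic_digraph B" and f': "f \<in> ssb_homs A B"
    using A B f by (auto simp: subcat_def acyclic_objs_def)
  show "ssb_restrict A B f \<in> Hom G_cat A B"
    using bij_betwE[OF ssb_restrict_bij[OF ac]] f' by (simp add: G_cat_def)
  have "snd f h \<in> sSb B" if "h \<in> sSb A" for h
    using ssb_morphism.sSb_image[OF ssb_morphismI[OF ac]] that f' by (metis prod.collapse)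
  then have "restrict (compose (Emb A) (snd g) (snd f)) (sSb A)
      = compose (sSb A) (restrict (snd g) (sSb B)) (restrict (snd f) (sSb A))"
    using sSb_Emb[of A] by (auto simp: compose_def restrict_def fun_eq_iff)
  then show "ssb_restrict A E (Comp (subcat U_cat acyclic_objs ssb_homs) A B E g f)
      = Comp G_cat A B E (ssb_restrict B E g) (ssb_restrict A B f)"
    by (simp add: subcat_def U_cat_def G_cat_def ssb_restrict_def)
qed

theorem theoremB18:
  shows "subcategory (U_cat :: (('e::infinite, 'v::infinite) digraph, ('e, 'v) gmor) cat)
           acyclic_objs ssb_homs
    \<and> (\<exists>\<Phi>. cat_isomorphism (G_cat :: (('e, 'v) digraph, ('e, 'v) gmor) cat)
              (subcat U_cat acyclic_objs ssb_homs) (\<lambda>G. G) \<Phi>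
          \<and> (\<forall>G \<in> acyclic_objs. \<forall>G' \<in> acyclic_objs. \<forall>\<phi> \<in> Hom G_cat G G'.
               fst (\<Phi> G G' \<phi>) = fst \<phi>))"
proof (intro conjI exI ballI)
  let ?S = "subcat U_cat acyclic_objs (ssb_homs :: ('e, 'v) digraph \<Rightarrow> _)"
  \<comment> \<open>The inverse of restriction, which sends a properadic morphism to its extension.
    As restriction leaves the edge function alone, so does its inverse.\<close>
  let ?\<Phi> = "\<lambda>G G'. inv_into (Hom ?S G G') (ssb_restrict G G')"
  have S: "Ob ?S = acyclic_objs" "Hom ?S = ssb_homs" by (simp_all add: subcat_def)
  have G: "Ob (G_cat :: (('e, 'v) digraph, ('e, 'v) gmor) cat) = acyclic_objs"
    "Hom (G_cat :: (('e, 'v) digraph, ('e, 'v) gmor) cat) = G_Hom"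
    by (simp_all add: G_cat_def acyclic_objs_def)
  have bij: "bij_betw (ssb_restrict G G') (ssb_homs G G') (G_Hom G G')"
    if "G \<in> acyclic_objs" "G' \<in> acyclic_objs" for G G' :: "('e, 'v) digraph"
    using ssb_restrict_bij that by (simp add: acyclic_objs_def)
  show "subcategory (U_cat :: (('e, 'v) digraph, ('e, 'v) gmor) cat) acyclic_objs ssb_homs"
    by (rule subcategory_ssb)
  show "cat_isomorphism (G_cat :: (('e, 'v) digraph, ('e, 'v) gmor) cat) ?S (\<lambda>G. G) ?\<Phi>"
    by (rule cat_isomorphism_inverse[OF ssb_restrict_functor]) (simp_all add: S G bij)
  fix G G' :: "('e, 'v) digraph" and \<phi>
  assume o: "G \<in> acyclic_objs" "G' \<in> acyclic_objs" and \<phi>: "\<phi> \<in> Hom G_cat G G'"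
  have "ssb_restrict G G' (?\<Phi> G G' \<phi>) = \<phi>"
    using bij_betw_inv_into_right[OF bij[OF o]] \<phi> by (simp add: S G)
  then show "fst (?\<Phi> G G' \<phi>) = fst \<phi>" by (metis fst_conv ssb_restrict_def)
qed

end
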